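(* Let $\Omega\subset\mathbb{R}^3$ be a domain, let $i_1=1$, $i_2=a_1e_1+a_2e_2$, $i_3=b_1e_1+b_2e_2$ ($a_k,b_k\in\mathbb{C}$) be linearly independent over $\mathbb{R}$ in $\mathbb{H}(\mathbb{C})$, and assume $f_1(E_3)=f_2(E_3)=\mathbb{C}$. Let $\Phi:\Omega_\zeta\to\mathbb{H}(\mathbb{C})$ be a right-$G$-monogenic mapping in $\Omega_\zeta$ and let $\widehat\Phi:\Omega_\zeta\to\mathbb{H}(\mathbb{C})$ be a left-$G$-monogenic mapping in $\Omega_\zeta$. Let $\Sigma$ be a (compact, oriented) piecewise smooth surface contained in $\Omega$ whose edge (boundary curve) $\gamma$ is a rectifiable Jordan curve. Then $$\int_{\gamma_\zeta}d\zeta\,\Phi(\zeta)=\int_{\gamma_\zeta}\widehat\Phi(\zeta)\,d\zeta=0.$$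
   Context: $\mathbb{H}(\mathbb{C})$ is the quaternion algebra over $\mathbb{C}$ with basis $1,I,J,K$ and rules $I^2=J^2=K^2=-1$, $IJ=-JI=K$, $JK=-KJ=I$, $KI=-IK=J$. With $i$ the complex imaginary unit, another basis is $$e_1=\tfrac12(1+iI),\quad e_2=\tfrac12(1-iI),\quad e_3=\tfrac12(iJ-K),\quad e_4=\tfrac12(iJ+K).$$ Its nonzero products are $e_1e_1=e_1$, $e_1e_3=e_3$, $e_2e_2=e_2$, $e_2e_4=e_4$, $e_3e_2=e_3$, $e_3e_4=e_1$, $e_4e_1=e_4$, $e_4e_3=e_2$, all other products $e_je_k$ are $0$, and $1=e_1+e_2$. $f_1,f_2:\mathbb{H}(\mathbb{C})\to\mathbb{C}$ are the $\mathbb{C}$-linear functionals with $f_1(e_1)=f_1(e_3)=1$, $f_1(e_2)=f_1(e_4)=0$, $f_2(e_2)=f_2(e_4)=1$, $f_2(e_1)=f_2(e_3)=0$. $E_3:=\{\zeta=xi_1+yi_2+zi_3: x,y,z\in\mathbb{R}\}$. For $S\subset\mathbb{R}^3$ put $S_\zeta:=\{xi_1+yi_2+zi_3:(x,y,z)\in S\}\subset E_3$; topological notions for $S_\zeta$ are those of $S$. A continuous mapping $\Phi:\Omega_\zeta\to\mathbb{H}(\mathbb{C})$ is right-$G$-monogenic in $\Omega_\zeta$ if for every $\zeta\in\Omega_\zeta$ there is $\Phi'(\zeta)\in\mathbb{H}(\mathbb{C})$ with $\lim_{\varepsilon\to0+}(\Phi(\zeta+\varepsilon h)-\Phi(\zeta))\varepsilon^{-1}=h\,\Phi'(\zeta)$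 for all $h\in E_3$. A continuous mapping $\widehat\Phi$ is left-$G$-monogenic if for every $\zeta\in\Omega_\zeta$ there is $\widehat\Phi'(\zeta)\in\mathbb{H}(\mathbb{C})$ with $\lim_{\varepsilon\to0+}(\widehat\Phi(\zeta+\varepsilon h)-\widehat\Phi(\zeta))\varepsilon^{-1}=\widehat\Phi'(\zeta)\,h$ for all $h\in E_3$. For a rectifiable curve $\gamma\subset\mathbb{R}^3$ and continuous $\Psi=\sum_{k=1}^4\Psi_ke_k:\gamma_\zeta\to\mathbb{H}(\mathbb{C})$ with $\Psi_k=U_k+iV_k$ complex-valued functions of $(x,y,z)\in\gamma$, the line integrals (with $d\zeta=dx+i_2dy+i_3dz$) are $$\int_{\gamma_\zeta}d\zeta\,\Psi(\zeta):=\sum_{k=1}^4\Big(e_k\int_\gamma\Psi_k\,dx+i_2e_k\int_\gamma\Psi_k\,dy+i_3e_k\int_\gamma\Psi_k\,dz\Big),$$ $$\int_{\gamma_\zeta}\Psi(\zeta)\,d\zeta:=\sum_{k=1}^4\Big(e_k\int_\gamma\Psi_k\,dx+e_ki_2\int_\gamma\Psi_k\,dy+e_ki_3\int_\gamma\Psi_k\,dz\Big).$$ *)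

theory Defs
  imports "HOL-Analysis.Analysis"
begin

section \<open>The algebra of complex quaternions\<close>

datatype cquat = CQ (cq1: complex) (cqI: complex) (cqJ: complex) (cqK: complex)

lemma cquat_eq_iff:
  "p = q \<longleftrightarrow> cq1 p = cq1 q \<and> cqI p = cqI q \<and> cqJ p = cqJ q \<and> cqK p = cqK q"
  by (cases p; cases q) auto

instantiation cquat :: ring_1
begin

definition "0 = CQ 0 0 0 0"
definition "1 = CQ 1 0 0 0"
definition "- p = CQ (- cq1 p) (- cqI p) (- cqJ p) (- cqK p)"
definition "p + q = CQ (cq1 p + cq1 q) (cqI p + cqI q) (cqJ p + cqJ q) (cqK p + cqK q)"
definition "p - q = CQ (cq1 p - cq1 q) (cqI p - cqI q) (cqJ p - cqJ q) (cqK p - cqK q)"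
definition "p * q = CQ
  (cq1 p * cq1 q - cqI p * cqI q - cqJ p * cqJ q - cqK p * cqK q)
  (cq1 p * cqI q + cqI p * cq1 q + cqJ p * cqK q - cqK p * cqJ q)
  (cq1 p * cqJ q - cqI p * cqK q + cqJ p * cq1 q + cqK p * cqI q)
  (cq1 p * cqK q + cqI p * cqJ q - cqJ p * cqI q + cqK p * cq1 q)"

instance
  by standard
    (auto simp: zero_cquat_def one_cquat_def uminus_cquat_def plus_cquat_def minus_cquat_def
      times_cquat_def cquat_eq_iff algebra_simps)

end

text \<open>The norm is the Euclidean norm of \<open>\<complex>\<^sup>4\<close>; it only serves to provide the topology
  (it is not submultiplicative).\<close>

instantiation cquat :: real_normed_vector
begin

definition "r *\<^sub>R p = CQ (r *\<^sub>R cq1 p) (r *\<^sub>R cqI p) (r *\<^sub>R cqJ p) (r *\<^sub>R cqK p)"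
definition "norm p = norm (cq1 p, cqI p, cqJ p, cqK p)"
definition "sgn p = inverse (norm p) *\<^sub>R (p :: cquat)"
definition "dist p q = norm (p - q :: cquat)"
definition [code del]:
  "(uniformity :: (cquat \<times> cquat) filter) = (INF e\<in>{0 <..}. principal {(p, q). dist p q < e})"
definition [code del]:
  "open (U :: cquat set) \<longleftrightarrow>
    (\<forall>p\<in>U. eventually (\<lambda>(p', q). p' = p \<longrightarrow> q \<in> U) uniformity)"

instance
proof
  fix p q :: cquat and r s :: real
  show "dist p q = norm (p - q)" by (rule dist_cquat_def)
  show "sgn p = inverse (norm p) *\<^sub>R p" by (rule sgn_cquat_def)
  show "(uniformity :: (cquat \<times> cquat) filter) = (INF e\<in>{0 <..}. principal {(p, q). dist p q < e})"
    by (rule uniformity_cquat_def)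
  show "open U \<longleftrightarrow> (\<forall>p\<in>U. eventually (\<lambda>(p', q). p' = p \<longrightarrow> q \<in> U) uniformity)"
    for U :: "cquat set" by (rule open_cquat_def)
  show "norm p = 0 \<longleftrightarrow> p = 0"
    unfolding norm_cquat_def norm_eq_zero by (simp add: zero_cquat_def zero_prod_def cquat_eq_iff)
  show "norm (p + q) \<le> norm p + norm q"
    using norm_triangle_ineq[of "(cq1 p, cqI p, cqJ p, cqK p)" "(cq1 q, cqI q, cqJ q, cqK q)"]
    by (simp add: norm_cquat_def plus_cquat_def)
  show "norm (r *\<^sub>R p) = \<bar>r\<bar> * norm p"
    using norm_scaleR[of r "(cq1 p, cqI p, cqJ p, cqK p)"]
    by (simp add: norm_cquat_def scaleR_cquat_def del: norm_scaleR)
qed (auto simp: scaleR_cquat_def plus_cquat_def cquat_eq_iff algebra_simps)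

end

instance cquat :: real_algebra_1
  by standard (auto simp: scaleR_cquat_def times_cquat_def cquat_eq_iff algebra_simps)

definition scaleC :: "complex \<Rightarrow> cquat \<Rightarrow> cquat" (infixr \<open>*\<^sub>C\<close> 75) where
  "c *\<^sub>C p = CQ (c * cq1 p) (c * cqI p) (c * cqJ p) (c * cqK p)"

definition quI :: cquat where "quI = CQ 0 1 0 0"
definition quJ :: cquat where "quJ = CQ 0 0 1 0"
definition quK :: cquat where "quK = CQ 0 0 0 1"

lemma hamilton_rules:
  "quI * quI = -1" "quJ * quJ = -1" "quK * quK = -1"
  "quI * quJ = quK" "quJ * quI = - quK" "quJ * quK = quI" "quK * quJ = - quI"
  "quK * quI = quJ" "quI * quK = - quJ"
  by (auto simp: quI_def quJ_def quK_def times_cquat_def uminus_cquat_def one_cquat_def)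

lemma cquat_expansion:
  "p = cq1 p *\<^sub>C 1 + cqI p *\<^sub>C quI + cqJ p *\<^sub>C quJ + cqK p *\<^sub>C quK"
  by (simp add: scaleC_def one_cquat_def quI_def quJ_def quK_def plus_cquat_def cquat_eq_iff)

definition qe1 :: cquat where "qe1 = (1/2) *\<^sub>C (1 + \<i> *\<^sub>C quI)"
definition qe2 :: cquat where "qe2 = (1/2) *\<^sub>C (1 - \<i> *\<^sub>C quI)"
definition qe3 :: cquat where "qe3 = (1/2) *\<^sub>C (\<i> *\<^sub>C quJ - quK)"
definition qe4 :: cquat where "qe4 = (1/2) *\<^sub>C (\<i> *\<^sub>C quJ + quK)"

lemmas qe_defs = qe1_def qe2_def qe3_def qe4_def

definition qe :: "nat \<Rightarrow> cquat" where
  "qe k = (if k = 1 then qe1 else if k = 2 then qe2 else if k = 3 then qe3 else qe4)"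

text \<open>The coordinates with respect to the basis \<open>qe 1, \<dots>, qe 4\<close>; see \<open>qcoord_expansion\<close>
  and \<open>qcoord_sum\<close> below.\<close>

definition qcoord :: "nat \<Rightarrow> cquat \<Rightarrow> complex" where
  "qcoord k p =
    (if k = 1 then cq1 p - \<i> * cqI p
     else if k = 2 then cq1 p + \<i> * cqI p
     else if k = 3 then - \<i> * cqJ p - cqK p
     else - \<i> * cqJ p + cqK p)"

lemma sum_1_4: "(\<Sum>k\<in>{1..4::nat}. F k) = F 1 + F 2 + F 3 + (F 4 :: 'a::comm_monoid_add)"
proof -
  have "{1..4::nat} = {1, 2, 3, 4}" by auto
  then show ?thesis by (simp add: add.assoc)
qed

lemma qcoord_expansion: "p = (\<Sum>k\<in>{1..4}. qcoord k p *\<^sub>C qe k)"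
  unfolding sum_1_4
  by (simp add: qe_def qcoord_def qe_defs quI_def quJ_def quK_def scaleC_def
      one_cquat_def plus_cquat_def minus_cquat_def cquat_eq_iff field_simps)

lemma qcoord_sum:
  assumes "j \<in> {1..4}"
  shows "qcoord j (\<Sum>k\<in>{1..4}. c k *\<^sub>C qe k) = c j"
proof -
  have "j = 1 \<or> j = 2 \<or> j = 3 \<or> j = 4"
    using assms by auto
  then show ?thesis
    unfolding sum_1_4
    by (auto simp: qe_def qcoord_def qe_defs quI_def quJ_def quK_def scaleC_def
        one_cquat_def plus_cquat_def minus_cquat_def field_simps)
qed

lemma qe_products:
  "qe1 * qe1 = qe1" "qe1 * qe2 = 0" "qe1 * qe3 = qe3" "qe1 * qe4 = 0"
  "qe2 * qe1 = 0" "qe2 * qe2 = qe2" "qe2 * qe3 = 0" "qe2 * qe4 = qe4"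
  "qe3 * qe1 = 0" "qe3 * qe2 = qe3" "qe3 * qe3 = 0" "qe3 * qe4 = qe1"
  "qe4 * qe1 = qe4" "qe4 * qe2 = 0" "qe4 * qe3 = qe2" "qe4 * qe4 = 0"
  "qe1 + qe2 = 1"
  by (auto simp: qe_defs quI_def quJ_def quK_def scaleC_def zero_cquat_def
      one_cquat_def plus_cquat_def minus_cquat_def times_cquat_def)

definition f1 :: "cquat \<Rightarrow> complex" where "f1 p = qcoord 1 p + qcoord 3 p"
definition f2 :: "cquat \<Rightarrow> complex" where "f2 p = qcoord 2 p + qcoord 4 p"

lemma f1_linear_basis:
  "f1 (p + q) = f1 p + f1 q" "f1 (c *\<^sub>C p) = c * f1 p"
  "f1 qe1 = 1" "f1 qe2 = 0" "f1 qe3 = 1" "f1 qe4 = 0"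
  by (auto simp: f1_def qcoord_def qe_defs quI_def quJ_def quK_def scaleC_def
      one_cquat_def plus_cquat_def minus_cquat_def algebra_simps)

lemma f2_linear_basis:
  "f2 (p + q) = f2 p + f2 q" "f2 (c *\<^sub>C p) = c * f2 p"
  "f2 qe1 = 0" "f2 qe2 = 1" "f2 qe3 = 0" "f2 qe4 = 1"
  by (auto simp: f2_def qcoord_def qe_defs quI_def quJ_def quK_def scaleC_def
      one_cquat_def plus_cquat_def minus_cquat_def algebra_simps)


section \<open>G-monogenic mappings\<close>

definition zeta :: "cquat \<Rightarrow> cquat \<Rightarrow> real^3 \<Rightarrow> cquat" where
  "zeta i2 i3 v = (v $ 1) *\<^sub>R 1 + (v $ 2) *\<^sub>R i2 + (v $ 3) *\<^sub>R i3"

definition E3 :: "cquat \<Rightarrow> cquat \<Rightarrow> cquat set" where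
  "E3 i2 i3 = range (zeta i2 i3)"

text \<open>Mappings on \<open>S\<^sub>\<zeta> = zeta i2 i3 ` S\<close>, the topology of \<open>S\<^sub>\<zeta>\<close> being that of
  \<open>S \<subseteq> \<real>\<^sup>3\<close>.\<close>

definition right_G_monogenic ::
    "cquat \<Rightarrow> cquat \<Rightarrow> (real^3) set \<Rightarrow> (cquat \<Rightarrow> cquat) \<Rightarrow> bool" where
  "right_G_monogenic i2 i3 S \<Phi> \<longleftrightarrow>
     continuous_on S (\<lambda>v. \<Phi> (zeta i2 i3 v)) \<and>
     (\<forall>\<xi> \<in> zeta i2 i3 ` S. \<exists>\<Phi>'. \<forall>h \<in> E3 i2 i3.
        ((\<lambda>\<epsilon>. (1 / \<epsilon>) *\<^sub>R (\<Phi> (\<xi> + \<epsilon> *\<^sub>R h) - \<Phi> \<xi>)) \<longlongrightarrow> h * \<Phi>') (at_right 0))"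

definition left_G_monogenic ::
    "cquat \<Rightarrow> cquat \<Rightarrow> (real^3) set \<Rightarrow> (cquat \<Rightarrow> cquat) \<Rightarrow> bool" where
  "left_G_monogenic i2 i3 S \<Phi> \<longleftrightarrow>
     continuous_on S (\<lambda>v. \<Phi> (zeta i2 i3 v)) \<and>
     (\<forall>\<xi> \<in> zeta i2 i3 ` S. \<exists>\<Phi>'. \<forall>h \<in> E3 i2 i3.
        ((\<lambda>\<epsilon>. (1 / \<epsilon>) *\<^sub>R (\<Phi> (\<xi> + \<epsilon> *\<^sub>R h) - \<Phi> \<xi>)) \<longlongrightarrow> \<Phi>' * h) (at_right 0))"


section \<open>Rectifiable curves and line integrals\<close>

definition rectifiable :: "(real \<Rightarrow> 'a::real_normed_vector) \<Rightarrow> bool" where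
  "rectifiable g \<longleftrightarrow> path g \<and>
     (\<exists>B. \<forall>d. d division_of {0..1} \<longrightarrow> (\<Sum>K\<in>d. norm (g (Sup K) - g (Inf K))) \<le> B)"

text \<open>The Riemann--Stieltjes integral over \<open>[0,1]\<close>. The gauge is constant, so the limit is
  taken as the mesh tends to zero.\<close>

definition has_rs_integral :: "(real \<Rightarrow> complex) \<Rightarrow> (real \<Rightarrow> real) \<Rightarrow> complex \<Rightarrow> bool" where
  "has_rs_integral f g I \<longleftrightarrow>
     (\<forall>\<epsilon>>0. \<exists>\<delta>>0. \<forall>p. p tagged_division_of {0..1} \<and> (\<lambda>x. ball x \<delta>) fine p \<longrightarrow>
        norm ((\<Sum>(x, K)\<in>p. (g (Sup K) - g (Inf K)) *\<^sub>R f x) - I) < \<epsilon>)"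

definition rs_integral :: "(real \<Rightarrow> complex) \<Rightarrow> (real \<Rightarrow> real) \<Rightarrow> complex" where
  "rs_integral f g = (THE I. has_rs_integral f g I)"

text \<open>\<open>coord_integral i2 i3 g \<Psi> k j\<close> is the integral of the \<open>k\<close>-th component of \<open>\<Psi>\<close>
  along \<open>g\<close> with respect to the \<open>j\<close>-th Cartesian coordinate.\<close>

definition coord_integral ::
    "cquat \<Rightarrow> cquat \<Rightarrow> (real \<Rightarrow> real^3) \<Rightarrow> (cquat \<Rightarrow> cquat) \<Rightarrow> nat \<Rightarrow> 3 \<Rightarrow> complex" where
  "coord_integral i2 i3 g \<Psi> k j =
     rs_integral (\<lambda>t. qcoord k (\<Psi> (zeta i2 i3 (g t)))) (\<lambda>t. g t $ j)"

text \<open>The integrals of \<open>d\<zeta> \<Psi>(\<zeta>)\<close> and of \<open>\<Psi>(\<zeta>) d\<zeta>\<close>, respectively.\<close>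

definition integral_dzeta_left ::
    "cquat \<Rightarrow> cquat \<Rightarrow> (real \<Rightarrow> real^3) \<Rightarrow> (cquat \<Rightarrow> cquat) \<Rightarrow> cquat" where
  "integral_dzeta_left i2 i3 g \<Psi> =
     (\<Sum>k\<in>{1..4}. coord_integral i2 i3 g \<Psi> k 1 *\<^sub>C qe k
                 + coord_integral i2 i3 g \<Psi> k 2 *\<^sub>C (i2 * qe k)
                 + coord_integral i2 i3 g \<Psi> k 3 *\<^sub>C (i3 * qe k))"

definition integral_dzeta_right ::
    "cquat \<Rightarrow> cquat \<Rightarrow> (real \<Rightarrow> real^3) \<Rightarrow> (cquat \<Rightarrow> cquat) \<Rightarrow> cquat" where
  "integral_dzeta_right i2 i3 g \<Psi> =
     (\<Sum>k\<in>{1..4}. coord_integral i2 i3 g \<Psi> k 1 *\<^sub>C qe k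
                 + coord_integral i2 i3 g \<Psi> k 2 *\<^sub>C (qe k * i2)
                 + coord_integral i2 i3 g \<Psi> k 3 *\<^sub>C (qe k * i3))"


section \<open>Piecewise smooth oriented surfaces\<close>

text \<open>A compact oriented piecewise smooth surface is given by a finite set of smooth curved
  triangles which form a coherently oriented curved triangulation of a compact topological surface
  with boundary. A curved triangle is smooth and regular in its interior; its three sides are only
  required to be rectifiable, so that the edge of the surface may be an arbitrary rectifiable curve.
  The vertices are listed counterclockwise.\<close>

definition std_vertex :: "nat \<Rightarrow> real \<times> real" where
  "std_vertex k = (if k = 0 then (0, 0) else if k = 1 then (1, 0) else (0, 1))"

definition std_triangle :: "(real \<times> real) set" where
  "std_triangle = convex hull (std_vertex ` {..<3})"

definition side :: "(real \<times> real \<Rightarrow> real^3) \<Rightarrow> nat \<Rightarrow> real \<Rightarrow> real^3" where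
  "side \<sigma> k = \<sigma> \<circ> linepath (std_vertex k) (std_vertex ((k + 1) mod 3))"

definition smooth_triangle :: "(real \<times> real \<Rightarrow> real^3) \<Rightarrow> bool" where
  "smooth_triangle \<sigma> \<longleftrightarrow>
     continuous_on std_triangle \<sigma> \<and> inj_on \<sigma> std_triangle \<and>
     (\<exists>\<sigma>' :: real \<times> real \<Rightarrow> (real \<times> real) \<Rightarrow>\<^sub>L (real^3).
        continuous_on (interior std_triangle) \<sigma>' \<and>
        (\<forall>u \<in> interior std_triangle.
           (\<sigma> has_derivative blinfun_apply (\<sigma>' u)) (at u) \<and> inj (blinfun_apply (\<sigma>' u)))) \<and>
     (\<forall>k<3. rectifiable (side \<sigma> k))"

definition surface_carrier :: "(real \<times> real \<Rightarrow> real^3) set \<Rightarrow> (real^3) set" where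
  "surface_carrier P = (\<Union>\<sigma>\<in>P. \<sigma> ` std_triangle)"

text \<open>The edge consists of the sides belonging to one triangle only.\<close>

definition surface_edge :: "(real \<times> real \<Rightarrow> real^3) set \<Rightarrow> (real^3) set" where
  "surface_edge P =
     \<Union> {path_image (side \<sigma> j) |\<sigma> j. \<sigma> \<in> P \<and> j < 3 \<and>
          (\<forall>\<tau>\<in>P - {\<sigma>}. \<forall>k<3. path_image (side \<tau> k) \<noteq> path_image (side \<sigma> j))}"

definition topological_surface :: "'a::topological_space set \<Rightarrow> bool" where
  "topological_surface S \<longleftrightarrow>
     (\<forall>p\<in>S. \<exists>U V. p \<in> U \<and> openin (top_of_set S) U \<and>
        openin (top_of_set {w :: real \<times> real. 0 \<le> snd w}) V \<and> U homeomorphic V)"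

text \<open>Distinct triangles meet in a common vertex or in a common side or not at all. Two triangles
  with a common side are coherently oriented when they traverse it in opposite directions.\<close>

definition pw_smooth_oriented_surface :: "(real \<times> real \<Rightarrow> real^3) set \<Rightarrow> bool" where
  "pw_smooth_oriented_surface P \<longleftrightarrow>
     finite P \<and> (\<forall>\<sigma>\<in>P. smooth_triangle \<sigma>) \<and>
     topological_surface (surface_carrier P) \<and>
     (\<forall>\<sigma>\<in>P. \<forall>\<tau>\<in>P. \<sigma> \<noteq> \<tau> \<longrightarrow>
        \<sigma> ` std_triangle \<inter> \<tau> ` std_triangle = {} \<or>
        (\<exists>j<3. \<exists>k<3. \<sigma> (std_vertex j) = \<tau> (std_vertex k) \<and>
           \<sigma> ` std_triangle \<inter> \<tau> ` std_triangle = {\<sigma> (std_vertex j)}) \<or>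
        (\<exists>j<3. \<exists>k<3. path_image (side \<sigma> j) = path_image (side \<tau> k) \<and>
           \<sigma> ` std_triangle \<inter> \<tau> ` std_triangle = path_image (side \<sigma> j) \<and>
           pathstart (side \<sigma> j) = pathfinish (side \<tau> k) \<and>
           pathfinish (side \<sigma> j) = pathstart (side \<tau> k)))"

end

theory Submission
  imports Defs "HOL-Complex_Analysis.Conformal_Mappings"
begin

text \<open>
  Multiplication by \<open>\<zeta> = \<xi>\<^sub>1 e\<^sub>1 + \<xi>\<^sub>2 e\<^sub>2\<close> is diagonal in the basis \<open>e\<^sub>1, \<dots>, e\<^sub>4\<close>, and \<open>\<xi>\<^sub>1, \<xi>\<^sub>2\<close> are
  the restrictions of \<open>f\<^sub>1, f\<^sub>2\<close>, i.e. real-linear surjections from \<open>\<real>\<^sup>3\<close> to \<open>\<complex>\<close>. So both claims split into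
  four scalar ones: a component \<open>\<phi>\<close> of the mapping has at each point of \<open>\<Omega>\<close> directional derivatives of the
  form \<open>c \<xi>(h)\<close>, where \<open>\<xi>\<close> is \<open>\<xi>\<^sub>1\<close> or \<open>\<xi>\<^sub>2\<close>, and the integral of \<open>\<phi> d\<xi>\<close> along \<open>\<gamma>\<close> has to vanish.

  The form \<open>\<phi> d\<xi>\<close> is locally exact. Indeed \<open>\<phi>\<close> is constant on the segments on which \<open>\<xi>\<close> is constant, so
  locally \<open>\<phi> = F \<circ> \<xi>\<close> with a continuous function \<open>F\<close> on a disc that has complex-linear directional
  derivatives at each point. Such an \<open>F\<close> is holomorphic; this is a theorem of Looman--Menchoff type
  (\<open>directionally_differentiable_imp_holomorphic\<close>). If \<open>G' = F\<close>, then \<open>G \<circ> \<xi>\<close> is a local primitive.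

  Every locally exact form has period zero along the edge of a surface (\<open>loop_period_zero\<close>). The form has a
  primitive on each triangle, which is a homeomorphic image of a convex set, so its increments along the
  three sides add up to zero. Increments along a side shared by two triangles cancel, because the orientations are opposite. Hence the increments along the sides that make up
  the edge add up to zero. To pass from these sides to \<open>\<gamma>\<close> no ordering of the sides along the loop is needed:
  one removes from the loop a point \<open>z\<close> that is not a vertex and compares the primitives on the triangles
  with a primitive on the remaining open arc. They differ by a constant on each side that does not contain
  \<open>z\<close>, hence the increments of both agree also along the side through \<open>z\<close>; but there they could
  only differ by the period of the form along \<open>\<gamma>\<close>, which is therefore zero.

  Rectifiability of \<open>\<gamma>\<close> is what makes the Riemann--Stieltjes integrals exist and equal the increment of a
  primitive along \<open>\<gamma>\<close> (\<open>line_integral_eq_primitive_increment\<close>).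
\<close>

section \<open>Functions with complex-linear directional derivatives\<close>

text \<open>The quotient \<open>g w / w\<close> is bounded by \<open>B\<close> on the frontier, but at the corner \<open>0\<close> it may blow up like
  \<open>o(1 / \<bar>w\<bar>)\<close>. In a quadrant the factor \<open>exp (- \<epsilon> (1 + \<i>) / w)\<close> has modulus at most
  \<open>exp (- \<epsilon> / \<bar>w\<bar>)\<close>, which removes the singularity; the maximum principle applies to the damped
  quotient, and \<open>\<epsilon>\<close> tends to \<open>0\<close>.\<close>

lemma phragmen_lindelof_quadrant:
  fixes g :: "complex \<Rightarrow> complex"
  assumes V: "open V" "bounded V" and quad: "\<And>w. w \<in> V \<Longrightarrow> 0 < Re w \<and> 0 < Im w"
    and holo: "g holomorphic_on V" and cont: "continuous_on (closure V) g"
    and bound: "\<And>w. w \<in> frontier V \<Longrightarrow> norm (g w) \<le> B * norm w"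
    and w: "w \<in> V"
  shows "norm (g w) \<le> B * norm w"
proof -
  define k where "k \<epsilon> z = (if z = 0 then 0 else g z / z * exp (- (complex_of_real \<epsilon> * (1 + \<i>) / z)))"
    for \<epsilon> and z :: complex
  have w0: "w \<noteq> 0"
    using quad[OF w] by auto
  have V0: "z \<noteq> 0" if "z \<in> V" for z
    using quad[OF that] by auto
  have closed_quadrant: "0 \<le> Re z \<and> 0 \<le> Im z" if "z \<in> closure V" for z
  proof -
    have "closure V \<subseteq> {z. 0 \<le> Re z} \<inter> {z. 0 \<le> Im z}"
      by (rule closure_minimal)
        (use quad in \<open>force intro: closed_halfspace_Re_ge closed_halfspace_Im_ge\<close>)+
    then show ?thesis using that by auto
  qed
  have damping: "norm (exp (- (complex_of_real \<epsilon> * (1 + \<i>) / z))) \<le> exp (- (\<epsilon> / norm z))"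
    if "z \<in> closure V" "z \<noteq> 0" "\<epsilon> > 0" for \<epsilon> z
  proof -
    have "Re ((1 + \<i>) / z) = (Re z + Im z) / (norm z)\<^sup>2"
      by (simp add: Re_divide cmod_power2)
    moreover have "norm z \<le> Re z + Im z"
      using closed_quadrant[OF that(1)] cmod_le[of z] by simp
    ultimately have "1 / norm z \<le> Re ((1 + \<i>) / z)"
      using that(2) by (simp only:) (simp add: field_simps power2_eq_square)
    then have "\<epsilon> * (1 / norm z) \<le> \<epsilon> * Re ((1 + \<i>) / z)"
      using \<open>\<epsilon> > 0\<close> by (intro mult_left_mono) auto
    moreover have "Re (complex_of_real \<epsilon> * (1 + \<i>) / z) = \<epsilon> * Re ((1 + \<i>) / z)"
      by (simp flip: times_divide_eq_right)
    ultimately show ?thesis by simp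
  qed
  have damped: "norm (g w) / norm w * norm (exp (- (complex_of_real \<epsilon> * (1 + \<i>) / w))) \<le> B"
    if "\<epsilon> > 0" for \<epsilon>
  proof -
    have "norm (k \<epsilon> w) \<le> B"
    proof (rule maximum_modulus_frontier[of "k \<epsilon>" V B w])
      have "(\<lambda>z. g z / z * exp (- (complex_of_real \<epsilon> * (1 + \<i>) / z))) holomorphic_on V"
        using V0 by (intro holomorphic_intros holo) auto
      then show "k \<epsilon> holomorphic_on interior V"
        using V0 unfolding interior_open[OF V(1)]
        by (rule_tac holomorphic_transform) (auto simp: k_def)
      show "continuous_on (closure V) (k \<epsilon>)"
        unfolding continuous_on_eq_continuous_within
      proof
        fix z assume z: "z \<in> closure V"
        show "continuous (at z within closure V) (k \<epsilon>)"
        proof (cases "z = 0")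
          case False
          have "continuous (at z within closure V) (\<lambda>z. g z / z * exp (- (complex_of_real \<epsilon> * (1 + \<i>) / z)))"
            using False cont z unfolding continuous_on_eq_continuous_within
            by (intro continuous_intros) auto
          moreover have "\<forall>\<^sub>F y in at z within closure V. y \<noteq> 0"
            using False by (intro tendsto_imp_eventually_ne[OF tendsto_ident_at])
          then have "\<forall>\<^sub>F y in at z within closure V.
              k \<epsilon> y = g y / y * exp (- (complex_of_real \<epsilon> * (1 + \<i>) / y))"
            by eventually_elim (simp add: k_def)
          moreover have "k \<epsilon> z = g z / z * exp (- (complex_of_real \<epsilon> * (1 + \<i>) / z))"
            using False by (simp add: k_def)
          ultimately show ?thesis
            unfolding continuous_within by (simp only: tendsto_cong)
        next
          case True
          have "z \<in> frontier V"
            using z V0[of z] True unfolding frontier_def interior_open[OF V(1)] by blast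
          then have g0: "g 0 = 0"
            using bound[of 0] True by simp
          have "((\<lambda>y. norm (g y) / \<epsilon>) \<longlongrightarrow> norm (g 0) / \<epsilon>) (at 0 within closure V)"
            using cont z True \<open>\<epsilon> > 0\<close> unfolding continuous_on by (intro tendsto_intros) auto
          moreover have "norm (k \<epsilon> y) \<le> norm (g y) / \<epsilon>" if y: "y \<in> closure V" "y \<noteq> 0" for y
          proof -
            have "\<epsilon> / norm y \<le> exp (\<epsilon> / norm y)"
              using exp_ge_add_one_self[of "\<epsilon> / norm y"] by linarith
            then have "exp (- (\<epsilon> / norm y)) \<le> norm y / \<epsilon>"
              using \<open>\<epsilon> > 0\<close> y by (simp add: exp_minus field_simps)
            then have "norm (exp (- (complex_of_real \<epsilon> * (1 + \<i>) / y))) \<le> norm y / \<epsilon>"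
              using damping[OF y \<open>\<epsilon> > 0\<close>] by linarith
            then have "norm (g y) / norm y * norm (exp (- (complex_of_real \<epsilon> * (1 + \<i>) / y)))
                \<le> norm (g y) / norm y * (norm y / \<epsilon>)"
              by (rule mult_left_mono) simp
            then show ?thesis
              using y by (simp add: k_def norm_mult norm_divide)
          qed
          then have "\<forall>\<^sub>F y in at 0 within closure V. norm (k \<epsilon> y) \<le> norm (g y) / \<epsilon>"
            by (simp add: eventually_at_filter)
          ultimately have "(k \<epsilon> \<longlongrightarrow> 0) (at 0 within closure V)"
            using Lim_null_comparison by (simp add: g0)
          then show ?thesis
            unfolding continuous_within True by (simp add: k_def)
        qed
      qed
      fix z assume z: "z \<in> frontier V"
      then have zc: "z \<in> closure V" by (simp add: frontier_def)
      have B0: "0 \<le> B"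
      proof -
        \<comment> \<open>otherwise the maximum principle for the identity would give \<open>w = 0\<close>\<close>
        have "frontier V \<noteq> {0}"
        proof
          assume fr: "frontier V = {0}"
          have "norm w \<le> 0"
            by (rule maximum_modulus_frontier[of "\<lambda>z. z" V 0 w]) (use V w fr in \<open>auto simp: frontier_def\<close>)
          then show False using w0 by simp
        qed
        then obtain y where "y \<in> frontier V" "y \<noteq> 0" using z by blast
        then show ?thesis
          using order_trans[OF norm_ge_zero bound[of y]]
          by (simp add: zero_le_mult_iff)
      qed
      show "norm (k \<epsilon> z) \<le> B"
      proof (cases "z = 0")
        case False
        have "norm (exp (- (complex_of_real \<epsilon> * (1 + \<i>) / z))) \<le> 1"
          by (rule order_trans[OF damping[OF zc False \<open>\<epsilon> > 0\<close>]]) (use \<open>\<epsilon> > 0\<close> in simp)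
        moreover have "norm (g z) / norm z \<le> B"
          using bound[OF z] False by (simp add: field_simps)
        ultimately have "norm (g z) / norm z * norm (exp (- (complex_of_real \<epsilon> * (1 + \<i>) / z))) \<le> B * 1"
          using B0 by (intro mult_mono) auto
        then show ?thesis using False by (simp add: k_def norm_mult norm_divide)
      qed (simp add: k_def B0)
    qed (use V w in auto)
    then show ?thesis using w0 by (simp add: k_def norm_mult norm_divide)
  qed
  have "((\<lambda>\<epsilon>. norm (g w) / norm w * norm (exp (- (complex_of_real \<epsilon> * (1 + \<i>) / w))))
      \<longlongrightarrow> norm (g w) / norm w * norm (exp (- (complex_of_real 0 * (1 + \<i>) / w)))) (at_right 0)"
    using w0 by (intro tendsto_intros) auto
  then have "norm (g w) / norm w * norm (exp (- (complex_of_real 0 * (1 + \<i>) / w))) \<le> B"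
    by (rule tendsto_upperbound)
      (use damped in \<open>auto simp: eventually_at_filter\<close>)
  then show ?thesis using w0 by (simp add: field_simps)
qed

text \<open>By the Lipschitz bound the difference quotients depend on the direction uniformly continuously, uniformly
  in the step. So convergence in the finitely many directions of a net of the unit circle is uniform
  convergence in all directions.\<close>

lemma directional_Lipschitz_imp_differentiable:
  fixes f :: "complex \<Rightarrow> complex"
  assumes r: "r > 0" and Lip: "\<And>x y. x \<in> ball z r \<Longrightarrow> y \<in> ball z r \<Longrightarrow> norm (f x - f y) \<le> L * norm (x - y)"
    and dir: "\<And>w. ((\<lambda>t. (f (z + of_real t * w) - f z) / of_real t) \<longlongrightarrow> c * w) (at_right 0)"
  shows "(f has_field_derivative c) (at z)"
proof -
  have L: "L \<ge> 0"
  proof -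
    have "0 \<le> L * norm (z - (z + of_real (r/2)))"
      by (rule order_trans[OF norm_ge_zero Lip]) (use r in \<open>auto simp: dist_norm\<close>)
    then show ?thesis using r by (simp add: zero_le_mult_iff)
  qed
  have main: "\<exists>d>0. \<forall>h. norm h < d \<longrightarrow> norm (f (z + h) - f z - c * h) \<le> e * norm h" if e: "e > 0" for e
  proof -
    \<comment> \<open>the mesh of the net: moving the direction by \<open>e'\<close> costs at most \<open>(L + \<bar>c\<bar>) e' \<le> e / 2\<close>\<close>
    define e' where "e' = e / (2 * (L + norm c + 1))"
    have pos: "L + norm c + 1 > 0" using L norm_ge_zero[of c] by linarith
    have e': "e' > 0" using e pos by (simp add: e'_def)
    have "sphere 0 1 \<subseteq> (\<Union>w\<in>sphere 0 1. ball (w::complex) e')"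
      using e' by auto
    then obtain N where N: "N \<subseteq> sphere 0 1" "finite N" "sphere 0 1 \<subseteq> (\<Union>w\<in>N. ball (w::complex) e')"
      by (rule compactE_image[OF compact_sphere, rotated]) auto
    have "\<forall>\<^sub>F t in at_right 0. norm ((f (z + of_real t * w) - f z) / of_real t - c * w) < e / 2" for w
      using tendstoD[OF dir[of w], of "e/2"] e by (simp add: dist_norm)
    then have "\<forall>\<^sub>F t in at_right 0. \<forall>w\<in>N. norm ((f (z + of_real t * w) - f z) / of_real t - c * w) < e / 2"
      using N(2) by (simp add: eventually_ball_finite_distrib)
    then obtain b where b: "b > 0"
      "\<And>t w. 0 < t \<Longrightarrow> t < b \<Longrightarrow> w \<in> N \<Longrightarrow> norm ((f (z + of_real t * w) - f z) / of_real t - c * w) < e / 2"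
      unfolding eventually_at_right_field by auto
    show ?thesis
    proof (intro exI[of _ "min b r"] conjI allI impI)
      show "min b r > 0" using b r by simp
      fix h :: complex assume h: "norm h < min b r"
      show "norm (f (z + h) - f z - c * h) \<le> e * norm h"
      proof (cases "h = 0")
        case False
        define t where "t = norm h"
        have t: "0 < t" "t < b" "t < r" using h False by (auto simp: t_def)
        have "h / of_real t \<in> sphere 0 1" using False by (simp add: t_def norm_divide)
        then obtain w where w: "w \<in> N" "norm (w - h / of_real t) < e'"
          using N(3) by (auto simp: dist_norm)
        have nw: "norm w = 1" using N(1) w(1) by auto
        have wh: "norm (of_real t * w - h) \<le> t * e'"
        proof -
          have "of_real t * w - h = of_real t * (w - h / of_real t)"
            using t by (simp add: field_simps)
          then have "norm (of_real t * w - h) = t * norm (w - h / of_real t)"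
            using t by (simp add: norm_mult)
          then show ?thesis using w(2) t by (simp add: mult_left_mono)
        qed
        have "norm (f (z + of_real t * w) - f z - c * (of_real t * w)) \<le> t * (e / 2)"
        proof -
          have "f (z + of_real t * w) - f z - c * (of_real t * w)
              = of_real t * ((f (z + of_real t * w) - f z) / of_real t - c * w)"
            using t by (simp add: field_simps)
          then have "norm (f (z + of_real t * w) - f z - c * (of_real t * w))
              = t * norm ((f (z + of_real t * w) - f z) / of_real t - c * w)"
            using t by (simp add: norm_mult)
          then show ?thesis using b(2)[OF t(1,2) w(1)] t by (simp add: mult_left_mono)
        qed
        moreover have "norm (f (z + h) - f (z + of_real t * w)) \<le> L * (t * e')"
        proof -
          have "norm (f (z + h) - f (z + of_real t * w)) \<le> L * norm ((z + h) - (z + of_real t * w))"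
            by (rule Lip) (use t nw in \<open>auto simp: dist_norm norm_mult t_def\<close>)
          also have "\<dots> \<le> L * (t * e')"
            using wh L by (intro mult_left_mono) (auto simp: norm_minus_commute)
          finally show ?thesis .
        qed
        moreover have "norm (c * (of_real t * w - h)) \<le> norm c * (t * e')"
          unfolding norm_mult by (intro mult_left_mono wh) simp
        ultimately have "norm ((f (z + of_real t * w) - f z - c * (of_real t * w))
            + (f (z + h) - f (z + of_real t * w)) + c * (of_real t * w - h))
            \<le> t * (e / 2) + L * (t * e') + norm c * (t * e')"
          by (intro norm_triangle_le add_mono)
        also have "\<dots> \<le> t * (e / 2) + (L + norm c + 1) * (t * e')"
          using t e' by (simp add: algebra_simps)
        also have "\<dots> = t * e" using pos by (simp add: e'_def field_simps)
        finally show ?thesis by (simp add: t_def algebra_simps)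
      qed simp
    qed
  qed
  show ?thesis
    unfolding has_field_derivative_def has_derivative_at_alt
  proof (intro conjI allI impI)
    show "bounded_linear ((*) c)" by (rule bounded_linear_mult_right)
    fix e :: real assume "e > 0"
    from main[OF this] obtain d where d: "d > 0" "\<And>h. norm h < d \<Longrightarrow> norm (f (z + h) - f z - c * h) \<le> e * norm h"
      by blast
    show "\<exists>d>0. \<forall>y. norm (y - z) < d \<longrightarrow> norm (f y - f z - c * (y - z)) \<le> e * norm (y - z)"
      using d(1) d(2)[of "y - z" for y] by (intro exI[of _ d]) (auto simp: algebra_simps)
  qed
qed

text \<open>If both points lie in \<open>E\<close>, pass through the corner \<open>(Re p, Im q)\<close>. For other points the estimate is
  known on the frontier of the part of a quadrant at \<open>p\<close> that lies in the ball and outside \<open>E\<close>: on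
  the two rays by assumption, on \<open>E\<close> by the case just treated, and on the circle because there
  \<open>\<bar>z - p\<bar> \<ge> \<delta> / 2\<close>. The Phragmen--Lindelof bound carries it to the interior.\<close>

lemma Lipschitz_from_cross_bounds:
  fixes f :: "complex \<Rightarrow> complex"
  assumes cont: "continuous_on (cball z0 \<delta>) f" and E: "closed E"
    and holo: "f holomorphic_on ball z0 \<delta> - E"
    and M: "\<And>z. z \<in> cball z0 \<delta> \<Longrightarrow> norm (f z) \<le> M"
    and cross: "\<And>q t u. q \<in> E \<Longrightarrow> q \<in> cball z0 \<delta> \<Longrightarrow> 0 \<le> t \<Longrightarrow> t \<le> 2 * \<delta> \<Longrightarrow> u \<in> {1, \<i>, -1, -\<i>} \<Longrightarrow>
        norm (f (q + of_real t * u) - f q) \<le> n * t"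
    and n: "n \<ge> 0" and p: "p \<in> E" "p \<in> ball z0 (\<delta> / 2)" and z: "z \<in> ball z0 \<delta>"
  shows "norm (f z - f p) \<le> (2 * n + 4 * M / \<delta>) * norm (z - p)"
proof -
  define B where "B = 2 * n + 4 * M / \<delta>"
  have \<delta>: "\<delta> > 0" using p(2) by (metis dist_nz half_gt_zero_iff mem_ball le_less_trans zero_le_dist)
  have M0: "M \<ge> 0" using M[of z0] \<delta> norm_ge_zero[of "f z0"] by (simp del: norm_ge_zero)
  have B: "n \<le> B" "2 * n \<le> B" "4 * M / \<delta> \<le> B" "B \<ge> 0"
    using n M0 \<delta> by (auto simp: B_def)
  have pc: "p \<in> cball z0 \<delta>" using p(2) \<delta> by simp
  have horiz: "norm (f (q + of_real s) - f q) \<le> n * \<bar>s\<bar>" if "q \<in> E" "q \<in> cball z0 \<delta>" "\<bar>s\<bar> \<le> 2 * \<delta>" for q s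
    using cross[OF that(1,2), of s 1] cross[OF that(1,2), of "-s" "-1"] that(3) by (cases "s \<ge> 0") auto
  have vert: "norm (f (q + \<i> * of_real s) - f q) \<le> n * \<bar>s\<bar>" if "q \<in> E" "q \<in> cball z0 \<delta>" "\<bar>s\<bar> \<le> 2 * \<delta>" for q s
    using cross[OF that(1,2), of s \<i>] cross[OF that(1,2), of "-s" "-\<i>"] that(3)
    by (cases "s \<ge> 0") (auto simp: mult.commute)
  have inE: "norm (f q - f p) \<le> B * norm (q - p)" if q: "q \<in> E" "q \<in> cball z0 \<delta>" for q
  proof -
    define r where "r = Complex (Re p) (Im q)"
    have "dist q p \<le> 2 * \<delta>"
      using dist_triangle[of q p z0] q(2) pc by (simp add: dist_commute)
    then have le: "norm (q - p) \<le> 2 * \<delta>" by (simp add: dist_norm)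
    have rp: "r = p + \<i> * of_real (Im (q - p))" and rq: "r = q + of_real (Re (p - q))"
      by (auto simp: r_def complex_eq_iff)
    have "norm (f r - f p) \<le> n * \<bar>Im (q - p)\<bar>"
      unfolding rp using p(1) pc le abs_Im_le_cmod[of "q - p"] by (intro vert) auto
    moreover have "norm (f r - f q) \<le> n * \<bar>Re (p - q)\<bar>"
      unfolding rq using q le abs_Re_le_cmod[of "q - p"] by (intro horiz) (auto simp: norm_minus_commute)
    moreover have "norm (f q - f p) \<le> norm (f r - f p) + norm (f r - f q)"
      by (metis norm_triangle_sub diff_diff_eq2 norm_minus_commute add.commute diff_add_cancel norm_triangle_ineq4 diff_diff_add diff_add_eq_diff_diff_swap)
    moreover have "n * \<bar>Im (q - p)\<bar> + n * \<bar>Re (p - q)\<bar> \<le> 2 * n * norm (q - p)"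
      using mult_left_mono[OF abs_Im_le_cmod[of "q - p"] n] mult_left_mono[OF abs_Re_le_cmod[of "p - q"] n]
      by (simp add: norm_minus_commute)
    moreover have "2 * n * norm (q - p) \<le> B * norm (q - p)"
      using B by (intro mult_right_mono) auto
    ultimately show ?thesis by linarith
  qed
  \<comment> \<open>the four quadrants at \<open>p\<close> are turned into the first one by a unit \<open>u\<close>\<close>
  have quadrant: "norm (f z - f p) \<le> B * norm (z - p)"
    if u: "u \<in> {1, \<i>, -1, -\<i>}" and zE: "z \<notin> E" and pos: "0 < Re ((z - p) / u)" "0 < Im ((z - p) / u)" for u
  proof -
    have nu: "norm u = 1" using u by auto
    then have u0: "u \<noteq> 0" by auto
    have iu: "\<i> * u \<in> {1, \<i>, -1, -\<i>}" using u by auto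
    define g where "g w = f (p + u * w) - f p" for w
    define A where "A = (\<lambda>w. p + u * w) -` (ball z0 \<delta> - E)"
    define V where "V = A \<inter> {w. 0 < Re w} \<inter> {w. 0 < Im w}"
    have contA: "continuous_on S (\<lambda>w. p + u * w)" for S by (intro continuous_intros)
    have V: "open V"
      unfolding V_def A_def using E
      by (intro open_Int open_halfspace_Re_gt open_halfspace_Im_gt open_vimage contA) auto
    have Acl: "closure V \<subseteq> ((\<lambda>w. p + u * w) -` cball z0 \<delta>) \<inter> {w. 0 \<le> Re w} \<inter> {w. 0 \<le> Im w}"
      by (rule closure_minimal)
        (auto simp: V_def A_def intro!: closed_Int closed_halfspace_Re_ge closed_halfspace_Im_ge
           closed_vimage contA)
    have bounded: "bounded V"
    proof (rule boundedI)
      fix w assume "w \<in> V"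
      then have "dist z0 (p + u * w) < \<delta>" by (simp add: V_def A_def)
      then have "dist p (p + u * w) \<le> 2 * \<delta>" using pc dist_triangle[of p "p + u * w" z0]
        by (simp add: dist_commute)
      then show "norm w \<le> 2 * \<delta>" by (simp add: dist_norm norm_mult nu)
    qed
    have "norm (g ((z - p) / u)) \<le> B * norm ((z - p) / u)"
    proof (rule phragmen_lindelof_quadrant[of V])
      show "g holomorphic_on V"
        unfolding g_def
        by (intro holomorphic_intros holomorphic_on_compose_gen[OF _ holo, unfolded o_def])
          (auto simp: V_def A_def)
      show "continuous_on (closure V) g"
        unfolding g_def using Acl
        by (intro continuous_intros continuous_on_compose2[OF cont contA]) auto
      show "norm (g w) \<le> B * norm w" if w: "w \<in> frontier V" for w
      proof -
        have w': "p + u * w \<in> cball z0 \<delta>" "0 \<le> Re w" "0 \<le> Im w"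
          using w Acl by (auto simp: frontier_def)
        have nw: "norm (p + u * w - p) = norm w" by (simp add: norm_mult nu)
        have "dist p (p + u * w) \<le> 2 * \<delta>"
          using w'(1) pc dist_triangle[of p "p + u * w" z0] by (simp add: dist_commute)
        then have nw2: "norm w \<le> 2 * \<delta>" by (simp add: dist_norm norm_mult nu)
        have "w \<notin> V" using w V by (simp add: frontier_def interior_open)
        then consider "p + u * w \<in> E" | "Re w = 0" | "Im w = 0" | "dist z0 (p + u * w) = \<delta>"
          using w' by (force simp: V_def A_def)
        then show ?thesis
        proof cases
          case 1
          then show ?thesis using inE[OF 1 w'(1)] nw by (simp add: g_def)
        next
          case 2
          then have w: "w = \<i> * of_real (Im w)" by (simp add: complex_eq_iff)
          have nI: "norm w = Im w" using 2 w'(3) by (simp add: cmod_def)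
          have "norm (f (p + of_real (Im w) * (\<i> * u)) - f p) \<le> n * Im w"
            using nI nw2 w' by (intro cross p(1) pc iu) auto
          moreover have "p + of_real (Im w) * (\<i> * u) = p + u * w" by (subst (2) w) simp
          moreover have "n * norm w \<le> B * norm w" using B by (intro mult_right_mono) auto
          ultimately show ?thesis using nI by (simp add: g_def)
        next
          case 3
          then have w: "w = of_real (Re w)" by (simp add: complex_eq_iff)
          have nR: "norm w = Re w" using 3 w'(2) by (simp add: cmod_def)
          have "norm (f (p + of_real (Re w) * u) - f p) \<le> n * Re w"
            using nR nw2 w' by (intro cross p(1) pc u) auto
          moreover have "p + of_real (Re w) * u = p + u * w" by (subst (2) w) simp
          moreover have "n * norm w \<le> B * norm w" using B by (intro mult_right_mono) auto
          ultimately show ?thesis using nR by (simp add: g_def)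
        next
          case 4
          have "dist p (p + u * w) \<ge> \<delta> / 2"
            using dist_triangle[of z0 "p + u * w" p] 4 p(2) by simp
          then have "norm w \<ge> \<delta> / 2" by (simp add: dist_norm norm_mult nu)
          then have "4 * M / \<delta> * (\<delta> / 2) \<le> B * norm w"
            using B \<delta> M0 by (intro mult_mono) auto
          then have "2 * M \<le> B * norm w" using \<delta> by simp
          moreover have "norm (g w) \<le> M + M"
            unfolding g_def by (rule norm_triangle_le_diff[OF add_mono[OF M[OF w'(1)] M[OF pc]]])
          ultimately show ?thesis by simp
        qed
      qed
      show "(z - p) / u \<in> V" using pos z zE u0 by (simp add: V_def A_def)
    qed (use V bounded in \<open>auto simp: V_def\<close>)
    then show ?thesis using nu u0 by (simp add: g_def norm_divide)
  qed
  have dzp: "norm (z - p) \<le> 2 * \<delta>"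
    using dist_triangle[of z p z0] z pc by (simp add: dist_norm norm_minus_commute)
  have "norm (f z - f p) \<le> B * norm (z - p)"
  proof (cases "z \<in> E")
    case True
    then show ?thesis using inE z by auto
  next
    case False
    consider "Re (z - p) = 0" | "Im (z - p) = 0" | "Re (z - p) > 0" "Im (z - p) > 0"
      | "Re (z - p) < 0" "Im (z - p) > 0" | "Re (z - p) < 0" "Im (z - p) < 0"
      | "Re (z - p) > 0" "Im (z - p) < 0" by linarith
    then show ?thesis
    proof cases
      case 1
      have z: "z = p + \<i> * of_real (Im (z - p))" using 1 by (auto simp: complex_eq_iff)
      have "norm (f z - f p) \<le> n * \<bar>Im (z - p)\<bar>"
        by (subst z, rule vert) (use p pc dzp abs_Im_le_cmod[of "z - p"] in auto)
      also have "\<dots> \<le> B * norm (z - p)" using B n abs_Im_le_cmod[of "z - p"] by (intro mult_mono) auto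
      finally show ?thesis .
    next
      case 2
      have z: "z = p + of_real (Re (z - p))" using 2 by (auto simp: complex_eq_iff)
      have "norm (f z - f p) \<le> n * \<bar>Re (z - p)\<bar>"
        by (subst z, rule horiz) (use p pc dzp abs_Re_le_cmod[of "z - p"] in auto)
      also have "\<dots> \<le> B * norm (z - p)" using B n abs_Re_le_cmod[of "z - p"] by (intro mult_mono) auto
      finally show ?thesis .
    next
      case 3 then show ?thesis using quadrant[of 1] False by auto
    next
      case 4 then show ?thesis using quadrant[of \<i>] False by auto
    next
      case 5 then show ?thesis using quadrant[of "-1"] False by auto
    next
      case 6 then show ?thesis using quadrant[of "-\<i>"] False by auto
    qed
  qed
  then show ?thesis by (simp add: B_def)
qed

text \<open>If the segment from \<open>x\<close> to \<open>y\<close> meets \<open>E\<close>, a common point splits it into two pieces with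
  known bounds. Otherwise \<open>f\<close> is holomorphic near the segment, and Cauchy's inequality on the largest disc
  around \<open>z\<close> outside \<open>E\<close> bounds \<open>f' z\<close>: a point of \<open>E\<close> on its boundary
  controls \<open>f\<close> on the whole disc.\<close>

lemma locally_Lipschitz_near_exceptional_set:
  fixes f :: "complex \<Rightarrow> complex"
  assumes cont: "continuous_on (cball z0 \<delta>) f" and E: "closed E" "z0 \<in> E"
    and holo: "f holomorphic_on ball z0 \<delta> - E"
    and bound: "\<And>p z. p \<in> E \<Longrightarrow> p \<in> ball z0 (\<delta> / 2) \<Longrightarrow> z \<in> ball z0 \<delta> \<Longrightarrow>
        norm (f z - f p) \<le> B * norm (z - p)"
    and x: "x \<in> ball z0 (\<delta> / 4)" and y: "y \<in> ball z0 (\<delta> / 4)" and B: "B \<ge> 0"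
  shows "norm (f x - f y) \<le> 2 * B * norm (x - y)"
proof -
  have sub: "closed_segment x y \<subseteq> ball z0 (\<delta> / 4)"
    using x y by (simp add: closed_segment_subset)
  have \<delta>: "\<delta> > 0"
    using x by (metis dist_nz mem_ball le_less_trans zero_le_dist zero_less_divide_iff zero_less_numeral not_less_iff_gr_or_eq)
  show ?thesis
  proof (cases "closed_segment x y \<inter> E = {}")
    case False
    then obtain p where p: "p \<in> closed_segment x y" "p \<in> E" by blast
    have pb: "p \<in> ball z0 (\<delta> / 2)" using p(1) sub \<delta> by (force simp: subset_iff)
    have "norm (f x - f p) \<le> B * norm (x - p)" "norm (f y - f p) \<le> B * norm (y - p)"
      using x y \<delta> by (auto intro!: bound p(2) pb)
    moreover have "norm (f x - f y) \<le> norm (f x - f p) + norm (f y - f p)"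
      using norm_triangle_ineq4[of "f x - f p" "f y - f p"] by simp
    moreover have "norm (x - p) + norm (y - p) = norm (x - y)"
      using p(1) by (simp add: between_mem_segment[symmetric] between dist_norm norm_minus_commute)
    moreover have "B * (norm (x - p) + norm (y - p)) = B * norm (x - p) + B * norm (y - p)"
      by (rule distrib_left)
    ultimately have "norm (f x - f y) \<le> B * norm (x - y)" by simp
    also have "\<dots> \<le> 2 * B * norm (x - y)" using B by (intro mult_right_mono) auto
    finally show ?thesis .
  next
    case True
    have der: "norm (deriv f z) \<le> 2 * B \<and> (f has_field_derivative deriv f z) (at z)"
      if "z \<in> closed_segment x y" for z
    proof -
      have z: "z \<in> ball z0 (\<delta> / 4)" "z \<notin> E" using that sub True by auto
      define K where "K = E \<inter> cball z0 (\<delta> / 2)"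
      have K: "compact K" "z0 \<in> K" using E \<delta> by (auto simp: K_def)
      obtain p where p: "p \<in> K" "\<And>q. q \<in> K \<Longrightarrow> dist z p \<le> dist z q"
        using distance_attains_inf[of K z] K by (auto simp: compact_imp_closed)
      define \<rho> where "\<rho> = dist z p"
      have \<rho>: "\<rho> > 0" "\<rho> < \<delta> / 4"
        using p(1) z p(2)[OF K(2)] by (auto simp: \<rho>_def K_def dist_commute)
      have cb: "cball z \<rho> \<subseteq> ball z0 (\<delta> / 2)"
      proof
        fix q assume "q \<in> cball z \<rho>"
        then show "q \<in> ball z0 (\<delta> / 2)"
          using dist_triangle[of z0 q z] z(1) \<rho> by simp
      qed
      have pb: "p \<in> ball z0 (\<delta> / 2)" using cb by (auto simp: \<rho>_def)
      have bs: "ball z \<rho> \<subseteq> ball z0 \<delta> - E"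
      proof
        fix q assume q: "q \<in> ball z \<rho>"
        then have qb: "q \<in> ball z0 (\<delta> / 2)" using cb ball_subset_cball by blast
        have "q \<notin> K" using p(2)[of q] q by (auto simp: \<rho>_def)
        then show "q \<in> ball z0 \<delta> - E" using qb \<delta> by (auto simp: K_def)
      qed
      have hz: "f holomorphic_on ball z \<rho>" by (rule holomorphic_on_subset[OF holo bs])
      have "norm ((deriv ^^ 1) (\<lambda>w. f w - f p) z) \<le> fact 1 * (B * (2 * \<rho>)) / \<rho> ^ 1"
      proof (rule Cauchy_inequality)
        show "(\<lambda>w. f w - f p) holomorphic_on ball z \<rho>" by (intro holomorphic_intros hz)
        show "continuous_on (cball z \<rho>) (\<lambda>w. f w - f p)"
        proof (intro continuous_intros continuous_on_subset[OF cont])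
          have "ball z0 (\<delta> / 2) \<subseteq> cball z0 \<delta>" using \<delta> by auto
          then show "cball z \<rho> \<subseteq> cball z0 \<delta>" using cb by blast
        qed
        fix w assume w: "norm (z - w) = \<rho>"
        then have "w \<in> cball z \<rho>" by (simp add: dist_norm)
        then have "w \<in> ball z0 (\<delta> / 2)" using cb by blast
        then have "norm (f w - f p) \<le> B * norm (w - p)"
          using \<delta> p(1) by (intro bound pb) (auto simp: K_def)
        also have "norm (w - p) \<le> 2 * \<rho>"
          using norm_triangle_ineq4[of "z - p" "z - w"] w by (simp add: \<rho>_def dist_norm)
        then have "B * norm (w - p) \<le> B * (2 * \<rho>)" using B by (rule mult_left_mono)
        finally show "norm (f w - f p) \<le> B * (2 * \<rho>)" .
      qed (use \<rho> in auto)
      moreover have df: "(f has_field_derivative deriv f z) (at z)"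
        using hz \<rho> by (intro holomorphic_derivI[of _ "ball z \<rho>"]) auto
      then have "deriv (\<lambda>w. f w - f p) z = deriv f z"
        by (intro DERIV_imp_deriv) (auto intro!: derivative_eq_intros)
      ultimately show ?thesis using df \<rho> by simp
    qed
    show ?thesis
    proof (rule field_differentiable_bound[of "closed_segment x y" f "deriv f"])
      fix z assume "z \<in> closed_segment x y"
      note d = der[OF this]
      show "(f has_field_derivative deriv f z) (at z within closed_segment x y)"
        using conjunct2[OF d] by (rule has_field_derivative_at_within)
      show "norm (deriv f z) \<le> 2 * B" using d by simp
    qed auto
  qed
qed

text \<open>Let \<open>E\<close> be the set of points near which \<open>f\<close> is not holomorphic. The closed sets \<open>A n\<close> of
  points at which the difference quotients in the four axis directions are bounded by \<open>n\<close> exhaust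
  \<open>E\<close>, so by Baire one of them contains a relatively open part of \<open>E\<close>. Near this part \<open>f\<close> is
  Lipschitz, hence complex differentiable everywhere, a contradiction. The theorem of Looman and Menchoff
  assumes the partial derivatives only; here derivatives in all directions are given, and the
  last step becomes elementary.\<close>

theorem directionally_differentiable_imp_holomorphic:
  fixes f :: "complex \<Rightarrow> complex"
  assumes D: "open D" and cont: "continuous_on D f"
    and dir: "\<And>z. z \<in> D \<Longrightarrow> \<exists>c. \<forall>w. ((\<lambda>t. (f (z + of_real t * w) - f z) / of_real t) \<longlongrightarrow> c * w) (at_right 0)"
  shows "f holomorphic_on D"
proof -
  define E where "E = {z \<in> D. \<not> (\<exists>r>0. f holomorphic_on ball z r)}"
  have offE: "f holomorphic_on U" if U: "open U" "U \<subseteq> D - E" for U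
  proof -
    have "\<exists>r>0. f holomorphic_on ball z r" if "z \<in> U" for z
      using U that by (auto simp: E_def)
    then show ?thesis
      using U(1) by (metis analytic_imp_holomorphic analytic_on_def)
  qed
  have Eclosed: "\<exists>e>0. ball z e \<subseteq> D - E" if z: "z \<in> D - E" for z
  proof -
    obtain r where r: "r > 0" "f holomorphic_on ball z r" using z by (auto simp: E_def)
    obtain s where s: "s > 0" "ball z s \<subseteq> D" using z D by (meson DiffD1 openE)
    have "y \<notin> E" if "y \<in> ball z (min r s)" for y
    proof -
      have "y \<in> ball z r" using that by simp
      then obtain e where "e > 0" "ball y e \<subseteq> ball z r"
        by (meson open_ball open_contains_ball)
      then show ?thesis using r(2) by (auto simp: E_def intro: holomorphic_on_subset)
    qed
    then show ?thesis using r s by (intro exI[of _ "min r s"]) auto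
  qed
  have "E = {}"
  proof (rule ccontr)
    assume "E \<noteq> {}"
    then obtain z1 where z1: "z1 \<in> E" by blast
    then have "z1 \<in> D" by (simp add: E_def)
    then obtain r1 where r1: "r1 > 0" "cball z1 r1 \<subseteq> D" using D by (meson open_contains_cball)
    define \<rho> where "\<rho> = r1 / 2"
    have \<rho>: "\<rho> > 0" "cball z1 (2 * \<rho>) \<subseteq> D" using r1 by (auto simp: \<rho>_def)
    \<comment> \<open>A closed set is needed for Baire; points of the open part \<open>E \<inter> ball z1 \<rho>\<close> are dense in it, so that
      the point \<open>z0\<close> below has a neighbourhood whose intersection with \<open>E\<close> lies in \<open>S\<close>.\<close>
    define S where "S = closure (E \<inter> ball z1 \<rho>)"
    have Scb: "S \<subseteq> cball z1 \<rho>"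
      unfolding S_def by (rule closure_minimal) auto
    have SE: "S \<subseteq> E"
    proof
      fix z assume z: "z \<in> S"
      then have zD: "z \<in> D" using Scb \<rho> by (force simp: subset_iff)
      show "z \<in> E"
      proof (rule ccontr)
        assume "z \<notin> E"
        then obtain e where e: "e > 0" "ball z e \<subseteq> D - E" using Eclosed zD by blast
        obtain y where "y \<in> E" "dist y z < e"
          using z e(1) by (auto simp: S_def closure_approachable)
        then have "y \<in> ball z e" by (simp add: dist_commute)
        then show False using e(2) \<open>y \<in> E\<close> by blast
      qed
    qed
    have step: "z + of_real t * u \<in> cball z1 (2 * \<rho>)"
      if "z \<in> S" "0 \<le> t" "t \<le> \<rho>" "norm u = 1" for z t u
    proof -
      have "dist z1 (z + of_real t * u) \<le> dist z1 z + dist z (z + of_real t * u)" by (rule dist_triangle)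
      also have "dist z (z + of_real t * u) = t" using that by (simp add: dist_norm norm_mult)
      also have "dist z1 z \<le> \<rho>" using that(1) Scb by auto
      finally show ?thesis using that by simp
    qed
    have contc: "continuous_on (cball z1 (2 * \<rho>)) f"
      by (rule continuous_on_subset[OF cont \<rho>(2)])
    then have "compact (f ` cball z1 (2 * \<rho>))" by (intro compact_continuous_image compact_cball)
    then obtain M where M: "\<And>z. z \<in> cball z1 (2 * \<rho>) \<Longrightarrow> norm (f z) \<le> M"
      by (meson compact_imp_bounded bounded_iff imageI)
    define U where "U = {1, \<i>, -1, -\<i>}"
    have nU: "norm u = 1" if "u \<in> U" for u using that by (auto simp: U_def)
    define A where "A n = {z \<in> S. \<forall>u\<in>U. \<forall>t\<in>{0..\<rho>}. norm (f (z + of_real t * u) - f z) \<le> real n * t}" for n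
    have Acl: "closed (A n)" for n
    proof -
      have "closed {z \<in> S. norm (f (z + of_real t * u) - f z) \<le> real n * t}"
        if ut: "u \<in> U" "t \<in> {0..\<rho>}" for u t
      proof (rule continuous_on_closed_Collect_le)
        have "S \<subseteq> cball z1 (2 * \<rho>)" using Scb \<rho> by force
        moreover have "(\<lambda>z. z + of_real t * u) \<in> S \<rightarrow> cball z1 (2 * \<rho>)"
          using ut step nU by auto
        ultimately show "continuous_on S (\<lambda>z. norm (f (z + of_real t * u) - f z))"
          by (intro continuous_intros continuous_on_compose2[OF contc] continuous_on_subset[OF contc]) auto
      qed (auto simp: S_def)
      moreover have "A n = S \<inter> (\<Inter>u\<in>U. \<Inter>t\<in>{0..\<rho>}. {z \<in> S. norm (f (z + of_real t * u) - f z) \<le> real n * t})"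
        by (auto simp: A_def)
      ultimately show ?thesis by (auto simp: S_def intro!: closed_Int closed_INT)
    qed
    have Aun: "\<exists>n. z \<in> A n" if zS: "z \<in> S" for z
    proof -
      have "z \<in> D" using zS Scb \<rho> by (force simp: subset_iff)
      then obtain c where c: "\<And>w. ((\<lambda>t. (f (z + of_real t * w) - f z) / of_real t) \<longlongrightarrow> c * w) (at_right 0)"
        using dir by blast
      have "\<exists>n. \<forall>t\<in>{0..\<rho>}. norm (f (z + of_real t * u) - f z) \<le> real n * t" if u: "u \<in> U" for u
      proof -
        have "\<forall>\<^sub>F t in at_right 0. norm ((f (z + of_real t * u) - f z) / of_real t) < norm (c * u) + 1"
          by (rule order_tendstoD(2)[OF tendsto_norm[OF c]]) simp
        then obtain b where b: "b > 0"
          "\<And>t. 0 < t \<Longrightarrow> t < b \<Longrightarrow> norm ((f (z + of_real t * u) - f z) / of_real t) < norm (c * u) + 1"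
          unfolding eventually_at_right_field by auto
        obtain n where n: "real n \<ge> norm (c * u) + 1" "real n \<ge> 2 * M / b"
          by (metis max.bounded_iff real_arch_simple)
        have "norm (f (z + of_real t * u) - f z) \<le> real n * t" if t: "t \<in> {0..\<rho>}" for t
        proof -
          consider "t = 0" | "0 < t" "t < b" | "t \<ge> b" using t by fastforce
          then show ?thesis
          proof cases
            case 2
            then show ?thesis using b(2)[of t] n(1) 
              by (simp add: norm_divide divide_less_eq)
                (meson less_eq_real_def mult_right_mono order_trans)
          next
            case 3
            have "norm (f (z + of_real t * u) - f z) \<le> M + M"
              by (rule norm_triangle_le_diff[OF add_mono]; rule M)
                (use step[OF zS _ _ nU[OF u]] t Scb zS \<rho> in force)+
            also have "M + M = 2 * M / b * b" using b(1) by simp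
            also have "\<dots> \<le> real n * t" using n(2) 3 b(1) by (intro mult_mono) auto
            finally show ?thesis .
          qed simp
        qed
        then show ?thesis by blast
      qed
      then obtain N where N: "\<And>u t. u \<in> U \<Longrightarrow> t \<in> {0..\<rho>} \<Longrightarrow> norm (f (z + of_real t * u) - f z) \<le> real (N u) * t"
        by metis
      have "real (N u) * t \<le> real (Max (N ` U)) * t" if "u \<in> U" "t \<in> {0..\<rho>}" for u t
        using that by (intro mult_right_mono) (auto simp: U_def)
      then have "norm (f (z + of_real t * u) - f z) \<le> real (Max (N ` U)) * t"
        if "u \<in> U" "t \<in> {0..\<rho>}" for u t
        using N[OF that] that order_trans by blast
      then have "z \<in> A (Max (N ` U))" using zS by (simp add: A_def)
      then show ?thesis ..
    qed
    obtain n x d where x: "x \<in> S" "d > 0" "ball x d \<inter> S \<subseteq> A n"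
    proof -
      have "\<not> (\<forall>n. S \<subseteq> closure (S - A n))"
      proof
        assume dense: "\<forall>n. S \<subseteq> closure (S - A n)"
        have "S \<subseteq> closure (\<Inter> (range (\<lambda>n. S - A n)))"
        proof (rule Baire)
          fix T assume "T \<in> range (\<lambda>n. S - A n)"
          then obtain n where T: "T = S - A n" by blast
          then have "T = S \<inter> - A n" by auto
          then have "openin (top_of_set S) T" using Acl[of n] by (auto simp: openin_open)
          then show "openin (top_of_set S) T \<and> S \<subseteq> closure T" using dense T by blast
        qed (auto simp: S_def)
        moreover have "\<Inter> (range (\<lambda>n. S - A n)) = {}" using Aun by auto
        moreover have "z1 \<in> S" using z1 \<rho> closure_subset[of "E \<inter> ball z1 \<rho>"] by (auto simp: S_def)
        ultimately show False by (metis closure_empty empty_iff subsetD)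
      qed
      then obtain n x where "x \<in> S" "x \<notin> closure (S - A n)" by blast
      then obtain d where "d > 0" "\<And>y. y \<in> S - A n \<Longrightarrow> \<not> dist y x < d"
        unfolding closure_approachable by blast
      then show thesis
        using that[of x d n] \<open>x \<in> S\<close> by (force simp: dist_commute)
    qed
    obtain z0 where z0: "z0 \<in> E" "z0 \<in> ball z1 \<rho>" "z0 \<in> ball x d"
      using x by (auto simp: S_def closure_approachable dist_commute)
    obtain e where e: "e > 0" "cball z0 e \<subseteq> ball z1 \<rho> \<inter> ball x d"
      using z0 by (metis IntI open_Int open_ball open_contains_cball)
    define \<delta> where "\<delta> = min e (\<rho> / 2)"
    have \<delta>: "\<delta> > 0" "2 * \<delta> \<le> \<rho>" "cball z0 \<delta> \<subseteq> ball z1 \<rho> \<inter> ball x d"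
      using e \<rho> by (auto simp: \<delta>_def subset_iff)
    have z0S: "z0 \<in> S" using z0 closure_subset[of "E \<inter> ball z1 \<rho>"] by (auto simp: S_def)
    have ES: "q \<in> S" if "q \<in> E" "q \<in> cball z0 \<delta>" for q
      using that \<delta>(3) closure_subset[of "E \<inter> ball z1 \<rho>"] by (auto simp: S_def)
    have big: "ball z1 \<rho> \<subseteq> cball z1 (2 * \<rho>)" using \<rho> by auto
    have sub: "cball z0 \<delta> \<subseteq> cball z1 (2 * \<rho>)" using \<delta>(3) big by blast
    have contd: "continuous_on (cball z0 \<delta>) f" by (rule continuous_on_subset[OF contc sub])
    have clS: "closed S" by (simp add: S_def)
    have holo: "f holomorphic_on ball z0 \<delta> - S"
    proof (rule offE)
      show "open (ball z0 \<delta> - S)" using clS by (intro open_Diff) auto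
      show "ball z0 \<delta> - S \<subseteq> D - E"
        using ES sub \<rho>(2) ball_subset_cball[of z0 \<delta>] by blast
    qed
    define B where "B = 2 * real n + 4 * M / \<delta>"
    have M0: "M \<ge> 0" using order_trans[OF norm_ge_zero M[of z1]] \<rho> by simp
    have B: "B \<ge> 0" using M0 \<delta> by (simp add: B_def)
    have bound: "norm (f z - f p) \<le> B * norm (z - p)"
      if "p \<in> S" "p \<in> ball z0 (\<delta> / 2)" "z \<in> ball z0 \<delta>" for p z
      unfolding B_def
    proof (rule Lipschitz_from_cross_bounds[OF contd clS holo])
      fix q t u assume "q \<in> S" "q \<in> cball z0 \<delta>" "0 \<le> t" "t \<le> 2 * \<delta>" and u: "u \<in> {1, \<i>, -1, -\<i>}"
      moreover have "q \<in> A n" using \<open>q \<in> S\<close> \<open>q \<in> cball z0 \<delta>\<close> \<delta>(3) x(3) by blast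
      ultimately show "norm (f (q + of_real t * u) - f q) \<le> real n * t"
        using \<delta>(2) u unfolding A_def U_def by auto
    qed (use that M sub in auto)
    have Lip: "norm (f y - f y') \<le> 2 * B * norm (y - y')" if "y \<in> ball z0 (\<delta> / 4)" "y' \<in> ball z0 (\<delta> / 4)" for y y'
      by (rule locally_Lipschitz_near_exceptional_set[OF contd clS z0S holo bound that B])
    have "f holomorphic_on ball z0 (\<delta> / 4)"
      unfolding holomorphic_on_def
    proof
      fix z assume z: "z \<in> ball z0 (\<delta> / 4)"
      then obtain r where r: "r > 0" "ball z r \<subseteq> ball z0 (\<delta> / 4)" by (meson open_ball openE)
      have "z \<in> cball z0 \<delta>" using z \<delta>(1) by auto
      then have "z \<in> D" using sub \<rho>(2) by blast
      then obtain c where "\<And>w. ((\<lambda>t. (f (z + of_real t * w) - f z) / of_real t) \<longlongrightarrow> c * w) (at_right 0)"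
        using dir by blast
      then have "(f has_field_derivative c) (at z)"
        using r by (intro directional_Lipschitz_imp_differentiable[of r z f "2 * B"] Lip) auto
      then show "f field_differentiable at z within ball z0 (\<delta> / 4)"
        using field_differentiable_at_within field_differentiable_def by blast
    qed
    then show False using z0(1) \<delta>(1) by (auto simp: E_def)
  qed
  then show ?thesis using offE[of D] D by auto
qed

section \<open>Primitives along maps\<close>

definition primitive_at ::
    "('a::real_normed_vector \<Rightarrow> 'a \<Rightarrow> 'b::real_normed_vector) \<Rightarrow> 'a \<Rightarrow> ('a \<Rightarrow> 'b) \<Rightarrow> bool" where
  "primitive_at \<omega> x p \<longleftrightarrow> (\<forall>\<^sub>F v in nhds x. (p has_derivative \<omega> v) (at v))"

definition locally_exact ::
    "('a::real_normed_vector \<Rightarrow> 'a \<Rightarrow> 'b::real_normed_vector) \<Rightarrow> 'a set \<Rightarrow> bool" where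
  "locally_exact \<omega> S \<longleftrightarrow> (\<forall>x\<in>S. \<exists>p. primitive_at \<omega> x p)"

text \<open>Continuation of local primitives of the form \<open>\<omega>\<close> along \<open>\<sigma>\<close>: the increments of \<open>q\<close> are what
  the integrals of \<open>\<omega>\<close> along the images of paths in \<open>K\<close> ought to be, and they make sense for every
  continuous \<open>\<sigma>\<close>. For the identity \<open>\<sigma>\<close>, this is a primitive on the set \<open>K\<close>, which need not be open.\<close>

definition primitive_along ::
    "('a::real_normed_vector \<Rightarrow> 'a \<Rightarrow> 'b::real_normed_vector) \<Rightarrow> ('c::topological_space \<Rightarrow> 'a) \<Rightarrow> 'c set \<Rightarrow> ('c \<Rightarrow> 'b) \<Rightarrow> bool"
  where "primitive_along \<omega> \<sigma> K q \<longleftrightarrow>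
    (\<forall>x\<in>K. \<exists>p. primitive_at \<omega> (\<sigma> x) p \<and> (\<forall>\<^sub>F y in nhds x. y \<in> K \<longrightarrow> q y = p (\<sigma> y)))"

lemma primitive_at_diff_const:
  assumes "primitive_at \<omega> x p1" "primitive_at \<omega> x p2"
  shows "\<forall>\<^sub>F v in nhds x. p1 v - p2 v = p1 x - p2 x"
proof -
  have "\<forall>\<^sub>F v in nhds x. ((\<lambda>v. p1 v - p2 v) has_derivative (\<lambda>h. 0)) (at v)"
    using assms unfolding primitive_at_def
    by eventually_elim (auto intro!: derivative_eq_intros)
  then obtain e where e: "e > 0"
    "\<And>v. dist v x < e \<Longrightarrow> ((\<lambda>v. p1 v - p2 v) has_derivative (\<lambda>h. 0)) (at v)"
    unfolding eventually_nhds_metric by blast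
  have "p1 v - p2 v = p1 x - p2 x" if "dist v x < e" for v
    by (rule has_derivative_zero_unique[of "ball x e" "\<lambda>v. p1 v - p2 v"])
      (use e that in \<open>auto simp: dist_commute intro: has_derivative_at_withinI\<close>)
  then show ?thesis unfolding eventually_nhds_metric using e(1) by blast
qed

lemma primitive_at_shift: "primitive_at \<omega> x p \<Longrightarrow> primitive_at \<omega> x (\<lambda>v. p v + c)"
  unfolding primitive_at_def by (erule eventually_mono) (auto intro!: derivative_eq_intros)

lemma eventually_nhds_compose_within:
  assumes "continuous_on K g" "x \<in> K" "\<forall>\<^sub>F y in nhds (g x). P y"
  shows "\<forall>\<^sub>F t in nhds x. t \<in> K \<longrightarrow> P (g t)"
proof -
  obtain U where U: "open U" "g x \<in> U" "\<And>y. y \<in> U \<Longrightarrow> P y"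
    using assms(3) unfolding eventually_nhds by blast
  obtain A where "open A" "x \<in> A" "\<forall>y\<in>K. y \<in> A \<longrightarrow> g y \<in> U"
    using assms(1,2) U(1,2) unfolding continuous_on_topological by meson
  then show ?thesis using U(3) unfolding eventually_nhds by blast
qed

lemma primitive_along_subset: "primitive_along \<omega> \<sigma> K q \<Longrightarrow> L \<subseteq> K \<Longrightarrow> primitive_along \<omega> \<sigma> L q"
  unfolding primitive_along_def by (fast elim: eventually_mono)

lemma primitive_along_compose:
  assumes q: "primitive_along \<omega> \<sigma> K q" and g: "continuous_on L g" "g ` L \<subseteq> K"
  shows "primitive_along \<omega> (\<lambda>t. \<sigma> (g t)) L (\<lambda>t. q (g t))"
  unfolding primitive_along_def
proof
  fix t assume t: "t \<in> L"
  then obtain p where p: "primitive_at \<omega> (\<sigma> (g t)) p" "\<forall>\<^sub>F y in nhds (g t). y \<in> K \<longrightarrow> q y = p (\<sigma> y)"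
    using q g(2) unfolding primitive_along_def by blast
  have "\<forall>\<^sub>F s in nhds t. s \<in> L \<longrightarrow> g s \<in> K \<longrightarrow> q (g s) = p (\<sigma> (g s))"
    by (rule eventually_nhds_compose_within[OF g(1) t p(2)])
  then have "\<forall>\<^sub>F s in nhds t. s \<in> L \<longrightarrow> q (g s) = p (\<sigma> (g s))"
    by eventually_elim (use g(2) in auto)
  then show "\<exists>p. primitive_at \<omega> (\<sigma> (g t)) p \<and> (\<forall>\<^sub>F s in nhds t. s \<in> L \<longrightarrow> q (g s) = p (\<sigma> (g s)))"
    using p(1) by blast
qed

lemma primitive_along_cong:
  assumes "primitive_along \<omega> \<sigma> K q" "\<And>x. x \<in> K \<Longrightarrow> \<sigma> x = \<tau> x" "\<And>x. x \<in> K \<Longrightarrow> q x = r x"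
  shows "primitive_along \<omega> \<tau> K r"
  unfolding primitive_along_def
proof
  fix x assume x: "x \<in> K"
  then obtain p where p: "primitive_at \<omega> (\<sigma> x) p" "\<forall>\<^sub>F y in nhds x. y \<in> K \<longrightarrow> q y = p (\<sigma> y)"
    using assms(1) unfolding primitive_along_def by blast
  have "\<forall>\<^sub>F y in nhds x. y \<in> K \<longrightarrow> r y = p (\<tau> y)"
    using p(2) by eventually_elim (auto simp: assms(2,3))
  then show "\<exists>p. primitive_at \<omega> (\<tau> x) p \<and> (\<forall>\<^sub>F y in nhds x. y \<in> K \<longrightarrow> r y = p (\<tau> y))"
    using p(1) x assms(2) by auto
qed

text \<open>The difference of two local primitives is locally constant, hence so is \<open>q1 - q2\<close>.\<close>

lemma primitive_along_unique:
  assumes q1: "primitive_along \<omega> \<sigma> K q1" and q2: "primitive_along \<omega> \<sigma> K q2"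
    and K: "connected K" "continuous_on K \<sigma>" and xy: "x \<in> K" "y \<in> K"
  shows "q1 x - q2 x = q1 y - q2 y"
proof -
  have "(\<lambda>x. q1 x - q2 x) constant_on K"
  proof (rule locally_constant_imp_constant[OF K(1)])
    fix a assume a: "a \<in> K"
    obtain p1 where p1: "primitive_at \<omega> (\<sigma> a) p1" "\<forall>\<^sub>F y in nhds a. y \<in> K \<longrightarrow> q1 y = p1 (\<sigma> y)"
      using q1 a unfolding primitive_along_def by blast
    obtain p2 where p2: "primitive_at \<omega> (\<sigma> a) p2" "\<forall>\<^sub>F y in nhds a. y \<in> K \<longrightarrow> q2 y = p2 (\<sigma> y)"
      using q2 a unfolding primitive_along_def by blast
    have const: "\<forall>\<^sub>F y in nhds a. y \<in> K \<longrightarrow> p1 (\<sigma> y) - p2 (\<sigma> y) = p1 (\<sigma> a) - p2 (\<sigma> a)"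
      by (rule eventually_nhds_compose_within[OF K(2) a primitive_at_diff_const[OF p1(1) p2(1)]])
    have at_a: "q1 a = p1 (\<sigma> a)" "q2 a = p2 (\<sigma> a)"
      using eventually_nhds_x_imp_x[OF p1(2)] eventually_nhds_x_imp_x[OF p2(2)] a by auto
    have "\<forall>\<^sub>F y in nhds a. y \<in> K \<longrightarrow> q1 y - q2 y = q1 a - q2 a"
      using const p1(2) p2(2) by eventually_elim (simp add: at_a)
    then obtain U where "open U" "a \<in> U" "\<forall>y\<in>U. y \<in> K \<longrightarrow> q1 y - q2 y = q1 a - q2 a"
      unfolding eventually_nhds by blast
    then show "\<exists>T. openin (top_of_set K) T \<and> a \<in> T \<and> (\<forall>x\<in>T. q1 x - q2 x = q1 a - q2 a)"
      using a openin_open_Int[of U K] by (intro exI[of _ "K \<inter> U"] conjI ballI) blast+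
  qed
  then show ?thesis using xy unfolding constant_on_def by metis
qed

text \<open>On the connected intersection the two primitives differ by a constant; this constant is added to the second
  one.\<close>

lemma primitive_along_Un:
  fixes K1 K2 :: "'c::topological_space set"
  assumes q1: "primitive_along \<omega> \<sigma> K1 q1" and q2: "primitive_along \<omega> \<sigma> K2 q2"
    and K: "closed K1" "closed K2" "connected (K1 \<inter> K2)" "continuous_on (K1 \<union> K2) \<sigma>"
  shows "\<exists>q. primitive_along \<omega> \<sigma> (K1 \<union> K2) q"
proof -
  obtain c where c: "\<And>x. x \<in> K1 \<inter> K2 \<Longrightarrow> q1 x - q2 x = c"
  proof (cases "K1 \<inter> K2 = {}")
    case False
    then obtain a where a: "a \<in> K1 \<inter> K2" by blast
    have "q1 x - q2 x = q1 a - q2 a" if "x \<in> K1 \<inter> K2" for x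
      by (rule primitive_along_unique[OF primitive_along_subset[OF q1] primitive_along_subset[OF q2] K(3)])
        (use a that in \<open>auto intro: continuous_on_subset[OF K(4)]\<close>)
    then show ?thesis by (rule that)
  qed auto
  define q where "q y = (if y \<in> K1 then q1 y else q2 y + c)" for y
  have q2': "q y = q2 y + c" if "y \<in> K2" for y
    using c[of y] that by (auto simp: q_def algebra_simps)
  have "\<exists>p. primitive_at \<omega> (\<sigma> x) p \<and> (\<forall>\<^sub>F y in nhds x. y \<in> K1 \<union> K2 \<longrightarrow> q y = p (\<sigma> y))"
    if x: "x \<in> K1 \<union> K2" for x
  proof -
    have P1: "\<exists>p. primitive_at \<omega> (\<sigma> x) p \<and> (\<forall>\<^sub>F y in nhds x. y \<in> K1 \<longrightarrow> q y = p (\<sigma> y))" if "x \<in> K1"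
      using q1 that unfolding primitive_along_def
      by (auto elim!: eventually_mono simp: q_def)
    have P2: "\<exists>p. primitive_at \<omega> (\<sigma> x) p \<and> (\<forall>\<^sub>F y in nhds x. y \<in> K2 \<longrightarrow> q y = p (\<sigma> y))" if x2: "x \<in> K2"
    proof -
      obtain p where p: "primitive_at \<omega> (\<sigma> x) p" "\<forall>\<^sub>F y in nhds x. y \<in> K2 \<longrightarrow> q2 y = p (\<sigma> y)"
        using q2 x2 unfolding primitive_along_def by blast
      have "\<forall>\<^sub>F y in nhds x. y \<in> K2 \<longrightarrow> q y = p (\<sigma> y) + c"
        using p(2) by eventually_elim (auto simp: q2')
      then show ?thesis using primitive_at_shift[OF p(1)] by blast
    qed
    have out: "\<forall>\<^sub>F y in nhds x. y \<notin> L" if "closed L" "x \<notin> L" for L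
      using eventually_nhds_in_open[of "- L" x] that by (simp add: open_Compl)
    consider "x \<in> K1" "x \<notin> K2" | "x \<notin> K1" "x \<in> K2" | "x \<in> K1" "x \<in> K2" using x by blast
    then show ?thesis
    proof cases
      case 1
      obtain p where p: "primitive_at \<omega> (\<sigma> x) p" "\<forall>\<^sub>F y in nhds x. y \<in> K1 \<longrightarrow> q y = p (\<sigma> y)"
        using P1 1 by blast
      have "\<forall>\<^sub>F y in nhds x. y \<in> K1 \<union> K2 \<longrightarrow> q y = p (\<sigma> y)"
        using p(2) out[OF K(2) 1(2)] by eventually_elim auto
      then show ?thesis using p(1) by blast
    next
      case 2
      obtain p where p: "primitive_at \<omega> (\<sigma> x) p" "\<forall>\<^sub>F y in nhds x. y \<in> K2 \<longrightarrow> q y = p (\<sigma> y)"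
        using P2 2 by blast
      have "\<forall>\<^sub>F y in nhds x. y \<in> K1 \<union> K2 \<longrightarrow> q y = p (\<sigma> y)"
        using p(2) out[OF K(1) 2(1)] by eventually_elim auto
      then show ?thesis using p(1) by blast
    next
      case 3
      obtain p1 where p1: "primitive_at \<omega> (\<sigma> x) p1" "\<forall>\<^sub>F y in nhds x. y \<in> K1 \<longrightarrow> q y = p1 (\<sigma> y)"
        using P1 3 by blast
      obtain p2 where p2: "primitive_at \<omega> (\<sigma> x) p2" "\<forall>\<^sub>F y in nhds x. y \<in> K2 \<longrightarrow> q y = p2 (\<sigma> y)"
        using P2 3 by blast
      have same: "p1 (\<sigma> x) = p2 (\<sigma> x)"
        using eventually_nhds_x_imp_x[OF p1(2)] eventually_nhds_x_imp_x[OF p2(2)] 3 by simp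
      have "\<forall>\<^sub>F y in nhds x. y \<in> K1 \<union> K2 \<longrightarrow> p1 (\<sigma> y) - p2 (\<sigma> y) = p1 (\<sigma> x) - p2 (\<sigma> x)"
        by (rule eventually_nhds_compose_within[OF K(4) x primitive_at_diff_const[OF p1(1) p2(1)]])
      then have "\<forall>\<^sub>F y in nhds x. y \<in> K1 \<union> K2 \<longrightarrow> q y = p1 (\<sigma> y)"
        using p1(2) p2(2) by eventually_elim (auto simp: same)
      then show ?thesis using p1(1) by blast
    qed
  qed
  then show ?thesis unfolding primitive_along_def by blast
qed

text \<open>A bisection principle: the box has a division into cells on which the property holds, and the cells
  can be reassembled along hyperplanes. The formal device is the notion of an operative function with values
  in the monoid of truth values under conjunction; such a function must be neutral on boxes without interior,
  whence the first disjunct in the definition of \<open>Good\<close>.\<close>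

lemma cbox_local_to_global:
  fixes a b :: "'c::euclidean_space"
  assumes sub: "\<And>K L. P K \<Longrightarrow> L \<subseteq> K \<Longrightarrow> P L"
    and un: "\<And>K L. closed K \<Longrightarrow> closed L \<Longrightarrow> convex K \<Longrightarrow> convex L \<Longrightarrow> K \<union> L \<subseteq> cbox a b \<Longrightarrow>
      P K \<Longrightarrow> P L \<Longrightarrow> P (K \<union> L)"
    and loc: "\<And>x. x \<in> cbox a b \<Longrightarrow> \<exists>U. open U \<and> x \<in> U \<and> P (U \<inter> cbox a b)"
    and ne: "box a b \<noteq> {}"
  shows "P (cbox a b)"
proof -
  define Good where "Good K \<longleftrightarrow> interior K = {} \<or> P (K \<inter> cbox a b)" for K
  interpret operative conj True Good
  proof
    fix u v :: 'c assume "box u v = {}"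
    then show "Good (cbox u v) = True" by (simp add: Good_def)
  next
    fix u v k :: 'c and c :: real assume k: "k \<in> Basis"
    let ?K = "cbox u v" and ?L = "cbox u v \<inter> {x. x \<bullet> k \<le> c}" and ?R = "cbox u v \<inter> {x. x \<bullet> k \<ge> c}"
    show "Good ?K = (Good ?L \<and> Good ?R)"
    proof
      assume K: "Good ?K"
      have "Good M" if "M \<subseteq> ?K" for M
        using K interior_mono[OF that] sub[of "?K \<inter> cbox a b" "M \<inter> cbox a b"] that
        unfolding Good_def by blast
      then show "Good ?L \<and> Good ?R" by simp
    next
      assume LR: "Good ?L \<and> Good ?R"
      have half: "?R = ?K" if "interior ?L = {}" "box u v \<noteq> {}"
      proof -
        have "box u v \<inter> {x. x \<bullet> k < c} \<subseteq> interior ?L"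
        proof (rule interior_maximal)
          show "open (box u v \<inter> {x. x \<bullet> k < c})" by (intro open_Int open_box open_halfspace_component_lt)
        qed (use box_subset_cbox[of u v] in auto)
        then have "box u v \<subseteq> {x. x \<bullet> k \<ge> c}" using that(1) by fastforce
        then have "closure (box u v) \<subseteq> {x. x \<bullet> k \<ge> c}"
          by (rule closure_minimal) (rule closed_halfspace_component_ge)
        then show ?thesis using that(2) by (auto simp: closure_box)
      qed
      have half': "?L = ?K" if "interior ?R = {}" "box u v \<noteq> {}"
      proof -
        have "box u v \<inter> {x. x \<bullet> k > c} \<subseteq> interior ?R"
        proof (rule interior_maximal)
          show "open (box u v \<inter> {x. x \<bullet> k > c})" by (intro open_Int open_box open_halfspace_component_gt)
        qed (use box_subset_cbox[of u v] in auto)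
        then have "box u v \<subseteq> {x. x \<bullet> k \<le> c}" using that(1) by fastforce
        then have "closure (box u v) \<subseteq> {x. x \<bullet> k \<le> c}"
          by (rule closure_minimal) (rule closed_halfspace_component_le)
        then show ?thesis using that(2) by (auto simp: closure_box)
      qed
      show "Good ?K"
      proof (cases "box u v = {} \<or> interior ?L = {} \<or> interior ?R = {}")
        case True
        then consider "box u v = {}" | "?R = ?K" | "?L = ?K" using half half' by blast
        then show ?thesis
        proof cases
          case 1 then show ?thesis by (simp add: Good_def)
        next
          case 2 then show ?thesis using LR by (simp only:)
        next
          case 3 then show ?thesis using LR by (simp only:)
        qed
      next
        case False
        then have PLR: "P (?L \<inter> cbox a b)" "P (?R \<inter> cbox a b)" using LR unfolding Good_def by blast+
        have hs: "convex {x. x \<bullet> k \<le> c}" "convex {x. x \<bullet> k \<ge> c}"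
          using convex_halfspace_le[of k c] convex_halfspace_ge[of c k] by (simp_all add: inner_commute)
        have "P ((?L \<inter> cbox a b) \<union> (?R \<inter> cbox a b))"
          by (rule un[OF _ _ _ _ _ PLR])
            (auto intro!: closed_Int closed_halfspace_component_le closed_halfspace_component_ge
              convex_Int convex_box hs)
        moreover have "(?L \<inter> cbox a b) \<union> (?R \<inter> cbox a b) = ?K \<inter> cbox a b" by auto
        ultimately show ?thesis unfolding Good_def by simp
      qed
    qed
  qed
  have "\<exists>U. open U \<and> x \<in> U \<and> (x \<in> cbox a b \<longrightarrow> P (U \<inter> cbox a b))" for x
    using loc[of x] by (cases "x \<in> cbox a b") auto
  then have "\<exists>\<gamma>. \<forall>x. open (\<gamma> x) \<and> x \<in> \<gamma> x \<and> (x \<in> cbox a b \<longrightarrow> P (\<gamma> x \<inter> cbox a b))"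
    by (rule choice[OF allI])
  then obtain \<gamma> where \<gamma>: "\<And>x. open (\<gamma> x)" "\<And>x. x \<in> \<gamma> x" "\<And>x. x \<in> cbox a b \<Longrightarrow> P (\<gamma> x \<inter> cbox a b)"
    by blast
  then have "gauge \<gamma>" by (simp add: gauge_def)
  then obtain T where T: "T tagged_division_of cbox a b" "\<gamma> fine T"
    by (rule fine_division_exists)
  have "\<forall>K\<in>snd ` T. Good K"
  proof
    fix K assume "K \<in> snd ` T"
    then obtain x where x: "(x, K) \<in> T" by auto
    have "x \<in> cbox a b" "K \<subseteq> \<gamma> x"
      using tag_in_interval[OF T(1) x] T(2) x by (auto simp: fine_def)
    then have "P (K \<inter> cbox a b)" using sub[OF \<gamma>(3)[of x], of "K \<inter> cbox a b"] by blast
    then show "Good K" by (simp add: Good_def)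
  qed
  then have "Good (cbox a b)"
    unfolding division[symmetric, OF division_of_tagged_division[OF T(1)]] comm_monoid_set_F_and by simp
  then show ?thesis using ne by (simp add: Good_def)
qed

lemma primitive_along_cbox:
  fixes a b :: "'c::euclidean_space"
  assumes ex: "locally_exact \<omega> S" and \<sigma>: "continuous_on (cbox a b) \<sigma>" "\<sigma> ` cbox a b \<subseteq> S"
    and ne: "box a b \<noteq> {}"
  shows "\<exists>q. primitive_along \<omega> \<sigma> (cbox a b) q"
proof (rule cbox_local_to_global[where P = "\<lambda>K. \<exists>q. primitive_along \<omega> \<sigma> K q", OF _ _ _ ne])
  fix K L :: "'c set" assume "\<exists>q. primitive_along \<omega> \<sigma> K q" "L \<subseteq> K"
  then show "\<exists>q. primitive_along \<omega> \<sigma> L q" by (elim exE) (rule exI, rule primitive_along_subset)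
next
  fix K L :: "'c set"
  assume KL: "closed K" "closed L" "convex K" "convex L" "K \<union> L \<subseteq> cbox a b"
    and "\<exists>q. primitive_along \<omega> \<sigma> K q" "\<exists>q. primitive_along \<omega> \<sigma> L q"
  then obtain q1 q2 where q: "primitive_along \<omega> \<sigma> K q1" "primitive_along \<omega> \<sigma> L q2" by blast
  show "\<exists>q. primitive_along \<omega> \<sigma> (K \<union> L) q"
    by (rule primitive_along_Un[OF q KL(1,2)])
      (use KL \<sigma>(1) in \<open>auto intro: convex_connected convex_Int continuous_on_subset\<close>)
next
  fix x assume x: "x \<in> cbox a b"
  then obtain p where p: "primitive_at \<omega> (\<sigma> x) p"
    using ex \<sigma>(2) unfolding locally_exact_def by blast
  then have "\<forall>\<^sub>F v in nhds (\<sigma> x). primitive_at \<omega> v p"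
    unfolding primitive_at_def by (simp add: eventually_eventually)
  then have "\<forall>\<^sub>F y in nhds x. y \<in> cbox a b \<longrightarrow> primitive_at \<omega> (\<sigma> y) p"
    by (rule eventually_nhds_compose_within[OF \<sigma>(1) x])
  then obtain U where U: "open U" "x \<in> U" "\<forall>y\<in>U. y \<in> cbox a b \<longrightarrow> primitive_at \<omega> (\<sigma> y) p"
    unfolding eventually_nhds by blast
  have "primitive_along \<omega> \<sigma> (U \<inter> cbox a b) (\<lambda>y. p (\<sigma> y))"
    unfolding primitive_along_def using U(3) by (intro ballI exI[of _ p]) auto
  then show "\<exists>U. open U \<and> x \<in> U \<and> (\<exists>q. primitive_along \<omega> \<sigma> (U \<inter> cbox a b) q)"
    using U(1,2) by (intro exI[of _ U] conjI exI[of _ "\<lambda>y. p (\<sigma> y)"])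
qed

text \<open>The nearest point projection onto \<open>T\<close> extends \<open>\<sigma>\<close> to a box, and by compactness \<open>\<sigma>\<close> has a
  continuous inverse on its image.\<close>

lemma primitive_on_compact_convex_image:
  fixes T :: "'c::euclidean_space set" and \<sigma> :: "'c \<Rightarrow> 'a::real_normed_vector"
  assumes ex: "locally_exact \<omega> S" and T: "compact T" "convex T" "T \<noteq> {}"
    and \<sigma>: "continuous_on T \<sigma>" "inj_on \<sigma> T" "\<sigma> ` T \<subseteq> S"
  shows "\<exists>q. primitive_along \<omega> (\<lambda>x. x) (\<sigma> ` T) q"
proof -
  have cT: "closed T" using T(1) by (rule compact_imp_closed)
  obtain a where a: "T \<subseteq> box (- a) a"
    using bounded_subset_box_symmetric[OF compact_imp_bounded[OF T(1)]] by blast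
  let ?c = "closest_point T"
  have "\<exists>q. primitive_along \<omega> (\<lambda>x. \<sigma> (?c x)) (cbox (- a) a) q"
  proof (rule primitive_along_cbox[OF ex])
    have cin: "?c x \<in> T" for x using closest_point_in_set[OF cT T(3)] .
    show "continuous_on (cbox (- a) a) (\<lambda>x. \<sigma> (?c x))"
      by (rule continuous_on_compose2[OF \<sigma>(1) continuous_on_closest_point[OF T(2) cT T(3)]])
        (use cin in auto)
    show "(\<lambda>x. \<sigma> (?c x)) ` cbox (- a) a \<subseteq> S" using cin \<sigma>(3) by auto
    show "box (- a) a \<noteq> {}" using a T(3) by auto
  qed
  then obtain q where q: "primitive_along \<omega> (\<lambda>x. \<sigma> (?c x)) (cbox (- a) a) q" by blast
  define g where "g = inv_into T \<sigma>"
  have g: "g (\<sigma> x) = x" if "x \<in> T" for x using \<sigma>(2) that by (simp add: g_def)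
  have "continuous_on (\<sigma> ` T) g"
    by (rule continuous_on_inv[OF \<sigma>(1) T(1)]) (use g in auto)
  moreover have "g ` \<sigma> ` T \<subseteq> cbox (- a) a"
    using g a box_subset_cbox[of "- a" a] by auto
  ultimately have "primitive_along \<omega> (\<lambda>x. \<sigma> (?c (g x))) (\<sigma> ` T) (\<lambda>x. q (g x))"
    by (rule primitive_along_compose[OF q])
  then have "primitive_along \<omega> (\<lambda>x. x) (\<sigma> ` T) (\<lambda>x. q (g x))"
    by (rule primitive_along_cong) (auto simp: g closest_point_self)
  then show ?thesis by blast
qed

text \<open>The image of the compact set of the other parameters is closed and does not contain \<open>x\<close>.\<close>

lemma eventually_nhds_preimage_near:
  fixes \<gamma> :: "real \<Rightarrow> 'a::t2_space"
  assumes "continuous_on {0..1} \<gamma>" "open W" "x \<notin> \<gamma> ` ({0..1} - W)"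
  shows "\<forall>\<^sub>F y in nhds x. y \<in> \<gamma> ` {0..1} \<longrightarrow> (\<exists>s\<in>W \<inter> {0..1}. y = \<gamma> s)"
proof -
  have "compact ({0..1} - W)" using assms(2) by (intro compact_diff) auto
  then have "compact (\<gamma> ` ({0..1} - W))"
    by (rule compact_continuous_image[rotated]) (rule continuous_on_subset[OF assms(1)], auto)
  then have "open (- \<gamma> ` ({0..1} - W))" by (simp add: compact_imp_closed open_Compl)
  then have "\<forall>\<^sub>F y in nhds x. y \<in> - \<gamma> ` ({0..1} - W)"
    by (rule eventually_nhds_in_open) (use assms(3) in simp)
  then show ?thesis by eventually_elim auto
qed

lemma simple_path_eqD:
  assumes "simple_path \<gamma>" "s \<in> {0..1}" "t \<in> {0..1}" "\<gamma> s = \<gamma> t"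
  shows "s = t \<or> s = 0 \<and> t = 1 \<or> s = 1 \<and> t = 0"
  using assms unfolding simple_path_def loop_free_def by blast

text \<open>Without \<open>\<gamma> t0\<close> the loop is an open arc that runs from \<open>t0\<close> through the base point back to \<open>t0\<close>.
  Adding the period \<open>h 1 - h 0\<close> on the parameters before \<open>t0\<close> makes the values at both ends of the
  parameter interval match, so that \<open>h\<close> descends to a primitive on the arc.\<close>

lemma primitive_on_punctured_loop:
  fixes \<gamma> :: "real \<Rightarrow> 'a::real_normed_vector"
  assumes \<gamma>: "simple_path \<gamma>" "pathfinish \<gamma> = pathstart \<gamma>"
    and h: "primitive_along \<omega> \<gamma> {0..1} h" and t0: "0 < t0" "t0 < 1"
  obtains u where "primitive_along \<omega> (\<lambda>x. x) (path_image \<gamma> - {\<gamma> t0}) u"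
    and "\<And>t. t0 < t \<Longrightarrow> t \<le> 1 \<Longrightarrow> u (\<gamma> t) = h t"
    and "\<And>t. 0 \<le> t \<Longrightarrow> t < t0 \<Longrightarrow> u (\<gamma> t) = h t + (h 1 - h 0)"
proof -
  have c\<gamma>: "continuous_on {0..1} \<gamma>" using \<gamma>(1) by (simp add: simple_path_def path_def)
  have ends: "\<gamma> 1 = \<gamma> 0" using \<gamma>(2) by (simp add: pathfinish_def pathstart_def)
  note inj = simple_path_eqD[OF \<gamma>(1)]
  define H where "H t = (if t < t0 then h t + (h 1 - h 0) else h t)" for t
  have H01: "H 0 = H 1" using t0 by (simp add: H_def)
  define u where "u x = H (SOME t. t \<in> {0..1} \<and> \<gamma> t = x)" for x
  have u: "u (\<gamma> t) = H t" if t: "t \<in> {0..1}" for t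
  proof -
    define s where "s = (SOME s. s \<in> {0..1} \<and> \<gamma> s = \<gamma> t)"
    have "s \<in> {0..1} \<and> \<gamma> s = \<gamma> t" unfolding s_def by (rule someI[of _ t]) (use t in simp)
    then have "s = t \<or> s = 0 \<and> t = 1 \<or> s = 1 \<and> t = 0" using inj t by blast
    then have "H s = H t" using H01 by auto
    then show ?thesis by (simp add: u_def s_def)
  qed
  have local: "\<exists>p W. primitive_at \<omega> (\<gamma> t) p \<and> open W \<and> (\<forall>s\<in>W \<inter> {0..1}. H s = p (\<gamma> s)) \<and>
      \<gamma> t \<notin> \<gamma> ` ({0..1} - W)" if t: "t \<in> {0..1}" "t \<noteq> t0" for t
  proof -
    have ph: "\<exists>p W. primitive_at \<omega> (\<gamma> s) p \<and> open W \<and> s \<in> W \<and> (\<forall>r\<in>W. r \<in> {0..1} \<longrightarrow> h r = p (\<gamma> r))"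
      if "s \<in> {0..1}" for s
      using h that unfolding primitive_along_def eventually_nhds by blast
    show ?thesis
    proof (cases "t = 0 \<or> t = 1")
      case False
      obtain p W where p: "primitive_at \<omega> (\<gamma> t) p" and W: "open W" "t \<in> W"
          "\<forall>r\<in>W. r \<in> {0..1} \<longrightarrow> h r = p (\<gamma> r)"
        using ph[OF t(1)] by blast
      have only: "\<gamma> t \<notin> \<gamma> ` ({0..1} - W')" if "t \<in> W'" for W'
        using inj[OF t(1)] False that by force
      show ?thesis
      proof (cases "t < t0")
        case True
        then show ?thesis
          using W primitive_at_shift[OF p, of "h 1 - h 0"] only[of "W \<inter> {..<t0}"]
          by (intro exI[of _ "\<lambda>v. p v + (h 1 - h 0)"] exI[of _ "W \<inter> {..<t0}"]) (auto simp: H_def)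
      next
        case False
        then have "t > t0" using t(2) by simp
        then show ?thesis
          using W p only[of "W \<inter> {t0<..}"]
          by (intro exI[of _ p] exI[of _ "W \<inter> {t0<..}"]) (auto simp: H_def)
      qed
    next
      case True
      have gt: "\<gamma> t = \<gamma> 0" using True ends by auto
      obtain p0 W0 where p0: "primitive_at \<omega> (\<gamma> 0) p0" and W0: "open W0" "0 \<in> W0"
          "\<forall>r\<in>W0. r \<in> {0..1} \<longrightarrow> h r = p0 (\<gamma> r)"
        using ph[of 0] by auto
      obtain p1 W1 where p1: "primitive_at \<omega> (\<gamma> 0) p1" and W1: "open W1" "1 \<in> W1"
          "\<forall>r\<in>W1. r \<in> {0..1} \<longrightarrow> h r = p1 (\<gamma> r)"
        using ph[of 1] ends by auto
      have "\<forall>\<^sub>F r in nhds 0. r \<in> {0..1} \<longrightarrow> p1 (\<gamma> r) - p0 (\<gamma> r) = p1 (\<gamma> 0) - p0 (\<gamma> 0)"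
        by (rule eventually_nhds_compose_within[OF c\<gamma> _ primitive_at_diff_const[OF p1 p0]]) simp
      then obtain W2 where W2: "open W2" "0 \<in> W2"
          "\<forall>r\<in>W2. r \<in> {0..1} \<longrightarrow> p1 (\<gamma> r) - p0 (\<gamma> r) = p1 (\<gamma> 0) - p0 (\<gamma> 0)"
        unfolding eventually_nhds by blast
      have L: "p1 (\<gamma> 0) - p0 (\<gamma> 0) = h 1 - h 0"
        using W0(2,3) W1(2,3) ends by simp
      define W where "W = (W0 \<inter> W2 \<inter> {..<t0}) \<union> (W1 \<inter> {t0<..})"
      have "H s = p1 (\<gamma> s)" if s: "s \<in> W \<inter> {0..1}" for s
      proof (cases "s < t0")
        case True
        then have s': "s \<in> W0" "s \<in> W2" "s \<in> {0..1}" using s by (auto simp: W_def)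
        have "h s = p0 (\<gamma> s)" "p1 (\<gamma> s) - p0 (\<gamma> s) = h 1 - h 0"
          using W0(3) W2(3) s' L by auto
        then have "h s + (h 1 - h 0) = p1 (\<gamma> s)" by (simp add: algebra_simps)
        then show ?thesis using True by (simp add: H_def)
      next
        case False
        then show ?thesis using s W1(3) by (auto simp: W_def H_def)
      qed
      moreover have "open W"
        unfolding W_def using W0(1) W1(1) W2(1)
        by (intro open_Un open_Int open_lessThan open_greaterThan)
      moreover have "\<gamma> t \<notin> \<gamma> ` ({0..1} - W)"
      proof
        assume "\<gamma> t \<in> \<gamma> ` ({0..1} - W)"
        then obtain s where s: "s \<in> {0..1}" "s \<notin> W" "\<gamma> t = \<gamma> s" by blast
        then have "s = 0 \<or> s = 1" using inj[OF t(1) s(1)] True by auto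
        then show False using s(2) W0(2) W1(2) W2(2) t0 by (auto simp: W_def)
      qed
      ultimately show ?thesis using p1 gt by (intro exI[of _ p1] exI[of _ W]) auto
    qed
  qed
  have "primitive_along \<omega> (\<lambda>x. x) (path_image \<gamma> - {\<gamma> t0}) u"
    unfolding primitive_along_def
  proof
    fix x assume "x \<in> path_image \<gamma> - {\<gamma> t0}"
    then obtain t where t: "t \<in> {0..1}" "x = \<gamma> t" and "x \<noteq> \<gamma> t0" unfolding path_image_def by blast
    then have tt0: "t \<noteq> t0" by auto
    obtain p W where p: "primitive_at \<omega> (\<gamma> t) p" and W: "open W" "\<forall>s\<in>W \<inter> {0..1}. H s = p (\<gamma> s)"
        "\<gamma> t \<notin> \<gamma> ` ({0..1} - W)"
      using local[OF t(1) tt0] by blast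
    have "\<forall>\<^sub>F y in nhds x. y \<in> path_image \<gamma> - {\<gamma> t0} \<longrightarrow> u y = p y"
      using eventually_nhds_preimage_near[OF c\<gamma> W(1,3)] unfolding t(2)
    proof eventually_elim
      case (elim y)
      show ?case
      proof
        assume "y \<in> path_image \<gamma> - {\<gamma> t0}"
        then have "y \<in> \<gamma> ` {0..1}" by (simp add: path_image_def)
        then obtain s where "s \<in> W \<inter> {0..1}" "y = \<gamma> s" using elim by blast
        then show "u y = p y" using W(2) u by auto
      qed
    qed
    then show "\<exists>p. primitive_at \<omega> x p \<and> (\<forall>\<^sub>F y in nhds x. y \<in> path_image \<gamma> - {\<gamma> t0} \<longrightarrow> u y = p y)"
      using p t(2) by blast
  qed
  then show thesis
    by (rule that) (use u t0 in \<open>auto simp: H_def\<close>)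
qed

section \<open>Riemann--Stieltjes and line integrals\<close>

definition variation_bounded :: "(real \<Rightarrow> 'a::real_normed_vector) \<Rightarrow> real \<Rightarrow> bool" where
  "variation_bounded g V \<longleftrightarrow> (\<forall>d. d division_of {0..1} \<longrightarrow> (\<Sum>K\<in>d. norm (g (Sup K) - g (Inf K))) \<le> V)"

lemma tagged_division_unit_intervalE:
  assumes "p tagged_division_of {0..1::real}" "(x, K) \<in> p"
  obtains u v where "K = {u..v}" "Inf K = u" "Sup K = v" "0 \<le> u" "u \<le> x" "x \<le> v" "v \<le> 1"
proof -
  obtain u v where K: "K = {u..v}" using tagged_division_ofD(4)[OF assms] by auto
  have "x \<in> K" "K \<subseteq> {0..1}" using tagged_division_ofD(2,3)[OF assms] by auto
  then show thesis using K by (intro that) auto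
qed

lemma variation_bounded_tagged:
  assumes V: "variation_bounded g V" and p: "p tagged_division_of {0..1}"
  shows "(\<Sum>(x, K)\<in>p. norm (g (Sup K) - g (Inf K))) \<le> V"
proof -
  have ne: "K \<noteq> {}" if "(x, K) \<in> p" for x K
    using tagged_division_ofD(2)[OF p that] by blast
  let ?d = "\<lambda>K. if K = {} then 0 else norm (g (Sup K) - g (Inf K))"
  have "(\<Sum>(x, K)\<in>p. norm (g (Sup K) - g (Inf K))) = (\<Sum>(x, K)\<in>p. ?d K)"
    by (rule sum.cong) (auto dest: ne)
  also have "\<dots> = (\<Sum>K\<in>snd ` p. ?d K)"
    using p
  proof (rule sum.over_tagged_division_lemma)
    fix u v :: real assume "box u v = {}"
    then have "cbox u v = {} \<or> u = v" by auto
    then show "?d (cbox u v) = 0" by auto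
  qed
  also have "\<dots> = (\<Sum>K\<in>snd ` p. norm (g (Sup K) - g (Inf K)))"
    by (rule sum.cong) (auto dest: ne)
  also have "\<dots> \<le> V"
    using V division_of_tagged_division[OF p] unfolding variation_bounded_def by blast
  finally show ?thesis .
qed

text \<open>The increments of \<open>\<Psi>\<close> telescope, and the local errors are summed against the additive
  majorant \<open>m\<close>. It will be applied with the length and with the variation of a curve as majorant.\<close>

lemma tagged_sum_approximates_increment:
  assumes p: "p tagged_division_of {0..1}" "(\<lambda>x. ball x \<delta>) fine p"
    and loc: "\<And>u x v. 0 \<le> u \<Longrightarrow> u \<le> x \<Longrightarrow> x \<le> v \<Longrightarrow> v \<le> 1 \<Longrightarrow> x - u < \<delta> \<Longrightarrow> v - x < \<delta> \<Longrightarrow>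
        norm (F x u v - (\<Psi> v - \<Psi> u)) \<le> \<epsilon> * m u v"
    and m: "(\<Sum>(x, K)\<in>p. m (Inf K) (Sup K)) \<le> C" and \<epsilon>: "\<epsilon> \<ge> 0"
  shows "norm ((\<Sum>(x, K)\<in>p. F x (Inf K) (Sup K)) - (\<Psi> 1 - \<Psi> 0)) \<le> \<epsilon> * C"
proof -
  have "(\<Sum>(x, K)\<in>p. F x (Inf K) (Sup K)) - (\<Psi> 1 - \<Psi> 0)
      = (\<Sum>(x, K)\<in>p. F x (Inf K) (Sup K) - (\<Psi> (Sup K) - \<Psi> (Inf K)))"
    by (simp add: additive_tagged_division_1[OF _ p(1), symmetric] sum_subtractf[symmetric] case_prod_beta)
  also have "norm \<dots> \<le> (\<Sum>(x, K)\<in>p. \<epsilon> * m (Inf K) (Sup K))"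
  proof (rule sum_norm_le, clarify)
    fix x K assume xK: "(x, K) \<in> p"
    obtain u v where uv: "K = {u..v}" "Inf K = u" "Sup K = v" "0 \<le> u" "u \<le> x" "x \<le> v" "v \<le> 1"
      by (rule tagged_division_unit_intervalE[OF p(1) xK])
    have "K \<subseteq> ball x \<delta>" using p(2) xK by (auto simp: fine_def)
    moreover have "u \<in> K" "v \<in> K" using uv by auto
    ultimately have "u \<in> ball x \<delta>" "v \<in> ball x \<delta>" by blast+
    then have "x - u < \<delta>" "v - x < \<delta>" using uv by (auto simp: dist_real_def)
    then show "norm (F x (Inf K) (Sup K) - (\<Psi> (Sup K) - \<Psi> (Inf K))) \<le> \<epsilon> * m (Inf K) (Sup K)"
      unfolding uv(2,3) using uv by (intro loc) auto
  qed
  also have "\<dots> = \<epsilon> * (\<Sum>(x, K)\<in>p. m (Inf K) (Sup K))"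
    by (simp add: sum_distrib_left case_prod_beta)
  also have "\<dots> \<le> \<epsilon> * C" by (rule mult_left_mono[OF m \<epsilon>])
  finally show ?thesis .
qed

text \<open>Integration by parts: \<open>f dg = d(f g) - g f' dt\<close> shows what the integral must be, and for continuously
  differentiable \<open>f\<close> the right-hand side makes sense for every continuous \<open>g\<close>.\<close>

lemma has_rs_integral_polynomial:
  fixes f :: "real \<Rightarrow> complex" and g :: "real \<Rightarrow> real"
  assumes f: "polynomial_function f" and g: "continuous_on {0..1} g"
  shows "\<exists>I. has_rs_integral f g I"
proof -
  obtain f' where f': "polynomial_function f'" "\<And>x. (f has_vector_derivative f' x) (at x)"
    using has_vector_derivative_polynomial_function[OF f] by metis
  have cf': "continuous_on S f'" for S by (rule continuous_on_polymonial_function[OF f'(1)])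
  have "compact (f' ` {0..1})" by (intro compact_continuous_image cf') auto
  from compact_imp_bounded[OF this] obtain M where M: "M > 0" "\<And>x. x \<in> {0..1} \<Longrightarrow> norm (f' x) \<le> M"
    unfolding bounded_pos by auto
  have cg: "continuous_on {u..v} g" if "0 \<le> u" "v \<le> 1" for u v
    by (rule continuous_on_subset[OF g]) (use that in auto)
  have int: "(\<lambda>t. g t *\<^sub>R f' t) integrable_on {u..v}" if "0 \<le> u" "v \<le> 1" for u v
    by (intro integrable_continuous_real continuous_intros cf' cg that)
  define \<Psi> where "\<Psi> t = g t *\<^sub>R f t - integral {0..t} (\<lambda>t. g t *\<^sub>R f' t)" for t
  have loc: "\<exists>\<delta>>0. \<forall>u x v. 0 \<le> u \<longrightarrow> u \<le> x \<longrightarrow> x \<le> v \<longrightarrow> v \<le> 1 \<longrightarrow> x - u < \<delta> \<longrightarrow> v - x < \<delta> \<longrightarrow>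
      norm ((g v - g u) *\<^sub>R f x - (\<Psi> v - \<Psi> u)) \<le> \<epsilon> * (v - u)" if \<epsilon>: "\<epsilon> > 0" for \<epsilon>
  proof -
    have "uniformly_continuous_on {0..1} g" by (rule compact_uniformly_continuous[OF g]) simp
    then obtain \<delta> where \<delta>: "\<delta> > 0"
      "\<And>s t. s \<in> {0..1} \<Longrightarrow> t \<in> {0..1} \<Longrightarrow> dist s t < \<delta> \<Longrightarrow> dist (g s) (g t) < \<epsilon> / M"
      unfolding uniformly_continuous_on_def using \<epsilon> M(1) by (metis divide_pos_pos)
    have part: "norm (integral {a..b} (\<lambda>t. g t *\<^sub>R f' t) - g c *\<^sub>R (f b - f a)) \<le> \<epsilon> * (b - a)"
      if ab: "0 \<le> a" "a \<le> b" "b \<le> 1" "b - a < \<delta>" "c \<in> {a..b}" for a b c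
    proof -
      have "(f' has_integral f b - f a) {a..b}"
        using ab(2) f'(2) by (intro fundamental_theorem_of_calculus) (auto intro: has_vector_derivative_at_within)
      then have "((\<lambda>t. g t *\<^sub>R f' t - g c *\<^sub>R f' t) has_integral
          integral {a..b} (\<lambda>t. g t *\<^sub>R f' t) - g c *\<^sub>R (f b - f a)) {a..b}"
        by (intro has_integral_diff has_integral_cmul integrable_integral int ab(1,3))
      moreover have "norm (g t *\<^sub>R f' t - g c *\<^sub>R f' t) \<le> \<epsilon>" if t: "t \<in> {a..b}" for t
      proof -
        have "\<bar>g t - g c\<bar> \<le> \<epsilon> / M"
          using \<delta>(2)[of t c] t ab by (force simp: dist_real_def)
        then have "\<bar>g t - g c\<bar> * norm (f' t) \<le> \<epsilon> / M * M"
          using M t ab \<epsilon> by (intro mult_mono) auto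
        then show ?thesis using M(1) by (simp flip: scaleR_left_diff_distrib)
      qed
      ultimately show ?thesis
        using has_integral_bound_real[of \<epsilon> "{}" "\<lambda>t. g t *\<^sub>R f' t - g c *\<^sub>R f' t" _ a b] \<epsilon> ab(2)
        by (simp add: content_real)
    qed
    show ?thesis
    proof (intro exI[of _ \<delta>] conjI allI impI)
      fix u x v assume A: "0 \<le> u" "u \<le> x" "x \<le> v" "v \<le> 1" "x - u < \<delta>" "v - x < \<delta>"
      have "integral {0..u} (\<lambda>t. g t *\<^sub>R f' t) + integral {u..x} (\<lambda>t. g t *\<^sub>R f' t)
          = integral {0..x} (\<lambda>t. g t *\<^sub>R f' t)"
        using A by (intro Henstock_Kurzweil_Integration.integral_combine int) auto
      note e1 = this
      have e2: "integral {0..x} (\<lambda>t. g t *\<^sub>R f' t) + integral {x..v} (\<lambda>t. g t *\<^sub>R f' t)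
          = integral {0..v} (\<lambda>t. g t *\<^sub>R f' t)"
        using A by (intro Henstock_Kurzweil_Integration.integral_combine int) auto
      have "(g v - g u) *\<^sub>R f x - (\<Psi> v - \<Psi> u)
          = (integral {u..x} (\<lambda>t. g t *\<^sub>R f' t) - g u *\<^sub>R (f x - f u))
          + (integral {x..v} (\<lambda>t. g t *\<^sub>R f' t) - g v *\<^sub>R (f v - f x))"
        by (simp add: \<Psi>_def scaleR_diff_left scaleR_diff_right e1[symmetric] e2[symmetric])
      also have "norm \<dots> \<le> \<epsilon> * (x - u) + \<epsilon> * (v - x)"
        using A by (intro norm_triangle_le add_mono part) auto
      finally show "norm ((g v - g u) *\<^sub>R f x - (\<Psi> v - \<Psi> u)) \<le> \<epsilon> * (v - u)"
        by (simp add: algebra_simps)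
    qed (rule \<delta>(1))
  qed
  have "has_rs_integral f g (\<Psi> 1 - \<Psi> 0)"
    unfolding has_rs_integral_def
  proof (intro allI impI)
    fix \<epsilon> :: real assume \<epsilon>: "\<epsilon> > 0"
    from loc[of "\<epsilon> / 2"] \<epsilon> obtain \<delta> where \<delta>: "\<delta> > 0"
      "\<And>u x v. 0 \<le> u \<Longrightarrow> u \<le> x \<Longrightarrow> x \<le> v \<Longrightarrow> v \<le> 1 \<Longrightarrow> x - u < \<delta> \<Longrightarrow> v - x < \<delta> \<Longrightarrow>
        norm ((g v - g u) *\<^sub>R f x - (\<Psi> v - \<Psi> u)) \<le> \<epsilon> / 2 * (v - u)" by auto
    show "\<exists>\<delta>>0. \<forall>p. p tagged_division_of {0..1} \<and> (\<lambda>x. ball x \<delta>) fine p \<longrightarrow>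
        norm ((\<Sum>(x, K)\<in>p. (g (Sup K) - g (Inf K)) *\<^sub>R f x) - (\<Psi> 1 - \<Psi> 0)) < \<epsilon>"
    proof (intro exI[of _ \<delta>] conjI allI impI \<delta>(1), elim conjE)
      fix p assume p: "p tagged_division_of {0..1::real}" "(\<lambda>x. ball x \<delta>) fine p"
      have "norm ((\<Sum>(x, K)\<in>p. (g (Sup K) - g (Inf K)) *\<^sub>R f x) - (\<Psi> 1 - \<Psi> 0)) \<le> \<epsilon> / 2 * 1"
      proof (rule tagged_sum_approximates_increment[OF p])
        show "(\<Sum>(x, K)\<in>p. Sup K - Inf K) \<le> (1::real)"
          using additive_tagged_division_1[OF _ p(1), of "\<lambda>x. x"] by simp
      qed (use \<delta>(2) \<epsilon> in auto)
      then show "norm ((\<Sum>(x, K)\<in>p. (g (Sup K) - g (Inf K)) *\<^sub>R f x) - (\<Psi> 1 - \<Psi> 0)) < \<epsilon>"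
        using \<epsilon> by simp
    qed
  qed
  then show ?thesis ..
qed

lemma norm_triangle_three:
  fixes a b c d :: "'a::real_normed_vector"
  shows "norm (a - d) \<le> norm (a - b) + norm (b - c) + norm (c - d)"
  using norm_triangle_le[of "a - b" "b - d" "norm (a - b) + norm (b - c) + norm (c - d)"]
    norm_triangle_ineq[of "b - c" "c - d"] by simp

lemma fine_tagged_division_exists:
  assumes "\<delta> > 0"
  obtains p where "p tagged_division_of {0..1::real}" "(\<lambda>x. ball x \<delta>) fine p"
  by (rule fine_division_exists_real[OF gauge_ball[OF assms]]) (rule that)

lemma has_rs_integral_diff_bound:
  assumes V: "variation_bounded g V" and I: "has_rs_integral fa g I1" "has_rs_integral fb g I2"
    and close: "\<And>t. t \<in> {0..1} \<Longrightarrow> norm (fa t - fb t) \<le> e"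
  shows "norm (I1 - I2) \<le> e * V"
proof (rule field_le_epsilon)
  fix \<epsilon> :: real assume "\<epsilon> > 0"
  then have "\<epsilon> / 2 > 0" by simp
  obtain \<delta>1 where \<delta>1: "\<delta>1 > 0" "\<And>p. p tagged_division_of {0..1} \<Longrightarrow> (\<lambda>x. ball x \<delta>1) fine p \<Longrightarrow>
      norm ((\<Sum>(x, K)\<in>p. (g (Sup K) - g (Inf K)) *\<^sub>R fa x) - I1) < \<epsilon> / 2"
    using I(1)[unfolded has_rs_integral_def, rule_format, OF \<open>\<epsilon> / 2 > 0\<close>] by (elim exE conjE) simp
  obtain \<delta>2 where \<delta>2: "\<delta>2 > 0" "\<And>p. p tagged_division_of {0..1} \<Longrightarrow> (\<lambda>x. ball x \<delta>2) fine p \<Longrightarrow>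
      norm ((\<Sum>(x, K)\<in>p. (g (Sup K) - g (Inf K)) *\<^sub>R fb x) - I2) < \<epsilon> / 2"
    using I(2)[unfolded has_rs_integral_def, rule_format, OF \<open>\<epsilon> / 2 > 0\<close>] by (elim exE conjE) simp
  obtain p where p: "p tagged_division_of {0..1::real}" "(\<lambda>x. ball x (min \<delta>1 \<delta>2)) fine p"
    using fine_tagged_division_exists[of "min \<delta>1 \<delta>2"] \<delta>1(1) \<delta>2(1) by auto
  have fine: "(\<lambda>x. ball x \<delta>1) fine p" "(\<lambda>x. ball x \<delta>2) fine p"
    using p(2) by (auto simp: fine_def subset_iff)
  let ?S = "\<lambda>f. \<Sum>(x, K)\<in>p. (g (Sup K) - g (Inf K)) *\<^sub>R (f x :: complex)"
  have "?S fa - ?S fb = (\<Sum>(x, K)\<in>p. (g (Sup K) - g (Inf K)) *\<^sub>R (fa x - fb x))"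
    by (simp add: sum_subtractf[symmetric] case_prod_beta scaleR_diff_right)
  also have "norm \<dots> \<le> (\<Sum>(x, K)\<in>p. e * norm (g (Sup K) - g (Inf K)))"
  proof (rule sum_norm_le, clarify)
    fix x K assume "(x, K) \<in> p"
    then have "norm (fa x - fb x) \<le> e" using tag_in_interval[OF p(1)] close by blast
    then show "norm ((g (Sup K) - g (Inf K)) *\<^sub>R (fa x - fb x)) \<le> e * norm (g (Sup K) - g (Inf K))"
      by (simp add: mult.commute mult_right_mono)
  qed
  also have "\<dots> = e * (\<Sum>(x, K)\<in>p. norm (g (Sup K) - g (Inf K)))"
    by (simp add: sum_distrib_left case_prod_beta)
  also have "\<dots> \<le> e * V"
  proof (rule mult_left_mono[OF variation_bounded_tagged[OF V p(1)]])
    show "e \<ge> 0" using close[of 0] norm_ge_zero[of "fa 0 - fb 0"] by (auto simp del: norm_ge_zero)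
  qed
  finally have "norm (?S fa - ?S fb) \<le> e * V" .
  moreover have "norm (?S fa - I1) < \<epsilon> / 2" "norm (?S fb - I2) < \<epsilon> / 2"
    using \<delta>1(2)[OF p(1) fine(1)] \<delta>2(2)[OF p(1) fine(2)] .
  moreover have "norm (I1 - I2) \<le> norm (I1 - ?S fa) + norm (?S fa - ?S fb) + norm (?S fb - I2)"
    by (rule norm_triangle_three)
  moreover have "norm (I1 - ?S fa) = norm (?S fa - I1)" by (rule norm_minus_commute)
  ultimately show "norm (I1 - I2) \<le> e * V + \<epsilon>" by linarith
qed

lemma has_rs_integral_uniform_limit:
  assumes V: "variation_bounded g V" and I: "has_rs_integral fa g I1"
    and close: "\<And>t. t \<in> {0..1} \<Longrightarrow> norm (f t - fa t) \<le> e" and e: "e * V + norm (I1 - I) < \<epsilon>"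
  shows "\<exists>\<delta>>0. \<forall>p. p tagged_division_of {0..1} \<and> (\<lambda>x. ball x \<delta>) fine p \<longrightarrow>
    norm ((\<Sum>(x, K)\<in>p. (g (Sup K) - g (Inf K)) *\<^sub>R f x) - I) < \<epsilon>"
proof -
  define \<eta> where "\<eta> = \<epsilon> - (e * V + norm (I1 - I))"
  have "\<eta> > 0" using e by (simp add: \<eta>_def)
  obtain \<delta> where \<delta>: "\<delta> > 0" "\<And>p. p tagged_division_of {0..1} \<Longrightarrow> (\<lambda>x. ball x \<delta>) fine p \<Longrightarrow>
      norm ((\<Sum>(x, K)\<in>p. (g (Sup K) - g (Inf K)) *\<^sub>R fa x) - I1) < \<eta>"
    using I[unfolded has_rs_integral_def, rule_format, OF \<open>\<eta> > 0\<close>] by (elim exE conjE) simp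
  show ?thesis
  proof (intro exI[of _ \<delta>] conjI allI impI \<delta>(1), elim conjE)
    fix p assume p: "p tagged_division_of {0..1::real}" "(\<lambda>x. ball x \<delta>) fine p"
    let ?S = "\<lambda>f. \<Sum>(x, K)\<in>p. (g (Sup K) - g (Inf K)) *\<^sub>R (f x :: complex)"
    have "?S f - ?S fa = (\<Sum>(x, K)\<in>p. (g (Sup K) - g (Inf K)) *\<^sub>R (f x - fa x))"
      by (simp add: sum_subtractf[symmetric] case_prod_beta scaleR_diff_right)
    also have "norm \<dots> \<le> (\<Sum>(x, K)\<in>p. e * norm (g (Sup K) - g (Inf K)))"
    proof (rule sum_norm_le, clarify)
      fix x K assume "(x, K) \<in> p"
      then have "norm (f x - fa x) \<le> e" using tag_in_interval[OF p(1)] close by blast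
      then show "norm ((g (Sup K) - g (Inf K)) *\<^sub>R (f x - fa x)) \<le> e * norm (g (Sup K) - g (Inf K))"
        by (simp add: mult.commute mult_right_mono)
    qed
    also have "\<dots> = e * (\<Sum>(x, K)\<in>p. norm (g (Sup K) - g (Inf K)))"
      by (simp add: sum_distrib_left case_prod_beta)
    also have "\<dots> \<le> e * V"
    proof (rule mult_left_mono[OF variation_bounded_tagged[OF V p(1)]])
      show "e \<ge> 0" using close[of 0] norm_ge_zero[of "f 0 - fa 0"] by (auto simp del: norm_ge_zero)
    qed
    finally have "norm (?S f - ?S fa) \<le> e * V" .
    moreover have "norm (?S fa - I1) < \<eta>" by (rule \<delta>(2)[OF p])
    moreover have "norm (?S f - I) \<le> norm (?S f - ?S fa) + norm (?S fa - I1) + norm (I1 - I)"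
      by (rule norm_triangle_three)
    ultimately show "norm (?S f - I) < \<epsilon>" unfolding \<eta>_def by linarith
  qed
qed

text \<open>The integral changes by at most \<open>V\<close> times the uniform distance of the integrands, so the
  integrals of approximating Weierstrass polynomials converge.\<close>

lemma has_rs_integral_continuous:
  fixes f :: "real \<Rightarrow> complex"
  assumes f: "continuous_on {0..1} f" and g: "continuous_on {0..1} g" and V: "variation_bounded g V"
  shows "\<exists>I. has_rs_integral f g I"
proof -
  have V0: "V \<ge> 0"
    using V division_of_self[of 0 "1::real"] unfolding variation_bounded_def
    by (force intro: order_trans[OF sum_nonneg])
  have "\<exists>h. polynomial_function h \<and> (\<forall>t\<in>{0..1}. norm (f t - h t) < inverse (real (Suc n)))" for n
    by (rule Stone_Weierstrass_polynomial_function[OF _ f]) auto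
  then obtain h where h: "\<And>n. polynomial_function (h n)"
      "\<And>n t. t \<in> {0..1} \<Longrightarrow> norm (f t - h n t) < inverse (real (Suc n))"
    by metis
  obtain J where J: "\<And>n. has_rs_integral (h n) g (J n)"
    using has_rs_integral_polynomial[OF h(1) g] by metis
  have diff: "norm (J m - J n) \<le> (inverse (real (Suc m)) + inverse (real (Suc n))) * V" for m n
  proof (rule has_rs_integral_diff_bound[OF V J J])
    fix t :: real assume "t \<in> {0..1}"
    then show "norm (h m t - h n t) \<le> inverse (real (Suc m)) + inverse (real (Suc n))"
      using h(2)[of t m] h(2)[of t n] norm_triangle_ineq4[of "f t - h n t" "f t - h m t"] by simp
  qed
  have lim0: "(\<lambda>n. inverse (real (Suc n)) * V) \<longlonglongrightarrow> 0"
    using tendsto_mult_left_zero[OF LIMSEQ_inverse_real_of_nat, of V] by simp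
  have "Cauchy J"
  proof (rule CauchyI)
    fix e :: real assume "e > 0"
    then have "\<forall>\<^sub>F n in sequentially. inverse (real (Suc n)) * V < e / 2"
      using order_tendstoD(2)[OF lim0, of "e / 2"] by simp
    then obtain N where N: "\<And>n. n \<ge> N \<Longrightarrow> inverse (real (Suc n)) * V < e / 2"
      unfolding eventually_sequentially by blast
    have "norm (J m - J n) < e" if "m \<ge> N" "n \<ge> N" for m n
      using diff[of m n] N[OF that(1)] N[OF that(2)] by (simp add: distrib_right)
    then show "\<exists>N. \<forall>m\<ge>N. \<forall>n\<ge>N. norm (J m - J n) < e" by blast
  qed
  then obtain I where I: "J \<longlonglongrightarrow> I" using Cauchy_convergent_iff convergent_def by blast
  have "has_rs_integral f g I"
    unfolding has_rs_integral_def
  proof (intro allI impI)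
    fix \<epsilon> :: real assume "\<epsilon> > 0"
    have "(\<lambda>n. inverse (real (Suc n)) * V + norm (J n - I)) \<longlonglongrightarrow> 0 + 0"
      by (intro tendsto_add lim0 tendsto_norm_zero LIM_zero I)
    then have "\<forall>\<^sub>F n in sequentially. inverse (real (Suc n)) * V + norm (J n - I) < \<epsilon>"
      using \<open>\<epsilon> > 0\<close> by (intro order_tendstoD(2)) auto
    then obtain n where n: "inverse (real (Suc n)) * V + norm (J n - I) < \<epsilon>"
      using eventually_happens by fastforce
    show "\<exists>\<delta>>0. \<forall>p. p tagged_division_of {0..1} \<and> (\<lambda>x. ball x \<delta>) fine p \<longrightarrow>
        norm ((\<Sum>(x, K)\<in>p. (g (Sup K) - g (Inf K)) *\<^sub>R f x) - I) < \<epsilon>"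
      by (rule has_rs_integral_uniform_limit[OF V J[of n] _ n]) (use h(2) in \<open>auto intro: less_imp_le\<close>)
  qed
  then show ?thesis ..
qed

lemma has_rs_integral_rs_integral:
  assumes "continuous_on {0..1} f" "continuous_on {0..1} g" and V: "variation_bounded g V"
  shows "has_rs_integral f g (rs_integral f g)"
proof -
  obtain I where I: "has_rs_integral f g I" using has_rs_integral_continuous[OF assms] ..
  have "J = I" if "has_rs_integral f g J" for J
    using has_rs_integral_diff_bound[OF V that I, of 0] by simp
  from theI[of "has_rs_integral f g", OF I this] show ?thesis unfolding rs_integral_def .
qed

lemma bounded_linear_vec_expansion:
  assumes "bounded_linear (L :: real^'n \<Rightarrow> 'b::real_normed_vector)"
  shows "L w = (\<Sum>j\<in>UNIV. (w $ j) *\<^sub>R L (axis j 1))"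
proof -
  interpret bounded_linear L by fact
  have "L w = L (\<Sum>j\<in>UNIV. (w $ j) *\<^sub>R axis j 1)"
    using basis_expansion[of w] by (simp add: scalar_mult_eq_scaleR)
  then show ?thesis by (simp add: sum scaleR)
qed

text \<open>Near each point of the curve \<open>p - f (\<gamma> x) L\<close> has a derivative of small norm, so the mean value
  inequality applies to every local primitive \<open>p\<close>; the Lebesgue number of the resulting cover of the parameter
  interval is \<open>\<delta>\<close>.\<close>

lemma primitive_increment_estimate:
  fixes f :: "real^'n \<Rightarrow> complex" and \<gamma> :: "real \<Rightarrow> real^'n"
  assumes L: "bounded_linear L" and \<Omega>: "open \<Omega>" and f: "continuous_on \<Omega> f"
    and \<gamma>: "continuous_on {0..1} \<gamma>" "\<gamma> ` {0..1} \<subseteq> \<Omega>"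
    and h: "primitive_along (\<lambda>v w. f v * L w) \<gamma> {0..1} h" and \<epsilon>: "\<epsilon> > 0"
  shows "\<exists>\<delta>>0. \<forall>u x v. 0 \<le> u \<longrightarrow> u \<le> x \<longrightarrow> x \<le> v \<longrightarrow> v \<le> 1 \<longrightarrow> x - u < \<delta> \<longrightarrow> v - x < \<delta> \<longrightarrow>
    norm (f (\<gamma> x) * L (\<gamma> v - \<gamma> u) - (h v - h u)) \<le> \<epsilon> * norm (\<gamma> v - \<gamma> u)"
proof -
  interpret L: bounded_linear L by fact
  obtain A where A: "A > 0" "\<And>w. norm (L w) \<le> norm w * A" using L.pos_bounded by blast
  define good where "good W \<longleftrightarrow> (\<forall>u\<in>W \<inter> {0..1}. \<forall>v\<in>W \<inter> {0..1}. \<forall>x\<in>W \<inter> {0..1}.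
     norm (f (\<gamma> x) * L (\<gamma> v - \<gamma> u) - (h v - h u)) \<le> \<epsilon> * norm (\<gamma> v - \<gamma> u))" for W
  have loc: "\<exists>W. open W \<and> t \<in> W \<and> good W" if t: "t \<in> {0..1}" for t
  proof -
    obtain p where p: "primitive_at (\<lambda>v w. f v * L w) (\<gamma> t) p"
        "\<forall>\<^sub>F s in nhds t. s \<in> {0..1} \<longrightarrow> h s = p (\<gamma> s)"
      using h t unfolding primitive_along_def by blast
    have gt: "\<gamma> t \<in> \<Omega>" using \<gamma>(2) t by blast
    then have "isCont f (\<gamma> t)" using f \<Omega> by (simp add: continuous_on_eq_continuous_at)
    then have "\<forall>\<^sub>F v in nhds (\<gamma> t). dist (f v) (f (\<gamma> t)) < \<epsilon> / A / 2"
      using \<epsilon> A(1) unfolding isCont_def by (intro tendstoD) (auto simp: tendsto_at_iff_tendsto_nhds)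
    then have "\<forall>\<^sub>F v in nhds (\<gamma> t). (p has_derivative (\<lambda>w. f v * L w)) (at v)
        \<and> dist (f v) (f (\<gamma> t)) < \<epsilon> / A / 2"
      using p(1) unfolding primitive_at_def by eventually_elim simp
    then obtain r where r: "r > 0" "\<And>v. v \<in> ball (\<gamma> t) r \<Longrightarrow> (p has_derivative (\<lambda>w. f v * L w)) (at v)"
        "\<And>v. v \<in> ball (\<gamma> t) r \<Longrightarrow> dist (f v) (f (\<gamma> t)) < \<epsilon> / A / 2"
      unfolding eventually_nhds_metric by (auto simp: dist_commute)
    have "\<forall>\<^sub>F s in nhds t. s \<in> {0..1} \<longrightarrow> \<gamma> s \<in> ball (\<gamma> t) r"
      by (rule eventually_nhds_compose_within[OF \<gamma>(1) t])
        (use r(1) in \<open>intro eventually_nhds_in_open, auto\<close>)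
    then have "\<forall>\<^sub>F s in nhds t. s \<in> {0..1} \<longrightarrow> \<gamma> s \<in> ball (\<gamma> t) r \<and> h s = p (\<gamma> s)"
      using p(2) by eventually_elim simp
    then obtain W where W: "open W" "t \<in> W" "\<And>s. s \<in> W \<Longrightarrow> s \<in> {0..1} \<Longrightarrow> \<gamma> s \<in> ball (\<gamma> t) r \<and> h s = p (\<gamma> s)"
      unfolding eventually_nhds by blast
    have "good W"
      unfolding good_def
    proof (intro ballI)
      fix u v x assume uvx: "u \<in> W \<inter> {0..1}" "v \<in> W \<inter> {0..1}" "x \<in> W \<inter> {0..1}"
      have "norm ((p (\<gamma> v) - f (\<gamma> x) * L (\<gamma> v)) - (p (\<gamma> u) - f (\<gamma> x) * L (\<gamma> u))) \<le> \<epsilon> * norm (\<gamma> v - \<gamma> u)"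
      proof (rule differentiable_bound[where S = "ball (\<gamma> t) r"])
        fix y assume y: "y \<in> ball (\<gamma> t) r"
        show "((\<lambda>y. p y - f (\<gamma> x) * L y) has_derivative (\<lambda>w. f y * L w - f (\<gamma> x) * L w))
            (at y within ball (\<gamma> t) r)"
          by (rule has_derivative_at_withinI)
            (intro has_derivative_diff r(2) y has_derivative_mult_right L.has_derivative has_derivative_ident)
        show "onorm (\<lambda>w. f y * L w - f (\<gamma> x) * L w) \<le> \<epsilon>"
        proof (rule onorm_bound)
          fix w
          have "dist (f y) (f (\<gamma> x)) \<le> dist (f y) (f (\<gamma> t)) + dist (f (\<gamma> x)) (f (\<gamma> t))"
            by (rule dist_triangle2)
          moreover have "\<gamma> x \<in> ball (\<gamma> t) r" using W(3)[of x] uvx(3) by blast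
          ultimately have "dist (f y) (f (\<gamma> x)) \<le> \<epsilon> / A"
            using r(3)[OF y] r(3)[of "\<gamma> x"] by linarith
          then have "norm (f y - f (\<gamma> x)) \<le> \<epsilon> / A" by (simp only: dist_norm)
          then have "norm (f y - f (\<gamma> x)) * norm (L w) \<le> \<epsilon> / A * (norm w * A)"
            using A(1) \<epsilon> by (intro mult_mono A(2)) auto
          then show "norm (f y * L w - f (\<gamma> x) * L w) \<le> \<epsilon> * norm w"
            using A(1) by (simp add: norm_mult flip: left_diff_distrib)
        qed (use \<epsilon> in simp)
      qed (use W(3) uvx in auto)
      moreover have "f (\<gamma> x) * L (\<gamma> v - \<gamma> u) - (h v - h u)
          = - ((p (\<gamma> v) - f (\<gamma> x) * L (\<gamma> v)) - (p (\<gamma> u) - f (\<gamma> x) * L (\<gamma> u)))"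
        using W(3) uvx by (auto simp: L.diff algebra_simps)
      ultimately show "norm (f (\<gamma> x) * L (\<gamma> v - \<gamma> u) - (h v - h u)) \<le> \<epsilon> * norm (\<gamma> v - \<gamma> u)"
        by (simp only: norm_minus_cancel)
    qed
    then show ?thesis using W(1,2) by blast
  qed
  obtain \<delta> where \<delta>: "\<delta> > 0" "\<And>x. x \<in> {0..1::real} \<Longrightarrow> \<exists>W\<in>{W. open W \<and> good W}. ball x \<delta> \<subseteq> W"
  proof (rule Heine_Borel_lemma[of "{0..1::real}" "{W. open W \<and> good W}"])
    show "{0..1} \<subseteq> \<Union>{W. open W \<and> good W}" using loc by blast
  qed auto
  show ?thesis
  proof (intro exI[of _ \<delta>] conjI allI impI \<delta>(1))
    fix u x v :: real assume uxv: "0 \<le> u" "u \<le> x" "x \<le> v" "v \<le> 1" "x - u < \<delta>" "v - x < \<delta>"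
    then obtain W where W: "good W" "ball x \<delta> \<subseteq> W" using \<delta>(2)[of x] by auto
    have "u \<in> ball x \<delta>" "v \<in> ball x \<delta>" "x \<in> ball x \<delta>" using uxv \<delta>(1) by (auto simp: dist_real_def)
    then have "u \<in> W \<inter> {0..1}" "v \<in> W \<inter> {0..1}" "x \<in> W \<inter> {0..1}" using W(2) uxv by auto
    then show "norm (f (\<gamma> x) * L (\<gamma> v - \<gamma> u) - (h v - h u)) \<le> \<epsilon> * norm (\<gamma> v - \<gamma> u)"
      using W(1) unfolding good_def by blast
  qed
qed

text \<open>All coordinate sums are evaluated on a common fine division; their combination with the weights
  \<open>L (axis j 1)\<close> is a sum of terms \<open>f (\<gamma> x) L (\<gamma> v - \<gamma> u)\<close>, each of which is close to an increment of \<open>h\<close>.\<close>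

lemma line_integral_eq_primitive_increment:
  fixes f :: "real^'n \<Rightarrow> complex"
  assumes L: "bounded_linear L" and \<Omega>: "open \<Omega>" and f: "continuous_on \<Omega> f"
    and \<gamma>: "rectifiable \<gamma>" "path_image \<gamma> \<subseteq> \<Omega>"
    and h: "primitive_along (\<lambda>v w. f v * L w) \<gamma> {0..1} h"
  shows "(\<Sum>j\<in>UNIV. L (axis j 1) * rs_integral (\<lambda>t. f (\<gamma> t)) (\<lambda>t. \<gamma> t $ j)) = h 1 - h 0"
proof -
  interpret L: bounded_linear L by fact
  have c\<gamma>: "continuous_on {0..1} \<gamma>" and im: "\<gamma> ` {0..1} \<subseteq> \<Omega>"
    using \<gamma> by (auto simp: rectifiable_def path_def path_image_def)
  obtain V0 where V0: "variation_bounded \<gamma> V0"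
    using \<gamma>(1) unfolding rectifiable_def variation_bounded_def by blast
  define V where "V = max V0 0"
  have V: "variation_bounded \<gamma> V" "V \<ge> 0"
    using V0 by (auto simp: V_def variation_bounded_def)
  have Vj: "variation_bounded (\<lambda>t. \<gamma> t $ j) V" for j
    unfolding variation_bounded_def
  proof (intro allI impI)
    fix d :: "real set set" assume d: "d division_of {0..1}"
    have "(\<Sum>K\<in>d. norm (\<gamma> (Sup K) $ j - \<gamma> (Inf K) $ j)) \<le> (\<Sum>K\<in>d. norm (\<gamma> (Sup K) - \<gamma> (Inf K)))"
      by (rule sum_mono) (simp flip: vector_minus_component add: component_le_norm_cart)
    also have "\<dots> \<le> V" using V(1) d unfolding variation_bounded_def by blast
    finally show "(\<Sum>K\<in>d. norm (\<gamma> (Sup K) $ j - \<gamma> (Inf K) $ j)) \<le> V" .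
  qed
  define R where "R j = rs_integral (\<lambda>t. f (\<gamma> t)) (\<lambda>t. \<gamma> t $ j)" for j
  have R: "has_rs_integral (\<lambda>t. f (\<gamma> t)) (\<lambda>t. \<gamma> t $ j) (R j)" for j
    unfolding R_def
    by (rule has_rs_integral_rs_integral[OF _ _ Vj])
      (use im in \<open>auto intro!: continuous_intros c\<gamma> continuous_on_compose2[OF f c\<gamma>]\<close>)
  define A where "A = (\<Sum>j\<in>UNIV. norm (L (axis j 1)))"
  have A: "A \<ge> 0" by (simp add: A_def sum_nonneg)
  have "norm ((\<Sum>j\<in>UNIV. L (axis j 1) * R j) - (h 1 - h 0)) \<le> 0"
  proof (rule field_le_epsilon)
    fix \<epsilon>0 :: real assume \<epsilon>0: "\<epsilon>0 > 0"
    define \<epsilon> where "\<epsilon> = \<epsilon>0 / (A + V + 1)"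
    have \<epsilon>: "\<epsilon> > 0" using \<epsilon>0 A V(2) by (simp add: \<epsilon>_def)
    have "\<exists>\<delta>. \<delta> > 0 \<and> (\<forall>p. p tagged_division_of {0..1} \<and> (\<lambda>x. ball x \<delta>) fine p \<longrightarrow>
        norm ((\<Sum>(x, K)\<in>p. (\<gamma> (Sup K) $ j - \<gamma> (Inf K) $ j) *\<^sub>R f (\<gamma> x)) - R j) < \<epsilon>)" for j
      using R[of j, unfolded has_rs_integral_def, rule_format, OF \<epsilon>] by blast
    from choice[OF allI, OF this] obtain \<delta>j where \<delta>j': "\<forall>j. \<delta>j j > 0 \<and>
        (\<forall>p. p tagged_division_of {0..1} \<and> (\<lambda>x. ball x (\<delta>j j)) fine p \<longrightarrow>
        norm ((\<Sum>(x, K)\<in>p. (\<gamma> (Sup K) $ j - \<gamma> (Inf K) $ j) *\<^sub>R f (\<gamma> x)) - R j) < \<epsilon>)" ..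
    have \<delta>j: "\<delta>j j > 0"
        "p tagged_division_of {0..1} \<Longrightarrow> (\<lambda>x. ball x (\<delta>j j)) fine p \<Longrightarrow>
        norm ((\<Sum>(x, K)\<in>p. (\<gamma> (Sup K) $ j - \<gamma> (Inf K) $ j) *\<^sub>R f (\<gamma> x)) - R j) < \<epsilon>" for j p
      using \<delta>j' by simp_all
    from primitive_increment_estimate[OF L \<Omega> f c\<gamma> im h \<epsilon>] obtain \<delta>0 where \<delta>0: "\<delta>0 > 0"
        "\<And>u x v. 0 \<le> u \<Longrightarrow> u \<le> x \<Longrightarrow> x \<le> v \<Longrightarrow> v \<le> 1 \<Longrightarrow> x - u < \<delta>0 \<Longrightarrow> v - x < \<delta>0 \<Longrightarrow>
        norm (f (\<gamma> x) * L (\<gamma> v - \<gamma> u) - (h v - h u)) \<le> \<epsilon> * norm (\<gamma> v - \<gamma> u)" by auto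
    define \<delta> where "\<delta> = Min (insert \<delta>0 (range \<delta>j))"
    have "\<delta> > 0" using \<delta>0(1) \<delta>j(1) by (auto simp: \<delta>_def)
    moreover have "\<delta> \<le> \<delta>0" "\<delta> \<le> \<delta>j j" for j
      unfolding \<delta>_def by (intro Min_le; simp)+
    ultimately have \<delta>: "\<delta> > 0" "\<delta> \<le> \<delta>0" "\<delta> \<le> \<delta>j j" for j by blast+
    obtain p where p: "p tagged_division_of {0..1::real}" "(\<lambda>x. ball x \<delta>) fine p"
      by (rule fine_tagged_division_exists[OF \<delta>(1)])
    have fine: "(\<lambda>x. ball x r) fine p" if "\<delta> \<le> r" for r
      using p(2) subset_ball[OF that] unfolding fine_def by fast
    define S where "S j = (\<Sum>(x, K)\<in>p. (\<gamma> (Sup K) $ j - \<gamma> (Inf K) $ j) *\<^sub>R f (\<gamma> x))" for j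
    have "(\<Sum>j\<in>UNIV. L (axis j 1) * S j) = (\<Sum>(x, K)\<in>p. f (\<gamma> x) * L (\<gamma> (Sup K) - \<gamma> (Inf K)))"
      unfolding S_def sum_distrib_left
      by (subst sum.swap)
        (simp add: bounded_linear_vec_expansion[OF L, of "_ - _"] sum_distrib_left case_prod_beta mult_ac)
    moreover have "norm ((\<Sum>(x, K)\<in>p. f (\<gamma> x) * L (\<gamma> (Sup K) - \<gamma> (Inf K))) - (h 1 - h 0)) \<le> \<epsilon> * V"
      by (rule tagged_sum_approximates_increment[OF p(1) fine[OF \<delta>(2)] _ variation_bounded_tagged[OF V(1) p(1)]])
        (use \<delta>0(2) \<epsilon> in auto)
    ultimately have 1: "norm ((\<Sum>j\<in>UNIV. L (axis j 1) * S j) - (h 1 - h 0)) \<le> \<epsilon> * V" by simp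
    have "norm ((\<Sum>j\<in>UNIV. L (axis j 1) * (R j - S j))) \<le> (\<Sum>j\<in>UNIV. norm (L (axis j 1)) * \<epsilon>)"
    proof (rule sum_norm_le)
      fix j
      have "norm (R j - S j) \<le> \<epsilon>"
        using \<delta>j(2)[OF p(1) fine[OF \<delta>(3)], of j] by (simp add: S_def norm_minus_commute)
      then show "norm (L (axis j 1) * (R j - S j)) \<le> norm (L (axis j 1)) * \<epsilon>"
        by (simp add: norm_mult mult_left_mono)
    qed
    also have "\<dots> = A * \<epsilon>" by (simp add: A_def sum_distrib_right)
    finally have 2: "norm ((\<Sum>j\<in>UNIV. L (axis j 1) * (R j - S j))) \<le> A * \<epsilon>" .
    have "(\<Sum>j\<in>UNIV. L (axis j 1) * R j) - (h 1 - h 0)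
        = (\<Sum>j\<in>UNIV. L (axis j 1) * (R j - S j)) + ((\<Sum>j\<in>UNIV. L (axis j 1) * S j) - (h 1 - h 0))"
      by (simp add: right_diff_distrib sum_subtractf)
    also have "norm \<dots> \<le> A * \<epsilon> + \<epsilon> * V" by (intro norm_triangle_le add_mono 1 2)
    also have "\<dots> \<le> (A + V + 1) * \<epsilon>" using \<epsilon> by (simp add: algebra_simps)
    also have "\<dots> = 0 + \<epsilon>0" using A V(2) by (simp add: \<epsilon>_def)
    finally show "norm ((\<Sum>j\<in>UNIV. L (axis j 1) * R j) - (h 1 - h 0)) \<le> 0 + \<epsilon>0" .
  qed
  then show ?thesis by (simp add: R_def)
qed

section \<open>Sides of an oriented triangulated surface\<close>

lemma std_triangle_compact_convex:
  "compact std_triangle" "convex std_triangle" "std_triangle \<noteq> {}"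
  by (simp_all add: std_triangle_def compact_convex_hull finite_imp_compact lessThan_empty_iff)

lemma std_vertex_in_std_triangle: "k < 3 \<Longrightarrow> std_vertex k \<in> std_triangle"
  unfolding std_triangle_def by (rule hull_inc) auto

lemma side_endpoints:
  "side \<sigma> k 0 = \<sigma> (std_vertex k)" "side \<sigma> k 1 = \<sigma> (std_vertex ((k + 1) mod 3))"
  by (simp_all add: side_def linepath_def)

lemma side_param_in_std_triangle:
  assumes "k < 3" "t \<in> {0..1}"
  shows "linepath (std_vertex k) (std_vertex ((k + 1) mod 3)) t \<in> std_triangle"
proof -
  have "closed_segment (std_vertex k) (std_vertex ((k + 1) mod 3)) \<subseteq> std_triangle"
    using assms(1) by (intro closed_segment_subset std_vertex_in_std_triangle std_triangle_compact_convex) auto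
  then show ?thesis using linepath_in_path[OF assms(2)] by blast
qed

lemma path_image_side_subset: "k < 3 \<Longrightarrow> path_image (side \<sigma> k) \<subseteq> \<sigma> ` std_triangle"
  using side_param_in_std_triangle by (auto simp: path_image_def side_def)

text \<open>The three sides of the standard triangle, written out in coordinates, meet in vertices only.\<close>

lemma side_params_disjoint:
  assumes "j < 3" "k < 3" "s \<in> {0..1}" "t \<in> {0..1}"
    and "linepath (std_vertex j) (std_vertex ((j + 1) mod 3)) s
      = linepath (std_vertex k) (std_vertex ((k + 1) mod 3)) t"
  shows "j = k \<and> s = t \<or> (s = 0 \<or> s = 1) \<and> (t = 0 \<or> t = 1)"
proof -
  have jk: "j = 0 \<or> j = 1 \<or> j = 2" "k = 0 \<or> k = 1 \<or> k = 2" using assms(1,2) by auto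
  show ?thesis
    using jk assms(3-5) by (elim disjE) (auto simp: linepath_def std_vertex_def)
qed

definition triangle_vertices :: "(real \<times> real \<Rightarrow> real^3) \<Rightarrow> (real^3) set" where
  "triangle_vertices \<sigma> = \<sigma> ` std_vertex ` {..<3}"

lemma side_vertices:
  "k < 3 \<Longrightarrow> side \<sigma> k 0 \<in> triangle_vertices \<sigma>"
  "side \<sigma> k 1 \<in> triangle_vertices \<sigma>"
  by (auto simp: side_endpoints triangle_vertices_def)

locale inj_triangle =
  fixes \<sigma> :: "real \<times> real \<Rightarrow> real^3"
  assumes cont: "continuous_on std_triangle \<sigma>" and inj: "inj_on \<sigma> std_triangle"
begin

lemma side_eqD:
  assumes "j < 3" "k < 3" "s \<in> {0..1}" "t \<in> {0..1}" "side \<sigma> j s = side \<sigma> k t"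
  shows "j = k \<and> s = t \<or> (s = 0 \<or> s = 1) \<and> (t = 0 \<or> t = 1)"
proof (rule side_params_disjoint[OF assms(1-4)])
  show "linepath (std_vertex j) (std_vertex ((j + 1) mod 3)) s
      = linepath (std_vertex k) (std_vertex ((k + 1) mod 3)) t"
    using assms(5) inj_onD[OF inj] side_param_in_std_triangle[OF assms(1,3)]
      side_param_in_std_triangle[OF assms(2,4)]
    by (auto simp: side_def)
qed

lemma side_continuous: "k < 3 \<Longrightarrow> continuous_on {0..1} (side \<sigma> k)"
  unfolding side_def o_def
  using side_param_in_std_triangle
  by (intro continuous_on_compose2[OF cont] continuous_on_linepath) auto

lemma side_ends_distinct: "k < 3 \<Longrightarrow> side \<sigma> k 0 \<noteq> side \<sigma> k 1"
proof
  assume k: "k < 3" and eq: "side \<sigma> k 0 = side \<sigma> k 1"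
  have "linepath (std_vertex k) (std_vertex ((k + 1) mod 3)) 0
      = linepath (std_vertex k) (std_vertex ((k + 1) mod 3)) 1"
    using eq inj_onD[OF inj] side_param_in_std_triangle[OF k, of 0] side_param_in_std_triangle[OF k, of 1]
    by (auto simp: side_def)
  moreover have "k = 0 \<or> k = 1 \<or> k = 2" using k by auto
  ultimately show False by (elim disjE) (auto simp: linepath_def std_vertex_def)
qed

lemma side_inj:
  assumes "k < 3" "s \<in> {0..1}" "t \<in> {0..1}" "side \<sigma> k s = side \<sigma> k t"
  shows "s = t"
  using side_eqD[OF assms(1,1) assms(2-4)] side_ends_distinct[OF assms(1)] assms(4) by auto

lemma side_Int:
  assumes "j < 3" "k < 3" "j \<noteq> k" "x \<in> path_image (side \<sigma> j)" "x \<in> path_image (side \<sigma> k)"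
  shows "x \<in> triangle_vertices \<sigma>"
proof -
  obtain s t where st: "s \<in> {0..1}" "t \<in> {0..1}" "x = side \<sigma> j s" "x = side \<sigma> k t"
    using assms(4,5) by (auto simp: path_image_def)
  then have "s = 0 \<or> s = 1" using side_eqD[OF assms(1,2) st(1,2)] assms(3) by auto
  then show ?thesis using st(3) side_vertices assms(1) by auto
qed

lemma side_subsetD:
  assumes "j < 3" "k < 3" "path_image (side \<sigma> j) \<subseteq> path_image (side \<sigma> k)"
  shows "j = k"
proof -
  have "side \<sigma> j (1/2) \<in> path_image (side \<sigma> j)" by (simp add: path_image_def)
  then have "side \<sigma> j (1/2) \<in> path_image (side \<sigma> k)" using assms(3) by blast
  then obtain t where "t \<in> {0..1}" "side \<sigma> j (1/2) = side \<sigma> k t"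
    by (auto simp: path_image_def)
  then show ?thesis using side_eqD[OF assms(1,2), of "1/2" t] by auto
qed

end

lemma smooth_triangle_inj_triangle: "smooth_triangle \<sigma> \<Longrightarrow> inj_triangle \<sigma>"
  by (simp add: smooth_triangle_def inj_triangle_def)

lemma finite_triangle_vertices: "finite (triangle_vertices \<sigma>)"
  by (simp add: triangle_vertices_def)

locale oriented_surface =
  fixes P :: "(real \<times> real \<Rightarrow> real^3) set"
  assumes surface: "pw_smooth_oriented_surface P"
begin

lemma triangle: "\<sigma> \<in> P \<Longrightarrow> inj_triangle \<sigma>"
  using surface by (simp add: pw_smooth_oriented_surface_def smooth_triangle_inj_triangle)

lemma finite_P: "finite P"
  using surface by (simp add: pw_smooth_oriented_surface_def)

lemma triangles_meet:
  assumes "\<sigma> \<in> P" "\<tau> \<in> P" "\<sigma> \<noteq> \<tau>"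
  obtains "\<sigma> ` std_triangle \<inter> \<tau> ` std_triangle = {}"
    | x where "x \<in> triangle_vertices \<sigma>" "\<sigma> ` std_triangle \<inter> \<tau> ` std_triangle = {x}"
    | j k where "j < 3" "k < 3" "path_image (side \<sigma> j) = path_image (side \<tau> k)"
      "\<sigma> ` std_triangle \<inter> \<tau> ` std_triangle = path_image (side \<sigma> j)"
      "side \<sigma> j 0 = side \<tau> k 1" "side \<sigma> j 1 = side \<tau> k 0"
proof -
  from surface assms consider "\<sigma> ` std_triangle \<inter> \<tau> ` std_triangle = {}"
    | j k where "j < 3" "k < 3" "\<sigma> (std_vertex j) = \<tau> (std_vertex k)"
      "\<sigma> ` std_triangle \<inter> \<tau> ` std_triangle = {\<sigma> (std_vertex j)}"
    | j k where "j < 3" "k < 3" "path_image (side \<sigma> j) = path_image (side \<tau> k)"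
      "\<sigma> ` std_triangle \<inter> \<tau> ` std_triangle = path_image (side \<sigma> j)"
      "pathstart (side \<sigma> j) = pathfinish (side \<tau> k)" "pathfinish (side \<sigma> j) = pathstart (side \<tau> k)"
    unfolding pw_smooth_oriented_surface_def by metis
  then show thesis
  proof cases
    case 1 then show ?thesis by (rule that(1))
  next
    case (2 j k)
    show ?thesis by (rule that(2)[OF _ 2(4)]) (use 2(1) in \<open>auto simp: triangle_vertices_def\<close>)
  next
    case (3 j k)
    show ?thesis by (rule that(3)[OF 3(1-4)]) (use 3(5,6) in \<open>auto simp: pathstart_def pathfinish_def\<close>)
  qed
qed

text \<open>An image of a side is contained in no other side of the same triangle, so the sides named in the definition
  of the surface are \<open>j\<close> and \<open>k\<close>.\<close>

lemma shared_side_opposite: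
  assumes "\<sigma> \<in> P" "\<tau> \<in> P" "\<sigma> \<noteq> \<tau>" "j < 3" "k < 3"
    and eq: "path_image (side \<sigma> j) = path_image (side \<tau> k)"
  shows "side \<sigma> j 0 = side \<tau> k 1" "side \<sigma> j 1 = side \<tau> k 0"
proof -
  interpret s: inj_triangle \<sigma> by (rule triangle[OF assms(1)])
  interpret t: inj_triangle \<tau> by (rule triangle[OF assms(2)])
  have sub: "path_image (side \<sigma> j) \<subseteq> \<sigma> ` std_triangle \<inter> \<tau> ` std_triangle"
    using path_image_side_subset[OF assms(4), of \<sigma>] path_image_side_subset[OF assms(5), of \<tau>] eq by blast
  have in2: "side \<sigma> j 0 \<in> path_image (side \<sigma> j)" "side \<sigma> j 1 \<in> path_image (side \<sigma> j)"
    by (auto simp: path_image_def)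
  have "side \<sigma> j 0 = side \<tau> k 1 \<and> side \<sigma> j 1 = side \<tau> k 0"
  proof (rule triangles_meet[OF assms(1-3)])
    fix x assume "\<sigma> ` std_triangle \<inter> \<tau> ` std_triangle = {x}"
    then have "path_image (side \<sigma> j) \<subseteq> {x}" using sub by simp
    then have "side \<sigma> j 0 = side \<sigma> j 1" using in2 by auto
    then show ?thesis using s.side_ends_distinct[OF assms(4)] by simp
  next
    fix j' k' assume *: "j' < 3" "k' < 3" "path_image (side \<sigma> j') = path_image (side \<tau> k')"
      "\<sigma> ` std_triangle \<inter> \<tau> ` std_triangle = path_image (side \<sigma> j')"
      "side \<sigma> j' 0 = side \<tau> k' 1" "side \<sigma> j' 1 = side \<tau> k' 0"
    have "j = j'" using s.side_subsetD[OF assms(4) *(1)] sub *(4) by blast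
    moreover have "k = k'" using t.side_subsetD[OF assms(5) *(2)] sub *(3,4) eq by blast
    ultimately show ?thesis using * by simp
  qed (use sub in2 in auto)
  then show "side \<sigma> j 0 = side \<tau> k 1" "side \<sigma> j 1 = side \<tau> k 0" by auto
qed

text \<open>A pair \<open>(\<sigma>, j)\<close> stands for the \<open>j\<close>-th side of the triangle \<open>\<sigma>\<close>.\<close>

definition matching :: "(real \<times> real \<Rightarrow> real^3) \<times> nat \<Rightarrow> (real \<times> real \<Rightarrow> real^3) \<times> nat \<Rightarrow> bool" where
  "matching a b \<longleftrightarrow> fst b \<in> P \<and> snd b < 3 \<and> fst b \<noteq> fst a \<and>
     path_image (side (fst a) (snd a)) = path_image (side (fst b) (snd b))"

definition free_sides :: "((real \<times> real \<Rightarrow> real^3) \<times> nat) set" where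
  "free_sides = {a \<in> P \<times> {..<3}. \<not> (\<exists>b. matching a b)}"

lemma surface_edge_eq: "surface_edge P = (\<Union>(\<sigma>, j)\<in>free_sides. path_image (side \<sigma> j))"
proof -
  have iff: "(\<sigma>, j) \<in> free_sides \<longleftrightarrow> \<sigma> \<in> P \<and> j < 3 \<and>
      (\<forall>\<tau>\<in>P - {\<sigma>}. \<forall>k<3. path_image (side \<tau> k) \<noteq> path_image (side \<sigma> j))" for \<sigma> j
    unfolding free_sides_def matching_def
    by (simp add: eq_commute[of "path_image (side \<sigma> j)"]) blast
  show ?thesis
  proof (intro set_eqI)
    fix x
    have "x \<in> surface_edge P \<longleftrightarrow> (\<exists>\<sigma> j. (\<sigma>, j) \<in> free_sides \<and> x \<in> path_image (side \<sigma> j))"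
      unfolding surface_edge_def iff by blast
    then show "x \<in> surface_edge P \<longleftrightarrow> x \<in> (\<Union>(\<sigma>, j)\<in>free_sides. path_image (side \<sigma> j))" by auto
  qed
qed

lemma finite_free_sides: "finite free_sides"
  by (rule finite_subset[of _ "P \<times> {..<3}"]) (auto simp: free_sides_def finite_P)

text \<open>Three triangles cannot share a side: any two of them would traverse it in opposite directions.\<close>

lemma matching_unique:
  assumes a: "a \<in> P \<times> {..<3}" and "matching a b" "matching a c"
  shows "b = c"
proof -
  obtain \<sigma> j where ab: "a = (\<sigma>, j)" by fastforce
  obtain \<tau> k where b: "b = (\<tau>, k)" by fastforce
  obtain \<rho> l where c: "c = (\<rho>, l)" by fastforce
  have s: "\<sigma> \<in> P" "j < 3" using a ab by auto
  have t: "\<tau> \<in> P" "k < 3" "\<tau> \<noteq> \<sigma>" "path_image (side \<sigma> j) = path_image (side \<tau> k)"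
    using assms(2) by (auto simp: matching_def ab b)
  have r: "\<rho> \<in> P" "l < 3" "\<rho> \<noteq> \<sigma>" "path_image (side \<sigma> j) = path_image (side \<rho> l)"
    using assms(3) by (auto simp: matching_def ab c)
  interpret t: inj_triangle \<tau> by (rule triangle[OF t(1)])
  have "\<tau> = \<rho>"
  proof (rule ccontr)
    assume ne: "\<tau> \<noteq> \<rho>"
    have "side \<tau> k 1 = side \<sigma> j 0"
      using shared_side_opposite(1)[OF s(1) t(1) t(3)[symmetric] s(2) t(2,4)] by simp
    also have "\<dots> = side \<rho> l 1"
      by (rule shared_side_opposite(1)[OF s(1) r(1) r(3)[symmetric] s(2) r(2,4)])
    also have "\<dots> = side \<tau> k 0"
      using shared_side_opposite(1)[OF t(1) r(1) ne t(2) r(2)] t(4) r(4) by simp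
    finally show False using t.side_ends_distinct[OF t(2)] by simp
  qed
  moreover have "k = l" using t.side_subsetD[OF t(2), of l] r t calculation by auto
  ultimately show ?thesis by (simp add: b c)
qed

text \<open>The partner of a side that is not free is unique, so taking partners is an involution; it changes the sign
  of \<open>d\<close>, and the contributions of these sides cancel.\<close>

lemma sum_free_sides:
  fixes d :: "(real \<times> real \<Rightarrow> real^3) \<Rightarrow> nat \<Rightarrow> complex"
  assumes closed: "\<And>\<sigma>. \<sigma> \<in> P \<Longrightarrow> d \<sigma> 0 + d \<sigma> 1 + d \<sigma> 2 = 0"
    and opp: "\<And>\<sigma> \<tau> j k. \<sigma> \<in> P \<Longrightarrow> \<tau> \<in> P \<Longrightarrow> \<sigma> \<noteq> \<tau> \<Longrightarrow> j < 3 \<Longrightarrow> k < 3 \<Longrightarrow>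
      path_image (side \<sigma> j) = path_image (side \<tau> k) \<Longrightarrow> d \<tau> k = - d \<sigma> j"
  shows "(\<Sum>(\<sigma>, j)\<in>free_sides. d \<sigma> j) = 0"
proof -
  define N where "N = P \<times> {..<3::nat} - free_sides"
  have fin: "finite (P \<times> {..<3::nat})" using finite_P by simp
  have "(\<Sum>(\<sigma>, j)\<in>P \<times> {..<3}. d \<sigma> j) = (\<Sum>\<sigma>\<in>P. \<Sum>j<3. d \<sigma> j)"
    by (rule sum.cartesian_product[symmetric])
  also have "\<dots> = 0"
  proof (rule sum.neutral, rule ballI)
    fix \<sigma> assume "\<sigma> \<in> P"
    then show "(\<Sum>j<3. d \<sigma> j) = 0"
      using closed[of \<sigma>] by (simp add: numeral_3_eq_3 numeral_2_eq_2)
  qed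
  finally have total: "(\<Sum>(\<sigma>, j)\<in>P \<times> {..<3}. d \<sigma> j) = 0" .
  define partner where "partner a = (SOME b. matching a b)" for a
  have partner: "matching a (partner a)" if "a \<in> N" for a
    using that someI_ex[of "matching a"] unfolding N_def free_sides_def partner_def by blast
  have partner_sym: "matching (partner a) a" if "a \<in> N" for a
    using partner[OF that] that unfolding matching_def N_def by auto
  have pN: "partner a \<in> N" if "a \<in> N" for a
    using partner[OF that] partner_sym[OF that] unfolding N_def free_sides_def
    by (auto simp: matching_def mem_Times_iff)
  have pp: "partner (partner a) = a" if "a \<in> N" for a
    using matching_unique[OF _ partner[OF pN[OF that]] partner_sym[OF that]] pN[OF that] by (simp add: N_def)
  have "(\<Sum>a\<in>N. case a of (\<sigma>, j) \<Rightarrow> d \<sigma> j) = (\<Sum>a\<in>N. - (case a of (\<sigma>, j) \<Rightarrow> d \<sigma> j))"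
  proof (rule sum.reindex_bij_witness[of _ partner partner])
    fix a assume a: "a \<in> N"
    obtain \<sigma> j \<tau> k where ab: "a = (\<sigma>, j)" "partner a = (\<tau>, k)" by fastforce
    have "d \<tau> k = - d \<sigma> j"
      using partner[OF a] a ab by (intro opp) (auto simp: matching_def N_def)
    then show "- (case partner a of (\<sigma>, j) \<Rightarrow> d \<sigma> j) = (case a of (\<sigma>, j) \<Rightarrow> d \<sigma> j)"
      unfolding ab(2) by (simp add: ab(1))
  qed (use pp pN in auto)
  then have "(\<Sum>a\<in>N. case a of (\<sigma>, j) \<Rightarrow> d \<sigma> j) = 0" by (simp add: sum_negf)
  moreover have "free_sides \<subseteq> P \<times> {..<3}" by (auto simp: free_sides_def)
  ultimately show ?thesis
    using total sum.subset_diff[of free_sides "P \<times> {..<3}" "\<lambda>(\<sigma>, j). d \<sigma> j"] fin by (simp add: N_def)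
qed

text \<open>If two different triangles meet in a common side, this side is not free; a point of the
  intersection therefore lies on two different sides of \<open>\<sigma>\<close>.\<close>

lemma free_sides_meet_in_vertices:
  assumes a: "(\<sigma>, j) \<in> free_sides" and b: "(\<tau>, k) \<in> free_sides" and ne: "(\<sigma>, j) \<noteq> (\<tau>, k)"
    and x: "x \<in> path_image (side \<sigma> j)" "x \<in> path_image (side \<tau> k)"
  shows "x \<in> triangle_vertices \<sigma>"
proof (cases "\<sigma> = \<tau>")
  case True
  interpret inj_triangle \<sigma> using a triangle by (auto simp: free_sides_def)
  show ?thesis using side_Int[of j k x] a b ne x True by (auto simp: free_sides_def)
next
  case False
  have s: "\<sigma> \<in> P" "j < 3" and t: "\<tau> \<in> P" "k < 3" using a b by (auto simp: free_sides_def)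
  interpret inj_triangle \<sigma> by (rule triangle[OF s(1)])
  have xin: "x \<in> \<sigma> ` std_triangle \<inter> \<tau> ` std_triangle"
    using x path_image_side_subset[OF s(2), of \<sigma>] path_image_side_subset[OF t(2), of \<tau>] by blast
  show ?thesis
  proof (rule triangles_meet[OF s(1) t(1) False])
    fix y assume y: "y \<in> triangle_vertices \<sigma>" "\<sigma> ` std_triangle \<inter> \<tau> ` std_triangle = {y}"
    then show ?thesis using xin unfolding y(2) by blast
  next
    fix j' k' assume *: "j' < 3" "k' < 3" "path_image (side \<sigma> j') = path_image (side \<tau> k')"
      "\<sigma> ` std_triangle \<inter> \<tau> ` std_triangle = path_image (side \<sigma> j')"
    have "j' \<noteq> j"
    proof
      assume "j' = j"
      then have "matching (\<sigma>, j) (\<tau>, k')" using * t(1) False by (auto simp: matching_def)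
      then show False using a by (auto simp: free_sides_def)
    qed
    moreover have "x \<in> path_image (side \<sigma> j')" using xin *(4) by blast
    ultimately show ?thesis using side_Int[OF s(2) *(1)] x(1) by blast
  qed (use xin in auto)
qed

end

section \<open>Periods along the edge of a surface\<close>

text \<open>The proof compares the primitives \<open>q \<sigma>\<close> on the triangles with a primitive \<open>u\<close> on the loop without
  a non-vertex point \<open>z\<close>. The increments \<open>d \<sigma> j\<close> of \<open>q \<sigma> - u\<close> along the free sides add up to zero,
  and they vanish for all sides but the one through \<open>z\<close>, hence for this one, too. So \<open>q \<sigma>0 - u\<close>
  takes the same constant value on both parts of this side, whereas its values just before and just after
  \<open>z\<close> differ by the period.\<close>

lemma (in oriented_surface) loop_period_zero:
  fixes \<omega> :: "real^3 \<Rightarrow> real^3 \<Rightarrow> complex"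
  assumes ex: "locally_exact \<omega> \<Omega>" and carrier: "surface_carrier P \<subseteq> \<Omega>"
    and \<gamma>: "simple_path \<gamma>" "pathfinish \<gamma> = pathstart \<gamma>" and edge: "surface_edge P = path_image \<gamma>"
    and h: "primitive_along \<omega> \<gamma> {0..1} h"
  shows "h 1 = h 0"
proof -
  have c\<gamma>: "continuous_on {0..1} \<gamma>" using \<gamma>(1) by (simp add: simple_path_def path_def)
  define S where "S = (\<Union>\<sigma>\<in>P. triangle_vertices \<sigma>)"
  have finS: "finite S" using finite_P finite_triangle_vertices by (simp add: S_def)
  have "inj_on \<gamma> {0<..<1}"
  proof (rule inj_onI)
    fix s t assume "s \<in> {0<..<1}" "t \<in> {0<..<1}" "\<gamma> s = \<gamma> t"
    then show "s = t" using simple_path_eqD[OF \<gamma>(1), of s t] by auto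
  qed
  then have "infinite (\<gamma> ` {0<..<1})" by (simp add: finite_image_iff)
  then have "\<not> \<gamma> ` {0<..<1} \<subseteq> S" using finS finite_subset by blast
  then obtain y where "y \<in> \<gamma> ` {0<..<1}" "y \<notin> S" by blast
  then obtain t0 where t0: "0 < t0" "t0 < 1" and zS: "\<gamma> t0 \<notin> S" by auto
  define z where "z = \<gamma> t0"
  have "z \<in> surface_edge P" using t0 by (auto simp: edge z_def path_image_def)
  then obtain \<sigma>0 j0 where f0: "(\<sigma>0, j0) \<in> free_sides" and z0: "z \<in> path_image (side \<sigma>0 j0)"
    unfolding surface_edge_eq by auto
  have s0: "\<sigma>0 \<in> P" "j0 < 3" using f0 by (auto simp: free_sides_def)
  define s where "s = side \<sigma>0 j0"
  have others: "z \<notin> path_image (side \<tau> k)" if "(\<tau>, k) \<in> free_sides" "(\<tau>, k) \<noteq> (\<sigma>0, j0)" for \<tau> k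
    using free_sides_meet_in_vertices[OF f0 that(1) that(2)[symmetric] z0] zS s0(1)
    by (auto simp: S_def z_def)
  have free_sub: "path_image (side \<tau> k) \<subseteq> path_image \<gamma>" if "(\<tau>, k) \<in> free_sides" for \<tau> k
    using that unfolding edge[symmetric] surface_edge_eq by auto
  have "\<exists>q. primitive_along \<omega> (\<lambda>x. x) (\<sigma> ` std_triangle) q" if "\<sigma> \<in> P" for \<sigma>
    using triangle[OF that] carrier that
    by (intro primitive_on_compact_convex_image[OF ex] std_triangle_compact_convex)
      (auto simp: inj_triangle_def surface_carrier_def)
  then have "\<forall>\<sigma>\<in>P. \<exists>q. primitive_along \<omega> (\<lambda>x. x) (\<sigma> ` std_triangle) q" by blast
  from bchoice[OF this] obtain q
    where q: "\<And>\<sigma>. \<sigma> \<in> P \<Longrightarrow> primitive_along \<omega> (\<lambda>x. x) (\<sigma> ` std_triangle) (q \<sigma>)" by blast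
  obtain u where u: "primitive_along \<omega> (\<lambda>x. x) (path_image \<gamma> - {z}) u"
      "\<And>t. t0 < t \<Longrightarrow> t \<le> 1 \<Longrightarrow> u (\<gamma> t) = h t"
      "\<And>t. 0 \<le> t \<Longrightarrow> t < t0 \<Longrightarrow> u (\<gamma> t) = h t + (h 1 - h 0)"
    unfolding z_def using primitive_on_punctured_loop[OF \<gamma> h t0] by blast
  have q_side: "primitive_along \<omega> (\<lambda>x. x) (path_image (side \<sigma> j)) (q \<sigma>)" if "\<sigma> \<in> P" "j < 3" for \<sigma> j
    by (rule primitive_along_subset[OF q[OF that(1)] path_image_side_subset[OF that(2)]])
  have conn: "connected (path_image (side \<sigma> j))" if "\<sigma> \<in> P" "j < 3" for \<sigma> j
    using inj_triangle.side_continuous[OF triangle[OF that(1)] that(2)]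
    by (intro connected_path_image) (simp add: path_def)
  have ends: "side \<sigma> j 0 \<in> path_image (side \<sigma> j)" "side \<sigma> j 1 \<in> path_image (side \<sigma> j)" for \<sigma> j
    by (auto simp: path_image_def)
  define d where "d \<sigma> j = (q \<sigma> (side \<sigma> j 1) - u (side \<sigma> j 1)) - (q \<sigma> (side \<sigma> j 0) - u (side \<sigma> j 0))" for \<sigma> j
  have total: "(\<Sum>(\<sigma>, j)\<in>free_sides. d \<sigma> j) = 0"
  proof (rule sum_free_sides)
    fix \<sigma>
    show "d \<sigma> 0 + d \<sigma> 1 + d \<sigma> 2 = 0"
      by (simp add: d_def side_endpoints numeral_2_eq_2 [symmetric])
  next
    fix \<sigma> \<tau> j k
    assume A: "\<sigma> \<in> P" "\<tau> \<in> P" "\<sigma> \<noteq> \<tau>" "j < 3" "k < (3::nat)"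
      and eq: "path_image (side \<sigma> j) = path_image (side \<tau> k)"
    have "q \<sigma> (side \<sigma> j 0) - q \<tau> (side \<sigma> j 0) = q \<sigma> (side \<sigma> j 1) - q \<tau> (side \<sigma> j 1)"
      by (rule primitive_along_unique[OF q_side[OF A(1,4)] q_side[OF A(2,5), folded eq] conn[OF A(1,4)] _ ends])
        auto
    then show "d \<tau> k = - d \<sigma> j"
      using shared_side_opposite[OF A eq] by (simp add: d_def algebra_simps)
  qed
  have others_zero: "d \<tau> k = 0" if f: "(\<tau>, k) \<in> free_sides - {(\<sigma>0, j0)}" for \<tau> k
  proof -
    have tk: "\<tau> \<in> P" "k < 3" using f by (auto simp: free_sides_def)
    have "path_image (side \<tau> k) \<subseteq> path_image \<gamma> - {z}" using free_sub[of \<tau> k] others[of \<tau> k] f by auto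
    then have "primitive_along \<omega> (\<lambda>x. x) (path_image (side \<tau> k)) u" by (rule primitive_along_subset[OF u(1)])
    from primitive_along_unique[OF q_side[OF tk] this conn[OF tk] _ ends] show ?thesis
      by (simp add: d_def)
  qed
  have "(\<Sum>(\<sigma>, j)\<in>free_sides - {(\<sigma>0, j0)}. d \<sigma> j) = 0"
    using others_zero by (intro sum.neutral) auto
  then have d0: "d \<sigma>0 j0 = 0"
    using total sum.remove[OF finite_free_sides f0, of "\<lambda>(\<sigma>, j). d \<sigma> j"] by simp
  interpret inj_triangle \<sigma>0 by (rule triangle[OF s0(1)])
  obtain r where r: "r \<in> {0..1}" "z = s r" using z0 by (auto simp: path_image_def s_def)
  have "z \<notin> triangle_vertices \<sigma>0" using zS s0(1) by (auto simp: S_def z_def)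
  then have "r \<noteq> 0" "r \<noteq> 1" using side_vertices(1)[OF s0(2), of \<sigma>0] side_vertices(2)[of \<sigma>0 j0] r(2) by (auto simp: s_def)
  then have r01: "0 < r" "r < 1" using r(1) by auto
  define g where "g x = q \<sigma>0 x - u x" for x
  have const: "g (s a) = g (s b)" if "J \<subseteq> {0..1} - {r}" "connected J" "a \<in> J" "b \<in> J" for J a b
  proof -
    have "connected (s ` J)"
      using that(1) side_continuous[OF s0(2)]
      by (intro connected_continuous_image[OF _ that(2)]) (auto simp: s_def intro: continuous_on_subset)
    moreover have sub: "s ` J \<subseteq> path_image s - {z}"
      using that(1) side_inj[OF s0(2)] r by (auto simp: path_image_def s_def subset_iff)
    ultimately show ?thesis
      unfolding g_def
      using sub free_sub[OF f0] that(3,4)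
      by (intro primitive_along_unique[where K = "s ` J", OF primitive_along_subset[OF q_side[OF s0]]
            primitive_along_subset[OF u(1)]]) (auto simp: s_def)
  qed
  have g01: "g (s 0) = g (s 1)" using d0 by (simp add: d_def g_def s_def)
  have g_const: "g y = g (s 0)" if y: "y \<in> path_image s" "y \<noteq> z" for y
  proof -
    obtain a where a: "a \<in> {0..1}" "y = s a" using y(1) by (auto simp: path_image_def)
    then have "a \<noteq> r" using y(2) r(2) by auto
    then consider "a < r" | "a > r" by linarith
    then show ?thesis
    proof cases
      case 1
      then have "{0..a} \<subseteq> {0..1} - {r}" using r01 by auto
      then show ?thesis using const[of "{0..a}" a 0] a by auto
    next
      case 2
      then have "{a..1} \<subseteq> {0..1} - {r}" using r01 by auto
      then show ?thesis using const[of "{a..1}" a 1] a g01 by auto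
    qed
  qed
  \<comment> \<open>the other free sides are closed and miss \<open>z\<close>, so near \<open>z\<close> the loop runs in \<open>s\<close>\<close>
  have near_s: "\<forall>\<^sub>F y in nhds z. y \<in> path_image \<gamma> \<longrightarrow> y \<in> path_image s"
  proof -
    let ?C = "\<Union>(\<tau>, k)\<in>free_sides - {(\<sigma>0, j0)}. path_image (side \<tau> k)"
    have "closed (path_image (side \<tau> k))" if "(\<tau>, k) \<in> free_sides" for \<tau> k
      using that inj_triangle.side_continuous[OF triangle, of \<tau> k]
      by (intro closed_path_image) (auto simp: path_def free_sides_def)
    then have "closed ?C" using finite_free_sides by (intro closed_UN) auto
    then have "open (- ?C)" by (rule open_Compl)
    moreover have "z \<in> - ?C" using others by auto
    ultimately have "\<forall>\<^sub>F y in nhds z. y \<in> - ?C" by (rule eventually_nhds_in_open)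
    then show ?thesis
      unfolding edge[symmetric] surface_edge_eq s_def by eventually_elim auto
  qed
  obtain p where p: "primitive_at \<omega> z p" "\<forall>\<^sub>F y in nhds z. y \<in> path_image s \<longrightarrow> q \<sigma>0 y = p y"
    using q_side[OF s0] z0 unfolding primitive_along_def s_def by blast
  obtain p' where p': "primitive_at \<omega> z p'" "\<forall>\<^sub>F t in nhds t0. t \<in> {0..1} \<longrightarrow> h t = p' (\<gamma> t)"
    using h t0 unfolding primitive_along_def z_def by force
  define k where "k = p z - p' z"
  have "\<forall>\<^sub>F y in nhds z. y \<in> path_image \<gamma> \<longrightarrow> y \<in> path_image s \<and> q \<sigma>0 y - p' y = k"
    using near_s p(2) primitive_at_diff_const[OF p(1) p'(1)] unfolding k_def by eventually_elim auto
  then have "\<forall>\<^sub>F t in nhds t0. t \<in> {0..1} \<longrightarrow> \<gamma> t \<in> path_image \<gamma> \<longrightarrow>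
      \<gamma> t \<in> path_image s \<and> q \<sigma>0 (\<gamma> t) - p' (\<gamma> t) = k"
    using t0 by (intro eventually_nhds_compose_within[OF c\<gamma>]) (auto simp: z_def)
  then have "\<forall>\<^sub>F t in nhds t0. t \<in> {0..1} \<longrightarrow> \<gamma> t \<in> path_image s \<and> q \<sigma>0 (\<gamma> t) - h t = k"
    using p'(2) by eventually_elim (auto simp: path_image_def)
  then obtain e where e: "e > 0" "\<And>t. dist t t0 < e \<Longrightarrow> t \<in> {0..1} \<Longrightarrow>
      \<gamma> t \<in> path_image s \<and> q \<sigma>0 (\<gamma> t) - h t = k"
    unfolding eventually_nhds_metric by blast
  have neq: "\<gamma> t \<noteq> z" if "t \<in> {0..1}" "t \<noteq> t0" for t
    using simple_path_eqD[OF \<gamma>(1) that(1), of t0] that t0 unfolding z_def by auto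
  \<comment> \<open>parameters just before and just after \<open>z\<close>\<close>
  define t1 where "t1 = t0 - min (e / 2) t0"
  define t2 where "t2 = t0 + min (e / 2) (1 - t0)"
  have t1: "t1 \<in> {0..1}" "t1 < t0" "dist t1 t0 < e"
    using e(1) t0 by (auto simp: t1_def dist_real_def min_def)
  have t2: "t2 \<in> {0..1}" "t0 < t2" "dist t2 t0 < e"
    using e(1) t0 by (auto simp: t2_def dist_real_def min_def)
  have "g (\<gamma> t1) = g (s 0)" "g (\<gamma> t2) = g (s 0)"
    using e(2)[OF t1(3,1)] e(2)[OF t2(3,1)] neq[of t1] neq[of t2] t1 t2 by (auto intro!: g_const)
  moreover have "g (\<gamma> t1) = k - (h 1 - h 0)"
    using e(2)[OF t1(3,1)] u(3)[of t1] t1 by (simp add: g_def algebra_simps)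
  moreover have "g (\<gamma> t2) = k"
    using e(2)[OF t2(3,1)] u(2)[of t2] t2 by (simp add: g_def)
  ultimately show ?thesis by simp
qed

section \<open>Forms that arise from directional derivatives\<close>

lemma directional_derivs_zero_imp_has_derivative_zero:
  fixes \<phi> :: "'a::real_normed_vector \<Rightarrow> complex"
  assumes "((\<lambda>\<epsilon>. (\<phi> (v + \<epsilon> *\<^sub>R h) - \<phi> v) / of_real \<epsilon>) \<longlongrightarrow> 0) (at_right 0)"
    and "((\<lambda>\<epsilon>. (\<phi> (v + \<epsilon> *\<^sub>R (- h)) - \<phi> v) / of_real \<epsilon>) \<longlongrightarrow> 0) (at_right 0)"
  shows "((\<lambda>\<epsilon>. \<phi> (v + \<epsilon> *\<^sub>R h)) has_derivative (\<lambda>_. 0)) (at 0)"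
proof -
  have "((\<lambda>\<epsilon>. norm (\<phi> (v + \<epsilon> *\<^sub>R h) - \<phi> v) / norm \<epsilon>) \<longlongrightarrow> 0) (at_right 0)"
    using tendsto_norm_zero[OF assms(1)] by (simp add: norm_divide)
  moreover have "((\<lambda>\<epsilon>. norm (\<phi> (v + \<epsilon> *\<^sub>R h) - \<phi> v) / norm \<epsilon>) \<longlongrightarrow> 0) (at_left 0)"
    unfolding filterlim_at_left_to_right
    using tendsto_norm_zero[OF assms(2)] by (simp add: norm_divide)
  ultimately have "((\<lambda>\<epsilon>. norm (\<phi> (v + \<epsilon> *\<^sub>R h) - \<phi> v) / norm \<epsilon>) \<longlongrightarrow> 0) (at 0)"
    by (rule filterlim_split_at[rotated])
  then show ?thesis by (simp add: has_derivative_iff_norm)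
qed

text \<open>In the directions of the fibre both one-sided derivatives vanish.\<close>

lemma constant_along_fibres:
  fixes \<phi> :: "'a::real_normed_vector \<Rightarrow> complex"
  assumes L: "bounded_linear L" and C: "convex C"
    and dir: "\<And>v. v \<in> C \<Longrightarrow> \<exists>c. \<forall>h. ((\<lambda>\<epsilon>. (\<phi> (v + \<epsilon> *\<^sub>R h) - \<phi> v) / of_real \<epsilon>) \<longlongrightarrow> c * L h) (at_right 0)"
    and xy: "x \<in> C" "y \<in> C" "L x = L y"
  shows "\<phi> x = \<phi> y"
proof -
  interpret L: bounded_linear L by fact
  define h where "h = y - x"
  have Lh: "L h = 0" "L (- h) = 0" using xy(3) by (simp_all add: h_def L.diff)
  have "\<phi> (x + 0 *\<^sub>R h) = \<phi> (x + 1 *\<^sub>R h)"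
  proof (rule has_derivative_zero_unique[of "{0..1::real}" "\<lambda>t. \<phi> (x + t *\<^sub>R h)"])
    fix t :: real assume t: "t \<in> {0..1}"
    have "x + t *\<^sub>R h = (1 - t) *\<^sub>R x + t *\<^sub>R y" by (simp add: h_def algebra_simps)
    then have "x + t *\<^sub>R h \<in> C" using t xy C by (simp add: convexD_alt)
    from dir[OF this] obtain c where
      c: "\<And>k. ((\<lambda>\<epsilon>. (\<phi> (x + t *\<^sub>R h + \<epsilon> *\<^sub>R k) - \<phi> (x + t *\<^sub>R h)) / of_real \<epsilon>) \<longlongrightarrow> c * L k) (at_right 0)"
      by blast
    have "((\<lambda>\<epsilon>. \<phi> (x + t *\<^sub>R h + \<epsilon> *\<^sub>R h)) has_derivative (\<lambda>_. 0)) (at (t - t))"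
      using directional_derivs_zero_imp_has_derivative_zero[of \<phi> "x + t *\<^sub>R h" h] c[of h] c[of "- h"]
      by (simp add: Lh)
    then have "((\<lambda>s. \<phi> (x + t *\<^sub>R h + (s - t) *\<^sub>R h)) has_derivative (\<lambda>_. 0)) (at t)"
      by (rule has_derivative_compose[of "\<lambda>s. s - t" "\<lambda>s. s", rotated])
        (auto intro!: derivative_eq_intros)
    moreover have "x + t *\<^sub>R h + (s - t) *\<^sub>R h = x + s *\<^sub>R h" for s by (simp add: algebra_simps)
    ultimately show "((\<lambda>t. \<phi> (x + t *\<^sub>R h)) has_derivative (\<lambda>_. 0)) (at t within {0..1})"
      by (simp add: has_derivative_at_withinI)
  qed auto
  then show ?thesis by (simp add: h_def)
qed

text \<open>With a linear right inverse \<open>g\<close> of \<open>L\<close>, the function \<open>\<phi>\<close> is locally \<open>F \<circ> L\<close> for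
  \<open>F w = \<phi> (v0 + g (w - L v0))\<close>. The directional derivatives of \<open>F\<close> are complex-linear, so \<open>F\<close>
  is holomorphic and has a holomorphic primitive \<open>G\<close>; then \<open>G \<circ> L\<close> is a primitive of the form.\<close>

lemma directionally_monogenic_imp_locally_exact:
  fixes \<phi> :: "'a::euclidean_space \<Rightarrow> complex"
  assumes \<Omega>: "open \<Omega>" and \<phi>: "continuous_on \<Omega> \<phi>" and L: "bounded_linear L" "surj L"
    and dir: "\<And>v. v \<in> \<Omega> \<Longrightarrow> \<exists>c. \<forall>h. ((\<lambda>\<epsilon>. (\<phi> (v + \<epsilon> *\<^sub>R h) - \<phi> v) / of_real \<epsilon>) \<longlongrightarrow> c * L h) (at_right 0)"
  shows "locally_exact (\<lambda>v w. \<phi> v * L w) \<Omega>"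
  unfolding locally_exact_def
proof
  interpret L: bounded_linear L by fact
  fix v0 assume "v0 \<in> \<Omega>"
  then obtain r where r: "r > 0" "ball v0 r \<subseteq> \<Omega>" using \<Omega> openE by blast
  have fibre: "\<phi> x = \<phi> y" if "x \<in> ball v0 r" "y \<in> ball v0 r" "L x = L y" for x y
    by (rule constant_along_fibres[OF L(1) convex_ball dir that]) (use r(2) in blast)
  obtain g where g: "linear g" "L \<circ> g = id"
    using linear_surjective_right_inverse[OF L.linear L(2)] by blast
  have bg: "bounded_linear g" using g(1) by (simp add: linear_conv_bounded_linear)
  interpret g: bounded_linear g by (rule bg)
  have Lg: "L (g w) = w" for w using g(2) by (metis comp_apply id_apply)
  define lift where "lift w = v0 + g (w - L v0)" for w
  have clift: "continuous_on S lift" for S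
    unfolding lift_def by (intro continuous_intros g.continuous_on)
  have Llift: "L (lift w) = w" for w by (simp add: lift_def L.add Lg)
  have "open (lift -` ball v0 r)" by (rule open_vimage[OF open_ball clift])
  moreover have "L v0 \<in> lift -` ball v0 r" using r(1) by (simp add: lift_def g.zero)
  ultimately obtain \<rho> where \<rho>: "\<rho> > 0" "ball (L v0) \<rho> \<subseteq> lift -` ball v0 r" using openE by blast
  have lift_in: "lift w \<in> ball v0 r" if "w \<in> ball (L v0) \<rho>" for w using that \<rho>(2) by blast
  define F where "F w = \<phi> (lift w)" for w
  have "F holomorphic_on ball (L v0) \<rho>"
  proof (rule directionally_differentiable_imp_holomorphic)
    show "continuous_on (ball (L v0) \<rho>) F"
      unfolding F_def by (rule continuous_on_compose2[OF \<phi> clift]) (use lift_in r(2) in blast)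
    fix z assume "z \<in> ball (L v0) \<rho>"
    then have "lift z \<in> \<Omega>" using lift_in r(2) by blast
    from dir[OF this] obtain c where
      c: "\<And>h. ((\<lambda>\<epsilon>. (\<phi> (lift z + \<epsilon> *\<^sub>R h) - \<phi> (lift z)) / of_real \<epsilon>) \<longlongrightarrow> c * L h) (at_right 0)" by blast
    have step: "lift (z + of_real t * w) = lift z + t *\<^sub>R g w" for t w
    proof -
      have "z + of_real t * w - L v0 = (z - L v0) + t *\<^sub>R w" by (simp add: scaleR_conv_of_real)
      then have "g (z + of_real t * w - L v0) = g (z - L v0) + t *\<^sub>R g w" by (simp only: g.add g.scaleR)
      then show ?thesis by (simp add: lift_def)
    qed
    have "((\<lambda>t. (F (z + of_real t * w) - F z) / of_real t) \<longlongrightarrow> c * w) (at_right 0)" for w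
      using c[of "g w"] by (simp add: F_def step Lg)
    then show "\<exists>c. \<forall>w. ((\<lambda>t. (F (z + of_real t * w) - F z) / of_real t) \<longlongrightarrow> c * w) (at_right 0)" by blast
  qed auto
  then obtain G where G: "\<And>w. w \<in> ball (L v0) \<rho> \<Longrightarrow> (G has_field_derivative F w) (at w within ball (L v0) \<rho>)"
    using holomorphic_convex_primitive'[of "ball (L v0) \<rho>" F] by auto
  have "primitive_at (\<lambda>v w. \<phi> v * L w) v0 (\<lambda>v. G (L v))"
    unfolding primitive_at_def
  proof -
    have "\<forall>\<^sub>F v in nhds v0. v \<in> ball v0 r" using r(1) by (intro eventually_nhds_in_open) auto
    moreover have "open (L -` ball (L v0) \<rho>)" by (rule open_vimage) (auto intro: L.continuous_on)
    then have "\<forall>\<^sub>F v in nhds v0. v \<in> L -` ball (L v0) \<rho>"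
      using \<rho>(1) by (intro eventually_nhds_in_open) auto
    ultimately show "\<forall>\<^sub>F v in nhds v0. ((\<lambda>v. G (L v)) has_derivative (\<lambda>w. \<phi> v * L w)) (at v)"
    proof eventually_elim
      case (elim v)
      then have Lv: "L v \<in> ball (L v0) \<rho>" by simp
      have "(G has_derivative (*) (F (L v))) (at (L v))"
        using G[OF Lv] Lv at_within_open[OF Lv open_ball] by (simp add: has_field_derivative_def)
      then have "((\<lambda>v. G (L v)) has_derivative (\<lambda>w. F (L v) * L w)) (at v)"
        by (rule has_derivative_compose[OF L.has_derivative[OF has_derivative_ident]])
      moreover have "F (L v) = \<phi> v"
        unfolding F_def using lift_in[OF Lv] elim(1) by (intro fibre) (auto simp: Llift)
      ultimately show ?case by simp
    qed
  qed
  then show "\<exists>p. primitive_at (\<lambda>v w. \<phi> v * L w) v0 p" by blast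
qed

section \<open>Components of monogenic mappings\<close>

lemma bounded_linear_qcoord: "bounded_linear (qcoord k)"
proof (rule bounded_linear_intro[where K = 2])
  fix p q :: cquat and r :: real
  show "qcoord k (p + q) = qcoord k p + qcoord k q"
    by (simp add: qcoord_def plus_cquat_def algebra_simps)
  show "qcoord k (r *\<^sub>R p) = r *\<^sub>R qcoord k p"
    by (simp add: qcoord_def scaleR_cquat_def algebra_simps)
  have n: "norm (cq1 p) \<le> norm p" "norm (cqI p) \<le> norm p" "norm (cqJ p) \<le> norm p" "norm (cqK p) \<le> norm p"
    unfolding norm_cquat_def
    by (metis fst_conv snd_conv norm_fst_le norm_snd_le order_trans)+
  show "norm (qcoord k p) \<le> norm p * 2"
    using n norm_triangle_ineq4[of "cq1 p" "\<i> * cqI p"] norm_triangle_ineq[of "cq1 p" "\<i> * cqI p"]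
      norm_triangle_ineq4[of "- \<i> * cqJ p" "cqK p"] norm_triangle_ineq[of "- \<i> * cqJ p" "cqK p"]
    by (auto simp: qcoord_def norm_mult)
qed

text \<open>A quaternion without \<open>J\<close> and \<open>K\<close> parts is a combination of the idempotents \<open>e\<^sub>1\<close> and \<open>e\<^sub>2\<close>, so
  multiplication by it is diagonal. From the left the components 1 and 3 get the same factor, from the right the
  components 1 and 4.\<close>

lemma qcoord_mult_diagonal:
  assumes "cqJ x = 0" "cqK x = 0"
  shows "qcoord 1 (x * p) = qcoord 1 x * qcoord 1 p" "qcoord 3 (x * p) = qcoord 1 x * qcoord 3 p"
    "qcoord 2 (x * p) = qcoord 2 x * qcoord 2 p" "qcoord 4 (x * p) = qcoord 2 x * qcoord 4 p"
    "qcoord 1 (p * x) = qcoord 1 p * qcoord 1 x" "qcoord 4 (p * x) = qcoord 4 p * qcoord 1 x"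
    "qcoord 2 (p * x) = qcoord 2 p * qcoord 2 x" "qcoord 3 (p * x) = qcoord 3 p * qcoord 2 x"
  using assms by (simp_all add: qcoord_def times_cquat_def algebra_simps)

lemma scaleC_combine:
  "x *\<^sub>C p + y *\<^sub>C (c *\<^sub>C p) + z *\<^sub>C (d *\<^sub>C p) = (x + c * y + d * z) *\<^sub>C p"
  by (simp add: scaleC_def plus_cquat_def algebra_simps)

lemma diagonal_mult_qe:
  assumes "x = a *\<^sub>C qe1 + b *\<^sub>C qe2"
  shows "x * qe 1 = a *\<^sub>C qe 1" "x * qe 2 = b *\<^sub>C qe 2" "x * qe 3 = a *\<^sub>C qe 3" "x * qe 4 = b *\<^sub>C qe 4"
    "qe 1 * x = a *\<^sub>C qe 1" "qe 2 * x = b *\<^sub>C qe 2" "qe 3 * x = b *\<^sub>C qe 3" "qe 4 * x = a *\<^sub>C qe 4"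
  by (simp_all add: assms qe_def qe_defs quI_def quJ_def quK_def scaleC_def one_cquat_def
      plus_cquat_def minus_cquat_def times_cquat_def field_simps)

context oriented_surface
begin

lemma directionally_monogenic_line_integral_zero:
  fixes \<phi> :: "real^3 \<Rightarrow> complex"
  assumes \<Omega>: "open \<Omega>" and carrier: "surface_carrier P \<subseteq> \<Omega>"
    and \<gamma>: "simple_path \<gamma>" "pathfinish \<gamma> = pathstart \<gamma>" "rectifiable \<gamma>"
    and edge: "surface_edge P = path_image \<gamma>"
    and \<phi>: "continuous_on \<Omega> \<phi>" and L: "bounded_linear L" "surj L"
    and dir: "\<And>v. v \<in> \<Omega> \<Longrightarrow> \<exists>c. \<forall>h. ((\<lambda>\<epsilon>. (\<phi> (v + \<epsilon> *\<^sub>R h) - \<phi> v) / of_real \<epsilon>) \<longlongrightarrow> c * L h) (at_right 0)"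
  shows "(\<Sum>j\<in>UNIV. L (axis j 1) * rs_integral (\<lambda>t. \<phi> (\<gamma> t)) (\<lambda>t. \<gamma> t $ j)) = 0"
proof -
  have ex: "locally_exact (\<lambda>v w. \<phi> v * L w) \<Omega>"
    by (rule directionally_monogenic_imp_locally_exact[OF \<Omega> \<phi> L dir])
  have "path_image \<gamma> \<subseteq> surface_carrier P"
    unfolding edge[symmetric] surface_edge_eq surface_carrier_def
    using path_image_side_subset by (fastforce simp: free_sides_def)
  then have im: "path_image \<gamma> \<subseteq> \<Omega>" using carrier by blast
  have "\<exists>h. primitive_along (\<lambda>v w. \<phi> v * L w) \<gamma> (cbox 0 (1::real)) h"
    by (rule primitive_along_cbox[OF ex]) (use \<gamma>(3) im in \<open>auto simp: rectifiable_def path_def path_image_def\<close>)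
  then obtain h where h: "primitive_along (\<lambda>v w. \<phi> v * L w) \<gamma> {0..1} h" by auto
  show ?thesis
    using line_integral_eq_primitive_increment[OF L(1) \<Omega> \<phi> \<gamma>(3) im h]
      loop_period_zero[OF ex carrier \<gamma>(1,2) edge h] by simp
qed

text \<open>The derivative is passed as the map \<open>D\<close>, which is \<open>h \<mapsto> h \<Phi>'\<close> for right monogenic and
  \<open>h \<mapsto> \<Phi>' h\<close> for left monogenic mappings.\<close>

lemma monogenic_component_line_integral_zero:
  fixes \<Psi> :: "cquat \<Rightarrow> cquat" and a b :: complex
  assumes \<Omega>: "open \<Omega>" and carrier: "surface_carrier P \<subseteq> \<Omega>"
    and \<gamma>: "simple_path \<gamma>" "pathfinish \<gamma> = pathstart \<gamma>" "rectifiable \<gamma>"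
    and edge: "surface_edge P = path_image \<gamma>"
    and surj: "surj (\<lambda>v :: real^3. of_real (v $ 1) + of_real (v $ 2) * a + of_real (v $ 3) * b)"
    and \<Psi>: "continuous_on \<Omega> (\<lambda>v. \<Psi> (zeta i2 i3 v))"
    and dir: "\<And>v. v \<in> \<Omega> \<Longrightarrow> \<exists>D c. (\<forall>h \<in> E3 i2 i3.
        ((\<lambda>\<epsilon>. (1 / \<epsilon>) *\<^sub>R (\<Psi> (zeta i2 i3 v + \<epsilon> *\<^sub>R h) - \<Psi> (zeta i2 i3 v))) \<longlongrightarrow> D h) (at_right 0)) \<and>
        (\<forall>w. qcoord k (D (zeta i2 i3 w)) = c * (of_real (w $ 1) + of_real (w $ 2) * a + of_real (w $ 3) * b))"
  shows "coord_integral i2 i3 \<gamma> \<Psi> k 1 + a * coord_integral i2 i3 \<gamma> \<Psi> k 2 + b * coord_integral i2 i3 \<gamma> \<Psi> k 3 = 0"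
proof -
  interpret qk: bounded_linear "qcoord k" by (rule bounded_linear_qcoord)
  define L where "L v = of_real (v $ 1) + of_real (v $ 2) * a + of_real (v $ 3) * b" for v :: "real^3"
  have L: "bounded_linear L"
    unfolding L_def
    by (intro bounded_linear_add bounded_linear_mult_const bounded_linear_compose[OF bounded_linear_of_real]
        bounded_linear_vec_nth)
  define \<phi> where "\<phi> v = qcoord k (\<Psi> (zeta i2 i3 v))" for v
  have zadd: "zeta i2 i3 (v + \<epsilon> *\<^sub>R h) = zeta i2 i3 v + \<epsilon> *\<^sub>R zeta i2 i3 h" for v h \<epsilon>
    by (simp add: zeta_def algebra_simps)
  have "(\<Sum>j\<in>UNIV. L (axis j 1) * rs_integral (\<lambda>t. \<phi> (\<gamma> t)) (\<lambda>t. \<gamma> t $ j)) = 0"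
  proof (rule directionally_monogenic_line_integral_zero[OF \<Omega> carrier \<gamma> edge _ L])
    show "continuous_on \<Omega> \<phi>" unfolding \<phi>_def by (rule qk.continuous_on[OF \<Psi>])
    show "surj L" using surj unfolding L_def .
    fix v assume "v \<in> \<Omega>"
    from dir[OF this] obtain D c where D:
      "\<And>h. h \<in> E3 i2 i3 \<Longrightarrow>
        ((\<lambda>\<epsilon>. (1 / \<epsilon>) *\<^sub>R (\<Psi> (zeta i2 i3 v + \<epsilon> *\<^sub>R h) - \<Psi> (zeta i2 i3 v))) \<longlongrightarrow> D h) (at_right 0)"
      "\<And>w. qcoord k (D (zeta i2 i3 w)) = c * L w"
      unfolding L_def by blast
    have quotient: "qcoord k ((1 / \<epsilon>) *\<^sub>R (\<Psi> (zeta i2 i3 v + \<epsilon> *\<^sub>R zeta i2 i3 w) - \<Psi> (zeta i2 i3 v)))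
        = (\<phi> (v + \<epsilon> *\<^sub>R w) - \<phi> v) / of_real \<epsilon>" for \<epsilon> w
      unfolding \<phi>_def zadd qk.scaleR qk.diff by (simp add: scaleR_conv_of_real divide_inverse mult.commute)
    have "((\<lambda>\<epsilon>. (\<phi> (v + \<epsilon> *\<^sub>R w) - \<phi> v) / of_real \<epsilon>) \<longlongrightarrow> c * L w) (at_right 0)" for w
      using qk.tendsto[OF D(1)[of "zeta i2 i3 w"]] unfolding quotient D(2) by (simp add: E3_def)
    then show "\<exists>c. \<forall>h. ((\<lambda>\<epsilon>. (\<phi> (v + \<epsilon> *\<^sub>R h) - \<phi> v) / of_real \<epsilon>) \<longlongrightarrow> c * L h) (at_right 0)" by blast
  qed
  moreover have "L (axis 1 1) = 1" "L (axis 2 1) = a" "L (axis 3 1) = b"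
    by (simp_all add: L_def axis_def)
  ultimately show ?thesis by (simp add: sum_3 coord_integral_def \<phi>_def)
qed

end

theorem theorem1:
  fixes \<Omega> :: "(real^3) set"
    and a1 a2 b1 b2 :: complex
    and i2 i3 :: cquat
    and \<Phi> \<Phi>h :: "cquat \<Rightarrow> cquat"
    and \<Sigma> :: "(real \<times> real \<Rightarrow> real^3) set"
    and \<gamma> :: "real \<Rightarrow> real^3"
  assumes "open \<Omega>" and "connected \<Omega>" and "\<Omega> \<noteq> {}"
    and "i2 = a1 *\<^sub>C qe1 + a2 *\<^sub>C qe2"
    and "i3 = b1 *\<^sub>C qe1 + b2 *\<^sub>C qe2"
    and "card {1, i2, i3} = 3" and "independent {1, i2, i3}"
    and "f1 ` E3 i2 i3 = UNIV" and "f2 ` E3 i2 i3 = UNIV"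
    and "right_G_monogenic i2 i3 \<Omega> \<Phi>"
    and "left_G_monogenic i2 i3 \<Omega> \<Phi>h"
    and "pw_smooth_oriented_surface \<Sigma>"
    and "surface_carrier \<Sigma> \<subseteq> \<Omega>"
    and "simple_path \<gamma>" and "pathfinish \<gamma> = pathstart \<gamma>" and "rectifiable \<gamma>"
    and "surface_edge \<Sigma> = path_image \<gamma>"
  shows "integral_dzeta_left i2 i3 \<gamma> \<Phi> = 0 \<and> integral_dzeta_right i2 i3 \<gamma> \<Phi>h = 0"
proof -
  interpret oriented_surface \<Sigma> by standard (rule assms(12))
  define z where "z = zeta i2 i3"
  define \<xi>1 where "\<xi>1 v = of_real (v $ 1) + of_real (v $ 2) * a1 + of_real (v $ 3) * b1" for v :: "real^3"
  define \<xi>2 where "\<xi>2 v = of_real (v $ 1) + of_real (v $ 2) * a2 + of_real (v $ 3) * b2" for v :: "real^3"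
  have z: "cqJ (z v) = 0" "cqK (z v) = 0" "qcoord 1 (z v) = \<xi>1 v" "qcoord 2 (z v) = \<xi>2 v"
      "qcoord 3 (z v) = 0" "qcoord 4 (z v) = 0" for v
    unfolding z_def \<xi>1_def \<xi>2_def zeta_def assms(4,5)
    by (simp_all add: qcoord_def qe_defs quI_def quJ_def quK_def scaleC_def scaleR_cquat_def one_cquat_def
        plus_cquat_def minus_cquat_def field_simps scaleR_conv_of_real)
  have surj1: "surj \<xi>1"
  proof -
    have "f1 (z v) = \<xi>1 v" for v unfolding f1_def z by simp
    then show ?thesis using assms(8) by (simp add: E3_def image_image flip: z_def)
  qed
  have surj2: "surj \<xi>2"
  proof -
    have "f2 (z v) = \<xi>2 v" for v unfolding f2_def z by simp
    then show ?thesis using assms(9) by (simp add: E3_def image_image flip: z_def)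
  qed
  note surface = assms(1,13-17)
  note qm = qcoord_mult_diagonal[OF z(1,2)]
  have R: "coord_integral i2 i3 \<gamma> \<Phi> k 1 + a * coord_integral i2 i3 \<gamma> \<Phi> k 2 + b * coord_integral i2 i3 \<gamma> \<Phi> k 3 = 0"
    if "k = 1 \<and> a = a1 \<and> b = b1 \<or> k = 3 \<and> a = a1 \<and> b = b1 \<or> k = 2 \<and> a = a2 \<and> b = b2 \<or> k = 4 \<and> a = a2 \<and> b = b2"
    for k a b
  proof (rule monogenic_component_line_integral_zero[OF surface])
    show "surj (\<lambda>v :: real^3. of_real (v $ 1) + of_real (v $ 2) * a + of_real (v $ 3) * b)"
      using that surj1 surj2 unfolding \<xi>1_def \<xi>2_def by auto
    show "continuous_on \<Omega> (\<lambda>v. \<Phi> (zeta i2 i3 v))" using assms(10) by (simp add: right_G_monogenic_def)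
    fix v assume "v \<in> \<Omega>"
    then obtain \<Phi>' where d: "\<forall>h \<in> E3 i2 i3. ((\<lambda>\<epsilon>. (1 / \<epsilon>) *\<^sub>R (\<Phi> (zeta i2 i3 v + \<epsilon> *\<^sub>R h) - \<Phi> (zeta i2 i3 v)))
        \<longlongrightarrow> h * \<Phi>') (at_right 0)"
      using assms(10) unfolding right_G_monogenic_def by blast
    have "qcoord k (z w * \<Phi>') = qcoord k \<Phi>' * (of_real (w $ 1) + of_real (w $ 2) * a + of_real (w $ 3) * b)" for w
      using that by (elim disjE conjE) (simp_all add: qm z \<xi>1_def \<xi>2_def del: One_nat_def)
    then show "\<exists>D c. (\<forall>h \<in> E3 i2 i3.
        ((\<lambda>\<epsilon>. (1 / \<epsilon>) *\<^sub>R (\<Phi> (zeta i2 i3 v + \<epsilon> *\<^sub>R h) - \<Phi> (zeta i2 i3 v))) \<longlongrightarrow> D h) (at_right 0)) \<and>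
        (\<forall>w. qcoord k (D (zeta i2 i3 w)) = c * (of_real (w $ 1) + of_real (w $ 2) * a + of_real (w $ 3) * b))"
      using d by (intro exI[of _ "\<lambda>h. h * \<Phi>'"] exI[of _ "qcoord k \<Phi>'"]) (simp flip: z_def)
  qed
  have Lf: "coord_integral i2 i3 \<gamma> \<Phi>h k 1 + a * coord_integral i2 i3 \<gamma> \<Phi>h k 2 + b * coord_integral i2 i3 \<gamma> \<Phi>h k 3 = 0"
    if "k = 1 \<and> a = a1 \<and> b = b1 \<or> k = 4 \<and> a = a1 \<and> b = b1 \<or> k = 2 \<and> a = a2 \<and> b = b2 \<or> k = 3 \<and> a = a2 \<and> b = b2"
    for k a b
  proof (rule monogenic_component_line_integral_zero[OF surface])
    show "surj (\<lambda>v :: real^3. of_real (v $ 1) + of_real (v $ 2) * a + of_real (v $ 3) * b)"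
      using that surj1 surj2 unfolding \<xi>1_def \<xi>2_def by auto
    show "continuous_on \<Omega> (\<lambda>v. \<Phi>h (zeta i2 i3 v))" using assms(11) by (simp add: left_G_monogenic_def)
    fix v assume "v \<in> \<Omega>"
    then obtain \<Phi>' where d: "\<forall>h \<in> E3 i2 i3. ((\<lambda>\<epsilon>. (1 / \<epsilon>) *\<^sub>R (\<Phi>h (zeta i2 i3 v + \<epsilon> *\<^sub>R h) - \<Phi>h (zeta i2 i3 v)))
        \<longlongrightarrow> \<Phi>' * h) (at_right 0)"
      using assms(11) unfolding left_G_monogenic_def by blast
    have "qcoord k (\<Phi>' * z w) = qcoord k \<Phi>' * (of_real (w $ 1) + of_real (w $ 2) * a + of_real (w $ 3) * b)" for w
      using that by (elim disjE conjE) (simp_all add: qm z \<xi>1_def \<xi>2_def del: One_nat_def)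
    then show "\<exists>D c. (\<forall>h \<in> E3 i2 i3.
        ((\<lambda>\<epsilon>. (1 / \<epsilon>) *\<^sub>R (\<Phi>h (zeta i2 i3 v + \<epsilon> *\<^sub>R h) - \<Phi>h (zeta i2 i3 v))) \<longlongrightarrow> D h) (at_right 0)) \<and>
        (\<forall>w. qcoord k (D (zeta i2 i3 w)) = c * (of_real (w $ 1) + of_real (w $ 2) * a + of_real (w $ 3) * b))"
      using d by (intro exI[of _ "\<lambda>h. \<Phi>' * h"] exI[of _ "qcoord k \<Phi>'"]) (simp flip: z_def)
  qed
  have zero: "0 *\<^sub>C p = 0" for p by (simp add: scaleC_def zero_cquat_def)
  have "integral_dzeta_left i2 i3 \<gamma> \<Phi> = 0"
    unfolding integral_dzeta_left_def sum_1_4 diagonal_mult_qe[OF assms(4)] diagonal_mult_qe[OF assms(5)]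
      scaleC_combine
    using R[of 1 a1 b1] R[of 2 a2 b2] R[of 3 a1 b1] R[of 4 a2 b2] by (simp add: zero)
  moreover have "integral_dzeta_right i2 i3 \<gamma> \<Phi>h = 0"
    unfolding integral_dzeta_right_def sum_1_4 diagonal_mult_qe[OF assms(4)] diagonal_mult_qe[OF assms(5)]
      scaleC_combine
    using Lf[of 1 a1 b1] Lf[of 2 a2 b2] Lf[of 3 a2 b2] Lf[of 4 a1 b1] by (simp add: zero)
  ultimately show ?thesis ..
qed

end
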